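(* Let $n,k\geq 0$ be integers. The polynomial $P(t)=(-1)^{n+k}(t-1)^n(t+1)^k$ is the Alexander polynomial of some Hurwitz $C$-group $G$ if and only if $n\geq k$.
   Context: **$C$-groups.** A $C$-group is a group $G$ together with a finite presentation (a $C$-presentation) on generators $x_1,\dots,x_m$ ($m\geq 1$) all of whose relations are conjugations between generators: $$G=G_W=\langle x_1,\dots,x_m \mid x_i=w_{i,j,k}^{-1}x_jw_{i,j,k},\ w_{i,j,k}\in W\rangle ,$$ where $W=\{w_{i,j,k}\in\mathbb F_m \mid 1\leq i,j\leq m,\ 1\leq k\leq \ell(i,j)\}$ is a finite family of elements (repetitions allowed) of the free group $\mathbb F_m$ on $x_1,\dots,x_m$, and $\ell(i,j)\ge 0$ are integers (if $\ell(i,j)=0$ there is no relation for the pair $(i,j)$). The images of $x_1,\dots,x_m$ in $G$ and all their conjugates are called the $C$-generators of $G$. A homomorphism of $C$-groups is a $C$-homomorphism if it sends $C$-generators to $C$-generators; $C$-groups are considered up to $C$-isomorphism. **Hurwitz $C$-groups.** A $C$-presentation $\langle x_1,\dots,x_m \mid x_i=w_{i,j,k}^{-1}x_jw_{i,j,k},\ w_{i,j,k}\in W\rangle$ is a Hurwitz $C$-presentation of degree $m$ if for each $i=1,\dots,m$ the word $w_{i,i,1}$ is the product $x_1x_2\cdots x_m$ (so the relations include that each $x_i$ commutes with $x_1\cdots x_m$). A $C$-group is a Hurwitz $C$-group if, for some $m$, it possesses a Hurwitz $C$-presentation of degree $m$. Equivalently, there are $C$-generators $x_1,\dots,x_m$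 generating $G$ (for some $m$) whose product $x_1\cdots x_m$ lies in the center of $G$. **Alexander polynomial.** For a $C$-group $G$ let $\nu:G\to\mathbb F_1\simeq \mathbb Z$ be the epimorphism sending every $C$-generator of $G$ to the fixed generator of the infinite cyclic group $\mathbb F_1$, and let $N=\ker\nu$, with commutator subgroup $N'$. Let $h$ be the automorphism of $N/N'$ induced by $g\mapsto \widetilde x^{-1}g\widetilde x$, $g\in N$, where $\widetilde x$ is any $C$-generator of $G$ (the result does not depend on $\widetilde x$), and let $h_{\mathbb C}$ be the induced automorphism of $(N/N')\otimes_{\mathbb Z}\mathbb C$. The Alexander polynomial of $G$ is $\Delta(t)=\det(h_{\mathbb C}-t\,\mathrm{Id})$ if $(N/N')\otimes\mathbb C$ is finite dimensional (equal to $1$ if this space is zero), and $\Delta(t)\equiv 0$ if it is infinite dimensional. *)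

theory Defs
  imports
    "HOL-Algebra.Elementary_Groups"
    "HOL-Algebra.Free_Abelian_Groups"
    "HOL-Algebra.Generated_Groups"
    "Jordan_Normal_Form.VS_Connect"
    "Jordan_Normal_Form.Determinant"
begin

section \<open>Free groups\<close>

text \<open>
  A letter \<open>(x, True)\<close> stands for the generator \<open>x\<close>, and \<open>(x, False)\<close> for its inverse.
  The free group on \<open>X\<close> consists of the reduced words in these letters, and the product is
  concatenation followed by free reduction.
\<close>

type_synonym 'a word = "('a \<times> bool) list"

definition cancels :: "'a \<times> bool \<Rightarrow> 'a \<times> bool \<Rightarrow> bool" where
  "cancels a b \<longleftrightarrow> fst a = fst b \<and> snd a \<noteq> snd b"

definition reduced :: "'a word \<Rightarrow> bool" where
  "reduced w \<longleftrightarrow> successively (\<lambda>a b. \<not> cancels a b) w"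

fun reduced_cons :: "'a \<times> bool \<Rightarrow> 'a word \<Rightarrow> 'a word" where
  "reduced_cons a [] = [a]"
| "reduced_cons a (b # w) = (if cancels a b then w else a # b # w)"

definition free_group :: "'a set \<Rightarrow> 'a word monoid" where
  "free_group X =
     \<lparr> carrier = {w. reduced w \<and> fst ` set w \<subseteq> X},
       mult = (\<lambda>u v. foldr reduced_cons u v),
       one = [] \<rparr>"

definition free_gen :: "'a \<Rightarrow> 'a word" where
  "free_gen x = [(x, True)]"

lemma reduced_reduced_cons: "reduced w \<Longrightarrow> reduced (reduced_cons a w)"
  by (cases w) (auto simp: reduced_def successively_Cons)

lemma reduced_foldr: "reduced v \<Longrightarrow> reduced (foldr reduced_cons u v)"
  by (induction u) (auto intro: reduced_reduced_cons)

lemma set_reduced_cons: "set (reduced_cons a w) \<subseteq> insert a (set w)"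
  by (cases w) auto

lemma set_foldr_reduced_cons: "set (foldr reduced_cons u v) \<subseteq> set u \<union> set v"
proof (induction u)
  case (Cons a u)
  then show ?case using set_reduced_cons[of a "foldr reduced_cons u v"] by auto
qed simp

lemma reduced_cons_cancel:
  assumes "cancels a b" "reduced w"
  shows "reduced_cons a (reduced_cons b w) = w"
proof (cases w)
  case Nil
  then show ?thesis using assms by simp
next
  case (Cons c v)
  show ?thesis
  proof (cases "cancels b c")
    case True
    then have "a = c" using assms(1) by (auto simp: cancels_def prod_eq_iff)
    then show ?thesis
      using True Cons assms(2) by (cases v) (auto simp: reduced_def successively_Cons)
  qed (use assms Cons in simp)
qed

lemma foldr_reduced_cons_assoc:
  assumes "reduced w"
  shows "foldr reduced_cons (foldr reduced_cons u v) w
       = foldr reduced_cons u (foldr reduced_cons v w)"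
proof (induction u)
  case (Cons a u)
  have "foldr reduced_cons (reduced_cons a t) w = reduced_cons a (foldr reduced_cons t w)" for t
  proof (cases t)
    case (Cons b s)
    show ?thesis
      using reduced_cons_cancel[of a b "foldr reduced_cons s w"] reduced_foldr[OF assms, of s]
      by (simp add: Cons)
  qed simp
  with Cons show ?case by simp
qed simp

lemma foldr_reduced_cons_Nil: "reduced w \<Longrightarrow> foldr reduced_cons w [] = w"
proof (induction w)
  case (Cons a w)
  then show ?case by (cases w) (auto simp: reduced_def successively_Cons)
qed simp

lemma free_group_left_inverse:
  assumes "reduced w" "fst ` set w \<subseteq> X"
  shows "\<exists>v. reduced v \<and> fst ` set v \<subseteq> X \<and> foldr reduced_cons v w = []"
  using assms
proof (induction w)
  case Nil
  show ?case by (rule exI[of _ "[]"]) (simp add: reduced_def)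
next
  case (Cons a w)
  then obtain v where v: "reduced v" "fst ` set v \<subseteq> X" "foldr reduced_cons v w = []"
    by (cases w) (auto simp: reduced_def successively_Cons)
  define b where "b = (fst a, \<not> snd a)"
  have ba: "cancels b a" by (simp add: b_def cancels_def)
  have r: "reduced [b]" by (simp add: reduced_def)
  have "foldr reduced_cons (foldr reduced_cons v [b]) (a # w)
      = foldr reduced_cons v (reduced_cons b (a # w))"
    using foldr_reduced_cons_assoc[OF Cons.prems(1), of v "[b]"] by simp
  also have "\<dots> = []" using ba v(3) by simp
  finally show ?case
    using reduced_foldr[OF r, of v] set_foldr_reduced_cons[of v "[b]"] v(2) Cons.prems(2)
    by (intro exI[of _ "foldr reduced_cons v [b]"]) (fastforce simp: b_def)
qed

lemma group_free_group: "group (free_group X)"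
proof (rule groupI)
  fix u v assume "u \<in> carrier (free_group X)" "v \<in> carrier (free_group X)"
  then show "u \<otimes>\<^bsub>free_group X\<^esub> v \<in> carrier (free_group X)"
    using set_foldr_reduced_cons[of u v]
    by (fastforce simp: free_group_def intro: reduced_foldr)
next
  fix u assume "u \<in> carrier (free_group X)"
  then show "\<exists>v\<in>carrier (free_group X). v \<otimes>\<^bsub>free_group X\<^esub> u = \<one>\<^bsub>free_group X\<^esub>"
    using free_group_left_inverse[of u X] by (auto simp: free_group_def)
qed (auto simp: free_group_def foldr_reduced_cons_assoc, auto simp: reduced_def)


section \<open>\<open>C\<close>-groups\<close>

definition normal_closure :: "('a, 'b) monoid_scheme \<Rightarrow> 'a set \<Rightarrow> 'a set" where
  "normal_closure G R =
     generate G {g \<otimes>\<^bsub>G\<^esub> r \<otimes>\<^bsub>G\<^esub> inv\<^bsub>G\<^esub> g | g r. g \<in> carrier G \<and> r \<in> R}"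

text \<open>
  A \<open>C\<close>-presentation is given by the number \<open>m\<close> of generators, the numbers \<open>l i j\<close> of relations
  for the pairs \<open>(i, j)\<close>, and the elements \<open>w i j k\<close> of the free group on \<open>{1..m}\<close>; values of
  \<open>l\<close> and \<open>w\<close> outside the index ranges are irrelevant.
\<close>

definition C_presentation ::
    "nat \<Rightarrow> (nat \<Rightarrow> nat \<Rightarrow> nat) \<Rightarrow> (nat \<Rightarrow> nat \<Rightarrow> nat \<Rightarrow> nat word) \<Rightarrow> bool" where
  "C_presentation m l w \<longleftrightarrow>
     m \<ge> 1 \<and>
     (\<forall>i\<in>{1..m}. \<forall>j\<in>{1..m}. \<forall>k\<in>{1..l i j}. w i j k \<in> carrier (free_group {1..m}))"

text \<open>The relation \<open>x\<^sub>i = w\<^sup>-\<^sup>1 x\<^sub>j w\<close> is encoded by the relator \<open>x\<^sub>i\<^sup>-\<^sup>1 w\<^sup>-\<^sup>1 x\<^sub>j w\<close>.\<close>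

definition C_relators ::
    "nat \<Rightarrow> (nat \<Rightarrow> nat \<Rightarrow> nat) \<Rightarrow> (nat \<Rightarrow> nat \<Rightarrow> nat \<Rightarrow> nat word) \<Rightarrow> nat word set" where
  "C_relators m l w =
     (let F = free_group {1..m} in
        {inv\<^bsub>F\<^esub> (free_gen i) \<otimes>\<^bsub>F\<^esub> (inv\<^bsub>F\<^esub> (w i j k) \<otimes>\<^bsub>F\<^esub> free_gen j \<otimes>\<^bsub>F\<^esub> w i j k) | i j k.
           i \<in> {1..m} \<and> j \<in> {1..m} \<and> k \<in> {1..l i j}})"

definition C_presented_group ::
    "nat \<Rightarrow> (nat \<Rightarrow> nat \<Rightarrow> nat) \<Rightarrow> (nat \<Rightarrow> nat \<Rightarrow> nat \<Rightarrow> nat word) \<Rightarrow> nat word set monoid" where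
  "C_presented_group m l w =
     free_group {1..m} Mod normal_closure (free_group {1..m}) (C_relators m l w)"

definition C_presented_gen ::
    "nat \<Rightarrow> (nat \<Rightarrow> nat \<Rightarrow> nat) \<Rightarrow> (nat \<Rightarrow> nat \<Rightarrow> nat \<Rightarrow> nat word) \<Rightarrow> nat \<Rightarrow> nat word set" where
  "C_presented_gen m l w i =
     normal_closure (free_group {1..m}) (C_relators m l w) #>\<^bsub>free_group {1..m}\<^esub> free_gen i"

definition C_presented_generators ::
    "nat \<Rightarrow> (nat \<Rightarrow> nat \<Rightarrow> nat) \<Rightarrow> (nat \<Rightarrow> nat \<Rightarrow> nat \<Rightarrow> nat word) \<Rightarrow> nat word set set" where
  "C_presented_generators m l w =
     (let G = C_presented_group m l w in
        {inv\<^bsub>G\<^esub> g \<otimes>\<^bsub>G\<^esub> C_presented_gen m l w i \<otimes>\<^bsub>G\<^esub> g | g i. g \<in> carrier G \<and> i \<in> {1..m}})"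

text \<open>
  Up to \<open>C\<close>-isomorphism a \<open>C\<close>-group is a group \<open>G\<close> together with its set \<open>S\<close> of
  \<open>C\<close>-generators.
\<close>

definition has_C_presentation ::
    "('g, 'b) monoid_scheme \<Rightarrow> 'g set \<Rightarrow>
     nat \<Rightarrow> (nat \<Rightarrow> nat \<Rightarrow> nat) \<Rightarrow> (nat \<Rightarrow> nat \<Rightarrow> nat \<Rightarrow> nat word) \<Rightarrow> bool" where
  "has_C_presentation G S m l w \<longleftrightarrow>
     group G \<and> C_presentation m l w \<and>
     (\<exists>\<phi>\<in>iso (C_presented_group m l w) G. \<phi> ` C_presented_generators m l w = S)"

definition hurwitz_C_presentation ::
    "nat \<Rightarrow> (nat \<Rightarrow> nat \<Rightarrow> nat) \<Rightarrow> (nat \<Rightarrow> nat \<Rightarrow> nat \<Rightarrow> nat word) \<Rightarrow> bool" where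
  "hurwitz_C_presentation m l w \<longleftrightarrow>
     C_presentation m l w \<and>
     (\<forall>i\<in>{1..m}. l i i \<ge> 1 \<and>
        w i i 1 = foldr (\<otimes>\<^bsub>free_group {1..m}\<^esub>) (map free_gen [1..<Suc m]) \<one>\<^bsub>free_group {1..m}\<^esub>)"

definition hurwitz_C_group :: "('g, 'b) monoid_scheme \<Rightarrow> 'g set \<Rightarrow> bool" where
  "hurwitz_C_group G S \<longleftrightarrow>
     (\<exists>m l w. hurwitz_C_presentation m l w \<and> has_C_presentation G S m l w)"


section \<open>Complexification of an abelian group\<close>

text \<open>
  The tensor product over the integers of a multiplicatively written abelian group \<open>A\<close> with the
  complex numbers: the free abelian group on the pairs \<open>(a, z)\<close> modulo biadditivity, with scalars
  acting on the second component. Images of cosets are multiplied by the subgroup of relations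
  because multiplication by \<open>0\<close> does not map cosets onto cosets.
\<close>

definition tensor_relations ::
    "('a, 'b) monoid_scheme \<Rightarrow> (('a \<times> complex) \<Rightarrow>\<^sub>0 int) set" where
  "tensor_relations A =
     generate (free_Abelian_group (carrier A \<times> UNIV))
       ({frag_of (a \<otimes>\<^bsub>A\<^esub> b, z) - frag_of (a, z) - frag_of (b, z) | a b z.
           a \<in> carrier A \<and> b \<in> carrier A} \<union>
        {frag_of (a, y + z) - frag_of (a, y) - frag_of (a, z) | a y z. a \<in> carrier A})"

definition tensor_induced ::
    "('a, 'b) monoid_scheme \<Rightarrow> ('a \<times> complex \<Rightarrow> 'a \<times> complex) \<Rightarrow>
     (('a \<times> complex) \<Rightarrow>\<^sub>0 int) set \<Rightarrow> (('a \<times> complex) \<Rightarrow>\<^sub>0 int) set" where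
  "tensor_induced A f X =
     tensor_relations A <#>\<^bsub>free_Abelian_group (carrier A \<times> UNIV)\<^esub>
       (frag_extend (\<lambda>p. frag_of (f p)) ` X)"

definition complexification ::
    "('a, 'b) monoid_scheme \<Rightarrow> (complex, (('a \<times> complex) \<Rightarrow>\<^sub>0 int) set) module" where
  "complexification A =
     (let T = free_Abelian_group (carrier A \<times> UNIV) Mod tensor_relations A in
        \<lparr> carrier = carrier T, mult = undefined, one = undefined,
          zero = \<one>\<^bsub>T\<^esub>, add = (\<otimes>\<^bsub>T\<^esub>),
          smult = (\<lambda>c. tensor_induced A (\<lambda>(a, z). (a, c * z))) \<rparr>)"

definition complexification_map ::
    "('a, 'b) monoid_scheme \<Rightarrow> ('a \<Rightarrow> 'a) \<Rightarrow>
     (('a \<times> complex) \<Rightarrow>\<^sub>0 int) set \<Rightarrow> (('a \<times> complex) \<Rightarrow>\<^sub>0 int) set" where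
  "complexification_map A h = tensor_induced A (\<lambda>(a, z). (h a, z))"


section \<open>The Alexander polynomial\<close>

text \<open>
  \<open>det (T - t Id)\<close> for an endomorphism \<open>T\<close> of a finite-dimensional complex vector space \<open>V\<close>,
  computed from the matrix \<open>M\<close> of \<open>T\<close> in any ordered basis \<open>vs\<close>.
\<close>

definition det_minus_t :: "(complex, 'v) module \<Rightarrow> ('v \<Rightarrow> 'v) \<Rightarrow> complex poly" where
  "det_minus_t V T =
     (THE p. \<exists>vs M.
        distinct vs \<and> vectorspace.basis class_ring V (set vs) \<and>
        M \<in> carrier_mat (length vs) (length vs) \<and>
        (\<forall>j<length vs. T (vs ! j) = (\<Oplus>\<^bsub>V\<^esub>i\<in>{..<length vs}. M $$ (i, j) \<odot>\<^bsub>V\<^esub> vs ! i)) \<and>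
        p = det (map_mat (\<lambda>a. [:a:]) M - [:0, 1:] \<cdot>\<^sub>m 1\<^sub>m (length vs)))"

text \<open>
  The homomorphism \<open>\<nu>\<close> sending every \<open>C\<close>-generator to \<open>1\<close>; extensionality only fixes its values
  off the carrier, so that it is unique as a HOL function.
\<close>

definition C_degree :: "('g, 'b) monoid_scheme \<Rightarrow> 'g set \<Rightarrow> 'g \<Rightarrow> int" where
  "C_degree G S =
     (THE \<nu>. \<nu> \<in> hom G integer_group \<and> \<nu> \<in> extensional (carrier G) \<and> (\<forall>s\<in>S. \<nu> s = 1))"

definition C_kernel :: "('g, 'b) monoid_scheme \<Rightarrow> 'g set \<Rightarrow> 'g set" where
  "C_kernel G S = kernel G integer_group (C_degree G S)"

definition alexander_module :: "('g, 'b) monoid_scheme \<Rightarrow> 'g set \<Rightarrow> 'g set monoid" where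
  "alexander_module G S = G\<lparr>carrier := C_kernel G S\<rparr> Mod derived G (C_kernel G S)"

text \<open>Conjugation maps the coset of \<open>g\<close> onto the coset of \<open>x\<^sup>-\<^sup>1 g x\<close>.\<close>

definition alexander_automorphism ::
    "('g, 'b) monoid_scheme \<Rightarrow> 'g set \<Rightarrow> 'g set \<Rightarrow> 'g set" where
  "alexander_automorphism G S X =
     (let x = (SOME s. s \<in> S) in (\<lambda>g. inv\<^bsub>G\<^esub> x \<otimes>\<^bsub>G\<^esub> g \<otimes>\<^bsub>G\<^esub> x) ` X)"

definition alexander_polynomial :: "('g, 'b) monoid_scheme \<Rightarrow> 'g set \<Rightarrow> complex poly" where
  "alexander_polynomial G S =
     (let A = alexander_module G S; V = complexification A in
        if vectorspace.fin_dim class_ring V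
        then det_minus_t V (complexification_map A (alexander_automorphism G S))
        else 0)"

end

(*
  Let A = N/N' with the automorphism h. Homomorphisms from A to the complex numbers on which h acts
  by a sign s are the same as crossed homomorphisms d(gh) = d(g) + s^deg(g) d(h) of G, modulo
  multiples of one of them, and those are determined by their values c_i on the generators x_i.

  In a Hurwitz C-group of degree m the central element x_1...x_m has degree m, so h^m = 1 and h is
  diagonalizable: n and k are the dimensions of the eigenspaces for 1 and -1. Let r be the number of
  classes of generators under the relations. For s = 1 the relations say that c is constant on classes,
  which gives n >= r - 1. For s = -1 the generators act as reflections z -> 2 c_i - z, and conjugating a
  reflection changes its centre by twice an element of the lattice spanned by the centres (once one of
  them is 0). Hence centres vanishing on representatives of the classes solve a homogeneous integral
  system of odd determinant and vanish, which gives k <= r - 1.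

  Conversely, take generators in n + 1 equal pairs, make the square of x_1 central, so that h^2 = 1, and
  let x_1 commute with the generators outside the first k + 1 pairs. Normalized by c_1 = 0, the values
  on the other pairs are arbitrary for s = 1, and arbitrary on the first k + 1 pairs and zero elsewhere
  for s = -1. Over the complex numbers A is spanned by the eigenvectors (1 + h) y_a and (1 - h) y_a for
  y_a = x_{2a+1} x_1^{-1}, 1 <= a <= n, and (1 - h) y_a = 0 for a > k.
*)
theory Submission
  imports Defs "Jordan_Normal_Form.Jordan_Normal_Form_Existence"
begin

section \<open>Linear algebra\<close>

text \<open>Crossed homomorphisms enter because they require no generators of N: finitely many
  values on the generators of G describe a functional on N/N', and prescribing them means lifting to
  the affine group of the complex line, where each relation is one linear equation. They are
  eigenvectors of the transpose of h, so they count geometric multiplicities, while the polynomial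
  records algebraic ones; the finite order of h closes this gap. Restriction to N forgets exactly a
  line of crossed homomorphisms, spanned by deg for s = 1 and by 1 - (-1)^deg for s = -1. Hence
  normalizing c_1 = 0 costs one class in both cases, and the same number r - 1 bounds k from above
  and n from below. The determinant for s = -1 is odd because the system has the form c = 2Mc with M
  integral, and 1 - 2M is the identity modulo 2. In the construction the Hurwitz relations ask that
  the product of all reflections commute with each of them. Two equal adjacent reflections cancel,
  so doubling every generator makes this condition empty and leaves the centres free.\<close>

lemma exists_nonzero_homogeneous_solution:
  fixes A :: "'i \<Rightarrow> 'j \<Rightarrow> 'a :: field"
  assumes "finite I" "finite J" "card I < card J"
  shows "\<exists>x. (\<exists>j\<in>J. x j \<noteq> 0) \<and> (\<forall>i\<in>I. (\<Sum>j\<in>J. A i j * x j) = 0)"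
  using assms
proof (induction I arbitrary: J A rule: finite_induct)
  case empty
  then obtain j where "j \<in> J" by fastforce
  then show ?case by (intro exI[of _ "\<lambda>_. 1"]) auto
next
  case (insert i I)
  show ?case
  proof (cases "\<forall>j\<in>J. A i j = 0")
    case True
    have "card I < card J" using insert by simp
    from insert.IH[OF insert.prems(1) this, of A] obtain x where
      "\<exists>j\<in>J. x j \<noteq> 0" "\<forall>i\<in>I. (\<Sum>j\<in>J. A i j * x j) = 0" by auto
    with True show ?thesis by (intro exI[of _ x]) auto
  next
    case False
    then obtain p where p: "p \<in> J" "A i p \<noteq> 0" by auto
    let ?J = "J - {p}"
    \<comment> \<open>Elimination of the unknown \<open>p\<close> with row \<open>i\<close> as pivot
      row; \<open>y\<close> below recovers the value at \<open>p\<close> by solving row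
      \<open>i\<close>.\<close>
    define B where "B r j = A r j - A r p * A i j / A i p" for r j
    have "card I < card ?J" using insert p by simp
    with insert.IH[of ?J B] insert.prems obtain x where
      x: "\<exists>j\<in>?J. x j \<noteq> 0" "\<forall>r\<in>I. (\<Sum>j\<in>?J. B r j * x j) = 0" by auto
    define y where "y = x(p := - (\<Sum>j\<in>?J. A i j * x j) / A i p)"
    have S: "(\<Sum>j\<in>J. A r j * y j) = A r p * y p + (\<Sum>j\<in>?J. A r j * x j)" for r
      using p insert.prems by (subst sum.remove[of J p]) (auto simp: y_def intro!: sum.cong)
    have "(\<Sum>j\<in>J. A i j * y j) = 0" unfolding S using p by (simp add: y_def)
    moreover have "(\<Sum>j\<in>J. A r j * y j) = 0" if "r \<in> I" for r
    proof -
      have "0 = (\<Sum>j\<in>?J. B r j * x j)" using x that by simp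
      also have "\<dots> = (\<Sum>j\<in>?J. A r j * x j) - A r p * (\<Sum>j\<in>?J. A i j * x j) / A i p"
        by (simp add: B_def left_diff_distrib sum_subtractf sum_distrib_left sum_divide_distrib
            field_simps)
      finally show ?thesis unfolding S by (simp add: y_def)
    qed
    moreover have "\<exists>j\<in>J. y j \<noteq> 0" using x(1) by (auto simp: y_def)
    ultimately show ?thesis by (intro exI[of _ y]) auto
  qed
qed

text \<open>Modulo 2 the matrix \<open>N\<close> is the identity, so its determinant is odd, hence
  nonzero, and stays invertible in characteristic 0. The induction is fraction-free elimination,
  under which the parity pattern persists.\<close>

lemma odd_diagonal_system_trivial:
  fixes N :: "'i \<Rightarrow> 'i \<Rightarrow> int" and c :: "'i \<Rightarrow> 'a :: {field_char_0}"
  assumes "finite I"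
    and "\<And>i. i \<in> I \<Longrightarrow> odd (N i i)"
    and "\<And>i j. i \<in> I \<Longrightarrow> j \<in> I \<Longrightarrow> i \<noteq> j \<Longrightarrow> even (N i j)"
    and "\<And>i. i \<in> I \<Longrightarrow> (\<Sum>j\<in>I. of_int (N i j) * c j) = 0"
    and "i \<in> I"
  shows "c i = 0"
  using assms
proof (induction I arbitrary: N i rule: finite_induct)
  case (insert p I)
  have np: "N p p \<noteq> 0" using insert.prems(1)[of p] by (metis even_zero insertI1)
  define M where "M i j = N p p * N i j - N i p * N p j" for i j
  have S: "of_int (N i p) * c p + (\<Sum>j\<in>I. of_int (N i j) * c j) = 0" if "i \<in> insert p I" for i
    using insert.prems(3)[OF that] insert.hyps by simp
  have z: "c i = 0" if i: "i \<in> I" for i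
  proof (rule insert.IH[of M])
    show "odd (M i i)" if "i \<in> I" for i
      using insert.prems(1)[of p] insert.prems(1)[of i] insert.prems(2)[of i p] that insert.hyps(2)
      by (auto simp: M_def)
    show "even (M i j)" if "i \<in> I" "j \<in> I" "i \<noteq> j" for i j
      using insert.prems(2)[of i j] insert.prems(2)[of i p] that insert.hyps(2)
      by (auto simp: M_def)
    fix i assume i: "i \<in> I"
    have "(\<Sum>j\<in>I. of_int (M i j) * c j)
        = of_int (N p p) * (\<Sum>j\<in>I. of_int (N i j) * c j)
          - of_int (N i p) * (\<Sum>j\<in>I. of_int (N p j) * c j)"
      by (simp add: M_def left_diff_distrib sum_subtractf sum_distrib_left algebra_simps)
    also have "(\<Sum>j\<in>I. of_int (N i j) * c j) = - (of_int (N i p) * c p)"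
      using S[of i] i by (simp add: eq_neg_iff_add_eq_0 add.commute)
    also have "(\<Sum>j\<in>I. of_int (N p j) * c j) = - (of_int (N p p) * c p)"
      using S[of p] by (simp add: eq_neg_iff_add_eq_0 add.commute)
    finally show "(\<Sum>j\<in>I. of_int (M i j) * c j) = 0" by simp
  qed (use i in auto)
  have "of_int (N p p) * c p = 0" using S[of p] z by simp
  with np have "c p = 0" by simp
  with z insert.prems(4) show ?case by auto
qed simp

section \<open>Coordinates on a complex vector space and the polynomial det(T - t Id)\<close>

lemma det_minus_X_char_poly:
  fixes M :: "'a :: comm_ring_1 mat"
  assumes M: "M \<in> carrier_mat n n"
  shows "det (map_mat (\<lambda>a. [:a:]) M - [:0, 1:] \<cdot>\<^sub>m 1\<^sub>m n) = (- 1) ^ n * char_poly M"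
proof -
  have "map_mat (\<lambda>a. [:a:]) M - [:0, 1:] \<cdot>\<^sub>m 1\<^sub>m n = (- 1) \<cdot>\<^sub>m char_poly_matrix M"
    using M by (intro eq_matI) (auto simp: char_poly_matrix_def)
  then show ?thesis using M
    by (simp add: char_poly_def del: one_poly_eq_simps) (metis char_poly_matrix_closed carrier_matD(2) det_smult)
qed

text \<open>A linear isomorphism from \<open>V\<close> to complex \<open>d\<close>-tuples, recorded
  by its component functionals. Functionals replace bases because crossed homomorphisms yield
  functionals on the complexification, not vectors.\<close>

definition coordinates ::
    "(complex, 'v) module \<Rightarrow> nat \<Rightarrow> (nat \<Rightarrow> 'v \<Rightarrow> complex) \<Rightarrow> bool" where
  "coordinates V d \<kappa> \<longleftrightarrow>
     (\<forall>i<d. \<forall>u\<in>carrier V. \<forall>v\<in>carrier V. \<kappa> i (u \<oplus>\<^bsub>V\<^esub> v) = \<kappa> i u + \<kappa> i v) \<and>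
     (\<forall>i<d. \<forall>c. \<forall>v\<in>carrier V. \<kappa> i (c \<odot>\<^bsub>V\<^esub> v) = c * \<kappa> i v) \<and>
     (\<forall>u\<in>carrier V. \<forall>v\<in>carrier V. (\<forall>i<d. \<kappa> i u = \<kappa> i v) \<longrightarrow> u = v) \<and>
     (\<forall>x. \<exists>v\<in>carrier V. \<forall>i<d. \<kappa> i v = x i)"

lemma coordinatesD:
  assumes "coordinates V d \<kappa>"
  shows "i < d \<Longrightarrow> u \<in> carrier V \<Longrightarrow> v \<in> carrier V \<Longrightarrow> \<kappa> i (u \<oplus>\<^bsub>V\<^esub> v) = \<kappa> i u + \<kappa> i v"
    and "i < d \<Longrightarrow> v \<in> carrier V \<Longrightarrow> \<kappa> i (c \<odot>\<^bsub>V\<^esub> v) = c * \<kappa> i v"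
    and "u \<in> carrier V \<Longrightarrow> v \<in> carrier V \<Longrightarrow> (\<And>i. i < d \<Longrightarrow> \<kappa> i u = \<kappa> i v) \<Longrightarrow> u = v"
    and "\<exists>v\<in>carrier V. \<forall>i<d. \<kappa> i v = x i"
  using assms by (simp_all add: coordinates_def)

context
  fixes V :: "(complex, 'v) module"
  assumes vs: "vectorspace class_ring V"
begin

interpretation vectorspace class_ring V by (rule vs)

lemma coordinates_zero:
  assumes "coordinates V d \<kappa>" "i < d"
  shows "\<kappa> i \<zero>\<^bsub>V\<^esub> = 0"
  using coordinatesD(1)[OF assms, of "\<zero>\<^bsub>V\<^esub>" "\<zero>\<^bsub>V\<^esub>"] by simp

lemma coordinates_finsum:
  assumes k: "coordinates V d \<kappa>" "i < d" and f: "\<And>j. j \<in> J \<Longrightarrow> f j \<in> carrier V"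
    and fin: "finite J"
  shows "\<kappa> i (\<Oplus>\<^bsub>V\<^esub>j\<in>J. f j) = (\<Sum>j\<in>J. \<kappa> i (f j))"
  using fin f
proof (induction J rule: finite_induct)
  case empty
  then show ?case using coordinates_zero[OF k] by simp
next
  case (insert j J)
  then show ?case using coordinatesD(1)[OF k] by (subst finsum_insert) auto
qed

lemma lincomb_set_list:
  assumes "distinct bs" "set bs \<subseteq> carrier V"
  shows "lincomb a (set bs) = (\<Oplus>\<^bsub>V\<^esub>i\<in>{..<length bs}. a (bs ! i) \<odot>\<^bsub>V\<^esub> bs ! i)"
proof -
  have c: "bs ! i \<in> carrier V" if "i < length bs" for i using assms(2) that by auto
  have "set bs = (!) bs ` {..<length bs}" by (auto simp: set_conv_nth)
  then have "lincomb a (set bs) = (\<Oplus>\<^bsub>V\<^esub>v\<in>(!) bs ` {..<length bs}. a v \<odot>\<^bsub>V\<^esub> v)"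
    by (simp add: lincomb_def)
  also have "\<dots> = (\<Oplus>\<^bsub>V\<^esub>i\<in>{..<length bs}. a (bs ! i) \<odot>\<^bsub>V\<^esub> bs ! i)"
    by (rule finsum_reindex) (use assms c in \<open>auto simp: inj_on_nth\<close>)
  finally show ?thesis .
qed

lemma coordinates_exist:
  assumes "fin_dim"
  shows "\<exists>d \<kappa>. coordinates V d \<kappa>"
proof -
  obtain B where B: "finite B" "basis B" using finite_basis_exists[OF assms] by auto
  obtain bs where bs': "distinct bs" "set bs = B" using finite_distinct_list[OF B(1)] by auto
  have Bc: "B \<subseteq> carrier V" using B by (simp add: basis_def)
  have ex1: "\<exists>!a. a \<in> B \<rightarrow>\<^sub>E UNIV \<and> lincomb a B = v" if "v \<in> carrier V" for v
    using basis_criterion[OF B(1) Bc] B(2) that by auto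
  define a where "a v = (THE a. a \<in> B \<rightarrow>\<^sub>E UNIV \<and> lincomb a B = v)" for v
  have a: "a v \<in> B \<rightarrow>\<^sub>E UNIV" "lincomb (a v) B = v" if "v \<in> carrier V" for v
    using theI'[OF ex1[OF that]] by (simp_all add: a_def)
  \<comment> \<open>Coefficient functions are unique only among extensional ones; restriction to
    \<open>B\<close> transfers the uniqueness to arbitrary \<open>f\<close>.\<close>
  have aI: "f b = a v b" if "lincomb f B = v" "v \<in> carrier V" "b \<in> B" for f v b
  proof -
    have "lincomb (restrict f B) B = lincomb f B"
      unfolding lincomb_def by (rule finsum_cong') (use Bc in auto)
    then have "lincomb (restrict f B) B = v" using that by simp
    then have "restrict f B = a v" using ex1[OF that(2)] a[OF that(2)] by auto
    then show ?thesis using that(3) by (metis restrict_apply')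
  qed
  define \<kappa> where "\<kappa> i v = a v (bs ! i)" for i v
  have mem: "bs ! i \<in> B" if "i < length bs" for i using bs' that by auto
  have "coordinates V (length bs) \<kappa>"
    unfolding coordinates_def
  proof (intro conjI allI ballI impI)
    fix i u v assume i: "i < length bs" and u: "u \<in> carrier V" and v: "v \<in> carrier V"
    have "lincomb (\<lambda>b. a u b + a v b) B = u \<oplus>\<^bsub>V\<^esub> v"
      using a(2)[OF u] a(2)[OF v] lincomb_sum[OF B(1) Bc, of "a u" "a v"] by simp
    from aI[OF this _ mem[OF i]] u v show "\<kappa> i (u \<oplus>\<^bsub>V\<^esub> v) = \<kappa> i u + \<kappa> i v"
      by (simp add: \<kappa>_def)
  next
    fix i c v assume i: "i < length bs" and v: "v \<in> carrier V"
    have "lincomb (\<lambda>b. c * a v b) B = c \<odot>\<^bsub>V\<^esub> v"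
      using a(2)[OF v] lincomb_smult[OF Bc, of "a v" c] B(1) by simp
    from aI[OF this _ mem[OF i]] v show "\<kappa> i (c \<odot>\<^bsub>V\<^esub> v) = c * \<kappa> i v"
      by (simp add: \<kappa>_def)
  next
    fix u v assume u: "u \<in> carrier V" and v: "v \<in> carrier V"
      and eq: "\<forall>i<length bs. \<kappa> i u = \<kappa> i v"
    have "a u b = a v b" if "b \<in> B" for b
      using that eq bs' by (metis \<kappa>_def in_set_conv_nth)
    then have "lincomb (a u) B = lincomb (a v) B"
      unfolding lincomb_def by (intro finsum_cong') (use Bc in auto)
    then show "u = v" using a(2) u v by simp
  next
    fix x :: "nat \<Rightarrow> complex"
    define f where "f b = x (THE i. i < length bs \<and> bs ! i = b)" for b
    have f: "f (bs ! i) = x i" if "i < length bs" for i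
      using that bs'(1) unfolding f_def
      by (intro arg_cong[of _ _ x] the_equality) (auto simp: nth_eq_iff_index_eq)
    have c: "lincomb f B \<in> carrier V" using Bc by (intro lincomb_closed) auto
    show "\<exists>v\<in>carrier V. \<forall>i<length bs. \<kappa> i v = x i"
      using aI[OF refl c] c mem f by (intro bexI[of _ "lincomb f B"]) (auto simp: \<kappa>_def)
  qed
  then show ?thesis by blast
qed

text \<open>\<open>det_minus_t\<close> is a definite description over all bases. The basis dual to
  \<open>\<kappa>\<close> supplies one admissible polynomial, and the matrix of \<open>T\<close> in
  any other basis is similar to \<open>M\<close>, so it supplies the same one.\<close>

lemma det_minus_t_coordinates:
  assumes k: "coordinates V d \<kappa>" and M: "M \<in> carrier_mat d d"
    and Tc: "\<And>v. v \<in> carrier V \<Longrightarrow> T v \<in> carrier V"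
    and T: "\<And>i v. i < d \<Longrightarrow> v \<in> carrier V \<Longrightarrow> \<kappa> i (T v) = (\<Sum>j<d. M $$ (i, j) * \<kappa> j v)"
  shows "fin_dim" and "det_minus_t V T = (- 1) ^ d * char_poly M"
proof -
  note add = coordinatesD(1)[OF k] and smult = coordinatesD(2)[OF k]
    and inj = coordinatesD(3)[OF k] and surj = coordinatesD(4)[OF k]
  \<comment> \<open>\<open>e\<close> will be the basis dual to the functionals
    \<open>\<kappa>\<close>.\<close>
  have "\<exists>v. v \<in> carrier V \<and> (\<forall>i<d. \<kappa> i v = (if i = j then 1 else 0))" for j
    using surj[of "\<lambda>i. if i = j then 1 else 0"] by blast
  then obtain e where e: "\<And>j. e j \<in> carrier V"
    "\<And>i j. i < d \<Longrightarrow> \<kappa> i (e j) = (if i = j then 1 else 0)" by metis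
  have coord_sum: "\<kappa> i (\<Oplus>\<^bsub>V\<^esub>j\<in>{..<n}. a j \<odot>\<^bsub>V\<^esub> u j) = (\<Sum>j<n. a j * \<kappa> i (u j))"
    if "i < d" "\<And>j. j < n \<Longrightarrow> u j \<in> carrier V" for i a u and n :: nat
    using that(2) by (subst coordinates_finsum[OF k that(1)]) (auto simp: smult[OF that(1)])
  let ?es = "map e [0..<d]"
  have es: "distinct ?es" "set ?es \<subseteq> carrier V"
  proof -
    have "inj_on e {0..<d}"
      by (rule inj_onI) (metis atLeastLessThan_iff e(2) zero_neq_one)
    then show "distinct ?es" by (simp add: distinct_map)
  qed (use e(1) in auto)
  have lc: "lincomb a (set ?es) = (\<Oplus>\<^bsub>V\<^esub>j\<in>{..<d}. a (e j) \<odot>\<^bsub>V\<^esub> e j)" for a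
    unfolding lincomb_set_list[OF es]
    by (rule finsum_cong') (use e(1) in auto)
  have lck: "\<kappa> i (lincomb a (set ?es)) = a (e i)" if "i < d" for i a
    unfolding lc using that e(1)
    by (subst coord_sum) (auto simp: e(2)[OF that] if_distrib cong: if_cong)
  have lcc: "lincomb a (set ?es) \<in> carrier V" for a
    using es(2) by (intro lincomb_closed) auto
  have bas: "basis (set ?es)"
  proof (subst basis_criterion)
    show "\<forall>v. v \<in> carrier V \<longrightarrow>
        (\<exists>!a. a \<in> set ?es \<rightarrow>\<^sub>E carrier class_ring \<and> lincomb a (set ?es) = v)"
    proof (intro allI impI)
      fix v assume v: "v \<in> carrier V"
      define a where "a b = (if b \<in> set ?es then \<kappa> (THE i. i < d \<and> e i = b) v else undefined)" for b
      have ae: "a (e i) = \<kappa> i v" if "i < d" for i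
      proof -
        have "(THE j. j < d \<and> e j = e i) = i"
          using that es(1) by (intro the_equality) (auto simp: distinct_map inj_on_def)
        then show ?thesis using that by (auto simp: a_def)
      qed
      show "\<exists>!a. a \<in> set ?es \<rightarrow>\<^sub>E carrier class_ring \<and> lincomb a (set ?es) = v"
      proof (intro ex1I[of _ a] conjI)
        show "lincomb a (set ?es) = v"
          by (rule inj[OF lcc v]) (simp only: lck ae)
        fix b assume b: "b \<in> set ?es \<rightarrow>\<^sub>E carrier class_ring \<and> lincomb b (set ?es) = v"
        show "b = a"
        proof
          fix x show "b x = a x"
          proof (cases "x \<in> set ?es")
            case True
            then obtain i where "i < d" "x = e i" by auto
            then show ?thesis using lck[of i b] b ae by metis
          next
            case False
            have "b x = undefined" using PiE_arb[of b "set ?es"] b False by metis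
            with False show ?thesis by (simp add: a_def)
          qed
        qed
      qed (auto simp: a_def)
    qed
  qed (use es in auto)
  show fd: "fin_dim" unfolding fin_dim_def
    using bas by (intro exI[of _ "set ?es"]) (simp add: basis_def)
  define R where "R p \<longleftrightarrow> (\<exists>bs M.
        distinct bs \<and> basis (set bs) \<and>
        M \<in> carrier_mat (length bs) (length bs) \<and>
        (\<forall>j<length bs. T (bs ! j) = (\<Oplus>\<^bsub>V\<^esub>i\<in>{..<length bs}. M $$ (i, j) \<odot>\<^bsub>V\<^esub> bs ! i)) \<and>
        p = det (map_mat (\<lambda>a. [:a:]) M - [:0, 1:] \<cdot>\<^sub>m 1\<^sub>m (length bs)))" for p
  have R1: "p = (- 1) ^ d * char_poly M" if "R p" for p
  proof -
    from that obtain us N where us: "distinct us" "basis (set us)"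
      and N: "N \<in> carrier_mat (length us) (length us)"
      and TN: "\<And>j. j < length us \<Longrightarrow>
            T (us ! j) = (\<Oplus>\<^bsub>V\<^esub>i\<in>{..<length us}. N $$ (i, j) \<odot>\<^bsub>V\<^esub> us ! i)"
      and p: "p = det (map_mat (\<lambda>a. [:a:]) N - [:0, 1:] \<cdot>\<^sub>m 1\<^sub>m (length us))"
      unfolding R_def by blast
    have usc: "set us \<subseteq> carrier V" using us(2) by (simp add: basis_def)
    have usc': "us ! j \<in> carrier V" if "j < length us" for j using usc that by auto
    have "card (set us) = card (set ?es)"
      using dim_basis[OF _ us(2)] dim_basis[OF _ bas] by simp
    then have len: "length us = d" using us(1) es(1) by (simp only: distinct_card) simp
    define B where "B = mat d d (\<lambda>(i, j). \<kappa> i (us ! j))"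
    have B: "B \<in> carrier_mat d d" by (simp add: B_def)
    \<comment> \<open>A kernel vector of \<open>B\<close> would be a nontrivial linear relation
      among the vectors of \<open>us\<close>.\<close>
    have "det B \<noteq> 0"
    proof
      assume "det B = 0"
      then obtain x where x: "x \<in> carrier_vec d" "x \<noteq> 0\<^sub>v d" "B *\<^sub>v x = 0\<^sub>v d"
        using det_0_iff_vec_prod_zero[OF B] by auto
      define v where "v = (\<Oplus>\<^bsub>V\<^esub>j\<in>{..<d}. x $ j \<odot>\<^bsub>V\<^esub> us ! j)"
      have vc: "v \<in> carrier V" unfolding v_def using usc' len by (intro finsum_closed) auto
      have v0: "v = \<zero>\<^bsub>V\<^esub>"
      proof (rule inj[OF vc])
        fix i assume i: "i < d"
        have "\<kappa> i v = (\<Sum>j<d. x $ j * \<kappa> i (us ! j))"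
          unfolding v_def using i usc' len by (subst coord_sum) auto
        also have "\<dots> = (B *\<^sub>v x) $ i"
          using i x(1) by (auto simp: B_def scalar_prod_def mult.commute atLeast0LessThan intro!: sum.cong)
        also have "\<dots> = 0" using x(3) i by simp
        finally show "\<kappa> i v = \<kappa> i \<zero>\<^bsub>V\<^esub>" using coordinates_zero[OF k i] by simp
      qed simp
      define a where "a b = x $ (THE j. j < d \<and> us ! j = b)" for b
      have a: "a (us ! j) = x $ j" if "j < d" for j
        unfolding a_def using that us(1) len
        by (intro arg_cong[of _ _ "($) x"] the_equality) (auto simp: nth_eq_iff_index_eq)
      have "lincomb a (set us) = v"
        unfolding lincomb_set_list[OF us(1) usc] v_def len
        by (rule finsum_cong') (use usc' len a in auto)
      with v0 have l0: "lincomb a (set us) = \<zero>\<^bsub>V\<^esub>" by simp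
      have nd: "\<not> lin_dep (set us)" using us(2) by (simp add: basis_def)
      have "a b = 0" if "b \<in> set us" for b
        using nd l0 that unfolding lin_dep_def by (auto simp: class_ring_simps)
      then have "x $ j = 0" if "j < d" for j using that a len by (metis nth_mem)
      with x(1,2) show False by auto
    qed
    then have "B \<in> Units (ring_mat TYPE(complex) d ())" by (rule det_non_zero_imp_unit[OF B])
    then obtain C where C: "C \<in> carrier_mat d d" "C * B = 1\<^sub>m d" "B * C = 1\<^sub>m d"
      unfolding Units_def ring_mat_def by auto
    \<comment> \<open>Both sides hold the coordinates of \<open>T (us ! j)\<close>: once
      \<open>M\<close> is applied to the coordinates of \<open>us ! j\<close>, once the image is
      expanded in \<open>us\<close> through \<open>N\<close>.\<close>
    have MB: "M * B = B * N"
    proof (rule eq_matI)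
      fix i j assume "i < dim_row (B * N)" "j < dim_col (B * N)"
      then have ij: "i < d" "j < d" using B N len by auto
      have "(M * B) $$ (i, j) = \<kappa> i (T (us ! j))"
        using T[of i "us ! j"] usc' ij len M B
        by (auto simp: scalar_prod_def B_def atLeast0LessThan)
      also have "\<dots> = (\<Sum>l<d. N $$ (l, j) * \<kappa> i (us ! l))"
        using TN[of j] ij len usc' by (simp add: coord_sum)
      also have "\<dots> = (B * N) $$ (i, j)"
        using ij N len by (auto simp: scalar_prod_def B_def atLeast0LessThan mult.commute intro!: sum.cong)
      finally show "(M * B) $$ (i, j) = (B * N) $$ (i, j)" .
    qed (use M B N len in auto)
    have "M = M * (B * C)" using M C by simp
    also have "\<dots> = M * B * C" using M B C by (simp add: assoc_mult_mat)
    also have "\<dots> = B * N * C" by (simp add: MB)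
    finally have "similar_mat M N"
      unfolding similar_mat_def similar_mat_wit_def Let_def
      using M B C N len by (intro exI[of _ B] exI[of _ C]) auto
    then have "char_poly M = char_poly N" by (rule char_poly_similar)
    then show ?thesis unfolding p using det_minus_X_char_poly[OF N] len by simp
  qed
  have "R ((- 1) ^ d * char_poly M)"
    unfolding R_def
  proof (intro exI[of _ ?es] exI[of _ M] conjI allI impI)
    fix j assume j: "j < length ?es"
    have nth: "?es ! i = e i" if "i < d" for i using that by simp
    show "T (?es ! j) = (\<Oplus>\<^bsub>V\<^esub>i\<in>{..<length ?es}. M $$ (i, j) \<odot>\<^bsub>V\<^esub> ?es ! i)"
    proof (rule inj)
      show "T (?es ! j) \<in> carrier V" using j e(1) Tc by simp
      show "(\<Oplus>\<^bsub>V\<^esub>i\<in>{..<length ?es}. M $$ (i, j) \<odot>\<^bsub>V\<^esub> ?es ! i) \<in> carrier V"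
        using e(1) by (intro finsum_closed) auto
      fix i assume i: "i < d"
      have "\<kappa> i (\<Oplus>\<^bsub>V\<^esub>i\<in>{..<length ?es}. M $$ (i, j) \<odot>\<^bsub>V\<^esub> ?es ! i)
          = (\<Sum>l<d. M $$ (l, j) * \<kappa> i (?es ! l))"
        using i e(1) by (subst coord_sum) auto
      also have "\<dots> = M $$ (i, j)" using i by (simp add: e(2)[OF i] if_distrib cong: if_cong)
      finally show "\<kappa> i (T (?es ! j)) = \<kappa> i (\<Oplus>\<^bsub>V\<^esub>i\<in>{..<length ?es}. M $$ (i, j) \<odot>\<^bsub>V\<^esub> ?es ! i)"
        using T[OF i, of "e j"] e(1) j by (simp add: e(2) if_distrib cong: if_cong)
    qed
  qed (use es bas M det_minus_X_char_poly[OF M] in auto)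
  then have "(THE p. R p) = (- 1) ^ d * char_poly M"
    using R1 by (intro the_equality)
  then show "det_minus_t V T = (- 1) ^ d * char_poly M"
    unfolding det_minus_t_def R_def .
qed

end

text \<open>The coordinates form a basis of the dual space, and \<open>t\<close> is read off on the
  basis dual to \<open>\<kappa>\<close>. This provides the matrix of an operator as well as the
  expansion of functionals coming from crossed homomorphisms.\<close>

lemma coordinates_functional:
  fixes V :: "(complex, 'v) module"
  assumes vs: "vectorspace class_ring V" and k: "coordinates V d \<kappa>"
    and add: "\<And>u v. u \<in> carrier V \<Longrightarrow> v \<in> carrier V \<Longrightarrow> f (u \<oplus>\<^bsub>V\<^esub> v) = f u + (f v :: complex)"
    and smult: "\<And>c v. v \<in> carrier V \<Longrightarrow> f (c \<odot>\<^bsub>V\<^esub> v) = c * f v"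
  obtains t where "\<And>v. v \<in> carrier V \<Longrightarrow> f v = (\<Sum>i<d. t i * \<kappa> i v)"
proof -
  interpret vectorspace class_ring V by (rule vs)
  have "\<exists>v. v \<in> carrier V \<and> (\<forall>i<d. \<kappa> i v = (if i = j then 1 else 0))" for j
    using coordinatesD(4)[OF k, of "\<lambda>i. if i = j then 1 else 0"] by blast
  then obtain e where e: "\<And>j. e j \<in> carrier V"
    "\<And>i j. i < d \<Longrightarrow> \<kappa> i (e j) = (if i = j then 1 else 0)" by metis
  have f0: "f \<zero>\<^bsub>V\<^esub> = 0" using add[of "\<zero>\<^bsub>V\<^esub>" "\<zero>\<^bsub>V\<^esub>"] by simp
  have fsum: "f (\<Oplus>\<^bsub>V\<^esub>j\<in>J. u j) = (\<Sum>j\<in>J. f (u j))"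
    if "finite J" "\<And>j. j \<in> J \<Longrightarrow> u j \<in> carrier V" for J :: "nat set" and u
    using that
  proof (induction J rule: finite_induct)
    case (insert j J)
    then show ?case using add by (subst finsum_insert) auto
  qed (simp add: f0)
  show thesis
  proof (rule that)
    fix v assume v: "v \<in> carrier V"
    have sc: "(\<Oplus>\<^bsub>V\<^esub>j\<in>{..<d}. \<kappa> j v \<odot>\<^bsub>V\<^esub> e j) \<in> carrier V" using e by (intro finsum_closed) auto
    have "v = (\<Oplus>\<^bsub>V\<^esub>j\<in>{..<d}. \<kappa> j v \<odot>\<^bsub>V\<^esub> e j)"
    proof (rule coordinatesD(3)[OF k v sc])
      fix i assume i: "i < d"
      have "\<kappa> i (\<Oplus>\<^bsub>V\<^esub>j\<in>{..<d}. \<kappa> j v \<odot>\<^bsub>V\<^esub> e j) = (\<Sum>j<d. \<kappa> j v * \<kappa> i (e j))"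
        using e(1)
        by (subst coordinates_finsum[OF vs k i]) (auto simp: coordinatesD(2)[OF k i])
      then show "\<kappa> i v = \<kappa> i (\<Oplus>\<^bsub>V\<^esub>j\<in>{..<d}. \<kappa> j v \<odot>\<^bsub>V\<^esub> e j)"
        using i by (simp add: e(2)[OF i] if_distrib cong: if_cong)
    qed
    then have "f v = f (\<Oplus>\<^bsub>V\<^esub>j\<in>{..<d}. \<kappa> j v \<odot>\<^bsub>V\<^esub> e j)" by simp
    also have "\<dots> = (\<Sum>j<d. f (e j) * \<kappa> j v)"
      using e(1) by (subst fsum) (auto simp: smult mult.commute)
    finally show "f v = (\<Sum>j<d. f (e j) * \<kappa> j v)" .
  qed
qed

section \<open>Matrices and operators of finite order\<close>

lemma four_block_mat_eq_one:
  assumes A: "A \<in> carrier_mat n n" and D: "D \<in> carrier_mat m m"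
    and eq: "four_block_mat A (0\<^sub>m n m) (0\<^sub>m m n) D = 1\<^sub>m (n + m)"
  shows "A = 1\<^sub>m n" and "D = 1\<^sub>m m"
proof -
  have *: "four_block_mat A (0\<^sub>m n m) (0\<^sub>m m n) D $$ (i, j) = (if i = j then 1 else 0)"
    if "i < n + m" "j < n + m" for i j using eq that by simp
  show "A = 1\<^sub>m n"
    using A D *[of i j for i j]
    by (intro eq_matI) (metis A carrier_matD index_mat_four_block(1) index_one_mat(1) index_one_mat(2,3) trans_less_add1, auto)
  show "D = 1\<^sub>m m"
  proof (rule eq_matI)
    fix i j assume ij: "i < dim_row (1\<^sub>m m)" "j < dim_col (1\<^sub>m m)"
    then show "D $$ (i, j) = 1\<^sub>m m $$ (i, j)" using *[of "n + i" "n + j"] A D by simp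
  qed (use D in auto)
qed

text \<open>In a block of size at least 2 the entry (0, 1) of the power is
  \<open>m * a ^ (m - 1)\<close>, which cannot vanish in characteristic 0 because the diagonal gives
  \<open>a ^ m = 1\<close>.\<close>

lemma jordan_block_pow_eq_one:
  fixes a :: "'a :: field_char_0"
  assumes "jordan_block n a ^\<^sub>m m = 1\<^sub>m n" "m > 0"
  shows "n \<le> 1"
proof (rule ccontr)
  assume n: "\<not> n \<le> 1"
  have eq: "mat n n (\<lambda>(i, j). if i \<le> j then of_nat (m choose (j - i)) * a ^ (m + i - j) else 0)
        $$ (i, j) = 1\<^sub>m n $$ (i, j)" for i j
    using assms(1) by (simp add: jordan_block_pow)
  have "of_nat m * a ^ (m - 1) = 0" using eq[of 0 1] n by simp
  moreover have "a ^ m = 1" using eq[of 0 0] n by simp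
  ultimately show False using assms(2) by (auto simp: power_0_left)
qed

lemma jordan_matrix_pow_eq_one:
  fixes bs :: "(nat \<times> 'a :: field_char_0) list"
  assumes "jordan_matrix bs ^\<^sub>m m = 1\<^sub>m (sum_list (map fst bs))" "m > 0" "b \<in> set bs"
  shows "fst b \<le> 1"
  using assms
proof (induction bs)
  case (Cons c bs)
  obtain n a where c: "c = (n, a)" by force
  let ?k = "sum_list (map fst bs)"
  have "jordan_matrix (c # bs) ^\<^sub>m m
      = four_block_mat (jordan_block n a ^\<^sub>m m) (0\<^sub>m n ?k) (0\<^sub>m ?k n) (jordan_matrix bs ^\<^sub>m m)"
    unfolding c jordan_matrix_Cons
    by (rule pow_four_block_mat) auto
  then have "jordan_block n a ^\<^sub>m m = 1\<^sub>m n" "jordan_matrix bs ^\<^sub>m m = 1\<^sub>m ?k"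
    using four_block_mat_eq_one[of "jordan_block n a ^\<^sub>m m" n "jordan_matrix bs ^\<^sub>m m" ?k] Cons.prems(1) c
    by auto
  then show ?case using Cons jordan_block_pow_eq_one c by auto
qed simp

lemma jordan_matrix_simple_index:
  assumes "i < length as" "j < length as"
  shows "jordan_matrix (map (Pair 1) as) $$ (i, j) = (if i = j then as ! i else 0)"
  using assms
proof (induction as arbitrary: i j)
  case (Cons a as)
  have l: "sum_list (map fst (map (Pair 1) as)) = length as" by (induction as) auto
  show ?case
    using Cons.prems Cons.IH[of "i - 1" "j - 1"] 
    by (cases i; cases j) (auto simp: jordan_matrix_Cons l simp del: map_map One_nat_def)
qed simp

text \<open>All Jordan blocks have size 1. The rows of \<open>Q\<close> appear as left eigenvectors
  of \<open>M\<close> because these are what combines coordinate functionals into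
  eigenfunctionals.\<close>

lemma finite_order_matrix_diagonalizable:
  fixes M :: "complex mat"
  assumes M: "M \<in> carrier_mat d d" and fo: "M ^\<^sub>m m = 1\<^sub>m d" "m > 0"
  obtains P Q as where "length as = d" "P \<in> carrier_mat d d" "Q \<in> carrier_mat d d"
    "P * Q = 1\<^sub>m d" "Q * P = 1\<^sub>m d"
    "\<And>i l. i < d \<Longrightarrow> l < d \<Longrightarrow> (Q * M) $$ (i, l) = as ! i * Q $$ (i, l)"
    "char_poly M = (\<Prod>a\<leftarrow>as. [:- a, 1:])"
proof -
  obtain cs where "char_poly M = (\<Prod>c\<leftarrow>cs. [:- c, 1:])"
    using char_poly_factorized[OF M] by auto
  then obtain bs where jnf: "jordan_nf M bs" using jordan_nf_exists[OF M] by blast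
  then obtain P Q where wit: "similar_mat_wit M (jordan_matrix bs) P Q"
    unfolding jordan_nf_def similar_mat_def by blast
  note w = similar_mat_witD2[OF M wit]
  have dim: "sum_list (map fst bs) = d"
    using w(5) by (metis carrier_matD(1) jordan_matrix_dim(1))
  have "jordan_matrix bs ^\<^sub>m m = Q * M ^\<^sub>m m * P"
    by (rule similar_mat_wit_pow_id[OF similar_mat_wit_sym[OF wit]])
  also have "\<dots> = 1\<^sub>m d" using w fo by simp
  finally have "fst b \<le> 1" if "b \<in> set bs" for b
    using jordan_matrix_pow_eq_one[of bs m b] dim fo that by simp
  \<comment> \<open>\<open>jordan_nf\<close> excludes empty blocks, so the upper bound leaves size
    exactly 1.\<close>
  moreover have "fst b \<noteq> 0" if "b \<in> set bs" for b
    using jnf that unfolding jordan_nf_def by (metis image_eqI)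
  ultimately have b1: "fst b = 1" if "b \<in> set bs" for b
    using that by (metis le_less_linear less_one antisym_conv2 le_neq_implies_less)
  define as where "as = map snd bs"
  have bs: "bs = map (Pair 1) as"
    unfolding as_def map_map comp_def by (rule map_idI[symmetric]) (simp add: b1 prod_eq_iff)
  have len: "length as = d"
    using dim unfolding bs by (induction as arbitrary: d) auto
  have "char_poly M = (\<Prod>(n, a)\<leftarrow>bs. [:- a, 1:] ^ n)" by (rule jordan_nf_char_poly[OF jnf])
  also have "\<dots> = (\<Prod>a\<leftarrow>as. [:- a, 1:])" by (simp add: bs comp_def)
  finally have cp: "char_poly M = (\<Prod>a\<leftarrow>as. [:- a, 1:])" .
  have JQ: "jordan_matrix bs * Q \<in> carrier_mat d d" using w by simp
  have "Q * M = Q * (P * (jordan_matrix bs * Q))" using w by (simp add: assoc_mult_mat)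
  also have "\<dots> = Q * P * (jordan_matrix bs * Q)" by (rule assoc_mult_mat[OF w(7,6) JQ, symmetric])
  also have "\<dots> = jordan_matrix bs * Q" unfolding w(2) by (rule left_mult_one_mat[OF JQ])
  finally have QM: "Q * M = jordan_matrix bs * Q" .
  have "(Q * M) $$ (i, l) = as ! i * Q $$ (i, l)" if il: "i < d" "l < d" for i l
  proof -
    have "(Q * M) $$ (i, l) = (\<Sum>j<d. jordan_matrix bs $$ (i, j) * Q $$ (j, l))"
      unfolding QM using w il by (auto simp: scalar_prod_def atLeast0LessThan)
    also have "\<dots> = (\<Sum>j<d. if j = i then as ! i * Q $$ (i, l) else 0)"
      unfolding bs using il len by (intro sum.cong) (auto simp: jordan_matrix_simple_index simp del: One_nat_def)
    finally show ?thesis using il by simp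
  qed
  with that len w cp show thesis by blast
qed

text \<open>In arbitrary coordinates the matrix of \<open>T\<close> has finite order, and its left
  eigenvectors turn these coordinates into diagonalizing ones. The list \<open>as\<close> then
  carries both the dimensions of the eigenspaces and the root multiplicities of the
  polynomial.\<close>

lemma finite_order_coordinates:
  fixes V :: "(complex, 'v) module"
  assumes vs: "vectorspace class_ring V" and fd: "vectorspace.fin_dim class_ring V"
    and Tc: "\<And>v. v \<in> carrier V \<Longrightarrow> T v \<in> carrier V"
    and Tadd: "\<And>u v. u \<in> carrier V \<Longrightarrow> v \<in> carrier V \<Longrightarrow> T (u \<oplus>\<^bsub>V\<^esub> v) = T u \<oplus>\<^bsub>V\<^esub> T v"
    and Tsmult: "\<And>c v. v \<in> carrier V \<Longrightarrow> T (c \<odot>\<^bsub>V\<^esub> v) = c \<odot>\<^bsub>V\<^esub> T v"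
    and fo: "\<And>v. v \<in> carrier V \<Longrightarrow> (T ^^ m) v = v" "m > 0"
  obtains as \<kappa> where "coordinates V (length as) \<kappa>"
    "\<And>i v. i < length as \<Longrightarrow> v \<in> carrier V \<Longrightarrow> \<kappa> i (T v) = as ! i * \<kappa> i v"
    "det_minus_t V T = (- 1) ^ length as * (\<Prod>a\<leftarrow>as. [:- a, 1:])"
proof -
  interpret vectorspace class_ring V by (rule vs)
  obtain d \<kappa> where k: "coordinates V d \<kappa>" using coordinates_exist[OF vs fd] by blast
  note add = coordinatesD(1)[OF k] and smult = coordinatesD(2)[OF k]
    and inj = coordinatesD(3)[OF k] and surj = coordinatesD(4)[OF k]
  have "\<exists>v. v \<in> carrier V \<and> (\<forall>i<d. \<kappa> i v = (if i = j then 1 else 0))" for j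
    using surj[of "\<lambda>i. if i = j then 1 else 0"] by blast
  then obtain e where e: "\<And>j. e j \<in> carrier V"
    "\<And>i j. i < d \<Longrightarrow> \<kappa> i (e j) = (if i = j then 1 else 0)" by metis
  have "\<exists>t. \<forall>v\<in>carrier V. \<kappa> i (T v) = (\<Sum>j<d. t j * \<kappa> j v)" if i: "i < d" for i
  proof -
    obtain t where "\<And>v. v \<in> carrier V \<Longrightarrow> \<kappa> i (T v) = (\<Sum>j<d. t j * \<kappa> j v)"
      by (rule coordinates_functional[OF vs k, of "\<lambda>v. \<kappa> i (T v)"])
        (simp_all add: i add smult Tadd Tsmult Tc)
    then show ?thesis by blast
  qed
  then obtain t where t: "\<And>i v. i < d \<Longrightarrow> v \<in> carrier V \<Longrightarrow> \<kappa> i (T v) = (\<Sum>j<d. t i j * \<kappa> j v)"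
    by metis
  define M where "M = mat d d (\<lambda>(i, j). t i j)"
  have M: "M \<in> carrier_mat d d" by (simp add: M_def)
  have kT: "\<kappa> i (T v) = (\<Sum>j<d. M $$ (i, j) * \<kappa> j v)" if "i < d" "v \<in> carrier V" for i v
    unfolding t[OF that] using that(1) by (intro sum.cong) (auto simp: M_def)
  have Tp: "(T ^^ p) v \<in> carrier V" if "v \<in> carrier V" for p v
    using that Tc by (induction p) auto
  have kTp: "\<kappa> i ((T ^^ p) v) = (\<Sum>j<d. (M ^\<^sub>m p) $$ (i, j) * \<kappa> j v)"
    if i: "i < d" and v: "v \<in> carrier V" for i v p
    using v
  proof (induction p arbitrary: v)
    case 0
    have "(\<Sum>j<d. (M ^\<^sub>m 0) $$ (i, j) * \<kappa> j v) = (\<Sum>j<d. if j = i then \<kappa> i v else 0)"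
      using i M by (intro sum.cong) auto
    then show ?case using i by simp
  next
    case (Suc p)
    have Mp: "M ^\<^sub>m p \<in> carrier_mat d d" using M by simp
    have "\<kappa> i ((T ^^ Suc p) v) = (\<Sum>j<d. (M ^\<^sub>m p) $$ (i, j) * \<kappa> j (T v))"
      using Suc Tc by (simp add: funpow_swap1)
    also have "\<dots> = (\<Sum>j<d. \<Sum>l<d. (M ^\<^sub>m p) $$ (i, j) * M $$ (j, l) * \<kappa> l v)"
      using Suc.prems by (intro sum.cong) (auto simp: kT sum_distrib_left mult.assoc)
    also have "\<dots> = (\<Sum>l<d. (\<Sum>j<d. (M ^\<^sub>m p) $$ (i, j) * M $$ (j, l)) * \<kappa> l v)"
      by (subst sum.swap) (simp add: sum_distrib_right)
    also have "\<dots> = (\<Sum>l<d. (M ^\<^sub>m Suc p) $$ (i, l) * \<kappa> l v)"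
      using i M Mp by (intro sum.cong) (auto simp: scalar_prod_def atLeast0LessThan)
    finally show ?case .
  qed
  have "M ^\<^sub>m m = 1\<^sub>m d"
  proof (rule eq_matI)
    fix i j assume "i < dim_row (1\<^sub>m d :: complex mat)" "j < dim_col (1\<^sub>m d :: complex mat)"
    then have ij: "i < d" "j < d" by auto
    have "(M ^\<^sub>m m) $$ (i, j) = \<kappa> i ((T ^^ m) (e j))"
      using ij e(1) by (simp add: kTp e(2) if_distrib cong: if_cong)
    then show "(M ^\<^sub>m m) $$ (i, j) = 1\<^sub>m d $$ (i, j)" using ij fo(1) e by simp
  qed (use M in auto)
  then obtain P Q as where D: "length as = d" "P \<in> carrier_mat d d" "Q \<in> carrier_mat d d"
    "P * Q = 1\<^sub>m d" "Q * P = 1\<^sub>m d"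
    "\<And>i l. i < d \<Longrightarrow> l < d \<Longrightarrow> (Q * M) $$ (i, l) = as ! i * Q $$ (i, l)"
    "char_poly M = (\<Prod>a\<leftarrow>as. [:- a, 1:])"
    using finite_order_matrix_diagonalizable[OF M _ fo(2)] by metis
  define \<mu> where "\<mu> i v = (\<Sum>j<d. Q $$ (i, j) * \<kappa> j v)" for i v
  have PQ: "(\<Sum>j<d. P $$ (i, j) * Q $$ (j, l)) = (if i = l then 1 else 0)" if "i < d" "l < d" for i l
    using arg_cong[OF D(4), of "\<lambda>A. A $$ (i, l)"] D(2,3) that
    by (auto simp: scalar_prod_def atLeast0LessThan)
  have QP: "(\<Sum>j<d. Q $$ (i, j) * P $$ (j, l)) = (if i = l then 1 else 0)" if "i < d" "l < d" for i l
    using arg_cong[OF D(5), of "\<lambda>A. A $$ (i, l)"] D(2,3) that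
    by (auto simp: scalar_prod_def atLeast0LessThan)
  have QM: "(\<Sum>j<d. Q $$ (i, j) * M $$ (j, l)) = as ! i * Q $$ (i, l)" if "i < d" "l < d" for i l
    using D(6)[OF that] D(3) M that by (auto simp: scalar_prod_def atLeast0LessThan)
  have "coordinates V (length as) \<mu>"
    unfolding coordinates_def D(1)
  proof (intro conjI allI ballI impI)
    fix i u v assume "i < d" "u \<in> carrier V" "v \<in> carrier V"
    then show "\<mu> i (u \<oplus>\<^bsub>V\<^esub> v) = \<mu> i u + \<mu> i v"
      by (simp add: \<mu>_def add algebra_simps sum.distrib)
  next
    fix i c v assume "i < d" "v \<in> carrier V"
    then show "\<mu> i (c \<odot>\<^bsub>V\<^esub> v) = c * \<mu> i v"
      by (simp add: \<mu>_def smult algebra_simps sum_distrib_left)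
  next
    fix u v assume uv: "u \<in> carrier V" "v \<in> carrier V" and eq: "\<forall>i<d. \<mu> i u = \<mu> i v"
    have inv: "\<kappa> i w = (\<Sum>j<d. P $$ (i, j) * \<mu> j w)" if i: "i < d" for i w
    proof -
      have "(\<Sum>j<d. P $$ (i, j) * \<mu> j w)
          = (\<Sum>j<d. \<Sum>l<d. P $$ (i, j) * Q $$ (j, l) * \<kappa> l w)"
        by (simp add: \<mu>_def sum_distrib_left mult.assoc)
      also have "\<dots> = (\<Sum>l<d. (\<Sum>j<d. P $$ (i, j) * Q $$ (j, l)) * \<kappa> l w)"
        by (subst sum.swap) (simp add: sum_distrib_right)
      also have "\<dots> = (\<Sum>l<d. if l = i then \<kappa> i w else 0)"
        using i by (intro sum.cong) (auto simp: PQ)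
      finally show ?thesis using i by simp
    qed
    show "u = v" using eq by (intro inj[OF uv]) (simp add: inv)
  next
    fix x :: "nat \<Rightarrow> complex"
    obtain v where v: "v \<in> carrier V" "\<And>i. i < d \<Longrightarrow> \<kappa> i v = (\<Sum>l<d. P $$ (i, l) * x l)"
      using surj[of "\<lambda>i. \<Sum>l<d. P $$ (i, l) * x l"] by blast
    have "\<mu> i v = x i" if i: "i < d" for i
    proof -
      have "\<mu> i v = (\<Sum>j<d. \<Sum>l<d. Q $$ (i, j) * P $$ (j, l) * x l)"
        by (simp add: \<mu>_def v sum_distrib_left mult.assoc)
      also have "\<dots> = (\<Sum>l<d. (\<Sum>j<d. Q $$ (i, j) * P $$ (j, l)) * x l)"
        by (subst sum.swap) (simp add: sum_distrib_right)
      also have "\<dots> = (\<Sum>l<d. if l = i then x i else 0)"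
        using i by (intro sum.cong) (auto simp: QP)
      finally show ?thesis using i by simp
    qed
    with v(1) show "\<exists>v\<in>carrier V. \<forall>i<d. \<mu> i v = x i" by blast
  qed
  moreover have "\<mu> i (T v) = as ! i * \<mu> i v" if i: "i < length as" and v: "v \<in> carrier V" for i v
  proof -
    have "\<mu> i (T v) = (\<Sum>j<d. \<Sum>l<d. Q $$ (i, j) * M $$ (j, l) * \<kappa> l v)"
      using v by (simp add: \<mu>_def kT sum_distrib_left mult.assoc)
    also have "\<dots> = (\<Sum>l<d. (\<Sum>j<d. Q $$ (i, j) * M $$ (j, l)) * \<kappa> l v)"
      by (subst sum.swap) (simp add: sum_distrib_right)
    also have "\<dots> = (\<Sum>l<d. as ! i * Q $$ (i, l) * \<kappa> l v)"
      using i D(1) by (intro sum.cong) (auto simp: QM)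
    finally show ?thesis by (simp add: \<mu>_def sum_distrib_left mult.assoc)
  qed
  moreover have "det_minus_t V T = (- 1) ^ length as * (\<Prod>a\<leftarrow>as. [:- a, 1:])"
    using det_minus_t_coordinates(2)[OF vs k M Tc kT] D(1,7) by simp
  ultimately show thesis by (rule that)
qed

lemma order_prod_list_linear:
  fixes as :: "'a :: idom list"
  shows "order a (\<Prod>b\<leftarrow>as. [:- b, 1:]) = count_list as a"
proof (induction as)
  case (Cons b as)
  have "(\<Prod>b\<leftarrow>as. [:- b, 1:]) \<noteq> 0" by (auto simp: prod_list_zero_iff)
  then have "order a ([:- b, 1:] * (\<Prod>b\<leftarrow>as. [:- b, 1:]))
      = order a [:- b, 1:] + order a (\<Prod>b\<leftarrow>as. [:- b, 1:])"
    by (intro order_mult) (metis mult_eq_0_iff pCons_eq_0_iff zero_neq_one)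
  with Cons show ?case by (simp add: order_linear' del: mult_pCons_left)
qed simp

lemma card_index_eq_count_list: "card {i. i < length as \<and> as ! i = a} = count_list as a"
  by (simp add: count_list_eq_length_filter length_filter_conv_card eq_commute conj_commute)

section \<open>Complexification\<close>

lemma complexification_add: "(\<oplus>\<^bsub>complexification A\<^esub>) =
    (<#>\<^bsub>free_Abelian_group (carrier A \<times> UNIV)\<^esub>)"
  by (simp add: complexification_def Let_def)

definition tensor_coset ::
    "('a, 'b) monoid_scheme \<Rightarrow> (('a \<times> complex) \<Rightarrow>\<^sub>0 int) \<Rightarrow> (('a \<times> complex) \<Rightarrow>\<^sub>0 int) set" where
  "tensor_coset A c = tensor_relations A #>\<^bsub>free_Abelian_group (carrier A \<times> UNIV)\<^esub> c"

text \<open>The tensor of \<open>a\<close> with 1; the tensors of \<open>a\<close> with other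
  complex numbers are its scalar multiples.\<close>

definition pure_tensor :: "('a, 'b) monoid_scheme \<Rightarrow> 'a \<Rightarrow> (('a \<times> complex) \<Rightarrow>\<^sub>0 int) set" where
  "pure_tensor A a = tensor_coset A (frag_of (a, 1))"

lemma keys_frag_extend_frag_of:
  assumes "Poly_Mapping.keys c \<subseteq> S" "\<And>p. p \<in> S \<Longrightarrow> f p \<in> S'"
  shows "Poly_Mapping.keys (frag_extend (\<lambda>p. frag_of (f p)) c) \<subseteq> S'"
  using keys_frag_extend[of "\<lambda>p. frag_of (f p)" c] assms by (fastforce simp: keys_frag_of)

section \<open>The tensor product as a complex vector space\<close>

context
  fixes A :: "('a, 'b) monoid_scheme"
  assumes A: "monoid A"
begin

private abbreviation "S \<equiv> carrier A \<times> (UNIV :: complex set)"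
private abbreviation "F \<equiv> free_Abelian_group S"
private abbreviation "E f \<equiv> frag_extend (\<lambda>p. frag_of (f p))"

interpretation F: comm_group F by (rule abelian_free_Abelian_group)

lemma F_add_closed: "c \<in> carrier F \<Longrightarrow> d \<in> carrier F \<Longrightarrow> c + d \<in> carrier F"
  using F.m_closed[of c d] by simp

lemma F_uminus_closed: "c \<in> carrier F \<Longrightarrow> - c \<in> carrier F"
  by simp

lemma F_diff_closed: "c \<in> carrier F \<Longrightarrow> d \<in> carrier F \<Longrightarrow> c - d \<in> carrier F"
  using keys_diff[of c d] by auto

lemma tensor_relations_subgroup: "subgroup (tensor_relations A) F"
  unfolding tensor_relations_def
proof (rule F.generate_is_subgroup, safe)
  fix a b z assume ab: "a \<in> carrier A" "b \<in> carrier A"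
  then have "a \<otimes>\<^bsub>A\<^esub> b \<in> carrier A" using A by (simp add: monoid.m_closed)
  with ab have "frag_of (a \<otimes>\<^bsub>A\<^esub> b, z) \<in> carrier F" "frag_of (a, z) \<in> carrier F"
    "frag_of (b, z) \<in> carrier F" for z :: complex by auto
  then show "frag_of (a \<otimes>\<^bsub>A\<^esub> b, z) - frag_of (a, z) - frag_of (b, z) \<in> carrier F" for z
    by (blast intro: F_diff_closed)
next
  fix a y z assume a: "a \<in> carrier A"
  then have "frag_of (a, z) \<in> carrier F" for z :: complex by auto
  then show "frag_of (a, y + z) - frag_of (a, y) - frag_of (a, z) \<in> carrier F"
    by (blast intro: F_diff_closed)
qed

interpretation R: normal "tensor_relations A" F
  by (rule F.subgroup_imp_normal[OF tensor_relations_subgroup])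

lemma tensor_relations_diff:
  assumes c: "c \<in> tensor_relations A" and d: "d \<in> tensor_relations A"
  shows "c - d \<in> tensor_relations A"
proof -
  have "d \<in> carrier F" using R.subset d by blast
  then have "- d \<in> tensor_relations A" using R.m_inv_closed[OF d] by simp
  then show ?thesis using R.m_closed[OF c, of "- d"] by simp
qed

lemma tensor_coset_eqI:
  assumes "c \<in> carrier F" "d \<in> carrier F" "c - d \<in> tensor_relations A"
  shows "tensor_coset A c = tensor_coset A d"
proof -
  have "c = (c - d) + d" by simp
  then have "c \<in> tensor_relations A #>\<^bsub>F\<^esub> d"
    using assms(3) unfolding r_coset_def by (metis UN_I mult_free_Abelian_group singletonI)
  then show ?thesis unfolding tensor_coset_def
    using F.repr_independence[OF _ assms(2) tensor_relations_subgroup] by metis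
qed

lemma tensor_coset_eqD:
  assumes "c \<in> carrier F" "d \<in> carrier F" "tensor_coset A c = tensor_coset A d"
  shows "c - d \<in> tensor_relations A"
proof -
  have "c \<in> tensor_relations A #>\<^bsub>F\<^esub> d"
    using assms F.rcos_self[OF assms(1) tensor_relations_subgroup] by (simp add: tensor_coset_def)
  then show ?thesis by (auto simp: r_coset_def)
qed

lemma carrier_complexification: "carrier (complexification A) = tensor_coset A ` carrier F"
  by (simp add: complexification_def Let_def carrier_FactGroup tensor_coset_def)

lemma tensor_coset_add:
  assumes "c \<in> carrier F" "d \<in> carrier F"
  shows "tensor_coset A c \<oplus>\<^bsub>complexification A\<^esub> tensor_coset A d = tensor_coset A (c + d)"
  using R.rcos_sum[OF assms] by (simp add: complexification_add tensor_coset_def)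

lemma zero_complexification: "\<zero>\<^bsub>complexification A\<^esub> = tensor_coset A 0"
  using F.coset_mult_one[OF R.subset]
  by (simp add: complexification_def Let_def tensor_coset_def)

text \<open>If \<open>E f\<close> preserves the relations, it maps the coset of \<open>c\<close>
  into the coset of \<open>E f c\<close>; the factor \<open>tensor_relations A\<close> in
  \<open>tensor_induced\<close> fills up this coset even where \<open>E f\<close> is not
  onto.\<close>

lemma tensor_induced_coset:
  assumes c: "c \<in> carrier F" and f: "\<And>p. p \<in> S \<Longrightarrow> f p \<in> S"
    and rel: "E f ` tensor_relations A \<subseteq> tensor_relations A"
  shows "tensor_induced A f (tensor_coset A c) = tensor_coset A (E f c)"
proof
  show "tensor_induced A f (tensor_coset A c) \<subseteq> tensor_coset A (E f c)"
  proof
    fix x assume "x \<in> tensor_induced A f (tensor_coset A c)"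
    then obtain r s where rs: "r \<in> tensor_relations A" "s \<in> tensor_relations A"
      "x = r + E f (s + c)"
      by (auto simp: tensor_induced_def tensor_coset_def set_mult_def r_coset_def)
    then have "x = (r + E f s) + E f c" by (simp add: frag_extend_add)
    moreover have "r + E f s \<in> tensor_relations A"
      using R.m_closed[of r "E f s"] rs rel by auto
    ultimately show "x \<in> tensor_coset A (E f c)"
      by (auto simp: tensor_coset_def r_coset_def)
  qed
  show "tensor_coset A (E f c) \<subseteq> tensor_induced A f (tensor_coset A c)"
  proof
    fix x assume "x \<in> tensor_coset A (E f c)"
    then obtain r where r: "r \<in> tensor_relations A" "x = r + E f c"
      by (auto simp: tensor_coset_def r_coset_def)
    have "c \<in> tensor_coset A c"
      unfolding tensor_coset_def by (rule F.rcos_self[OF c tensor_relations_subgroup])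
    with r show "x \<in> tensor_induced A f (tensor_coset A c)"
      by (auto simp: tensor_induced_def set_mult_def)
  qed
qed

lemma tensor_relations_image:
  assumes "\<And>a b z. a \<in> carrier A \<Longrightarrow> b \<in> carrier A \<Longrightarrow>
      E f (frag_of (a \<otimes>\<^bsub>A\<^esub> b, z) - frag_of (a, z) - frag_of (b, z)) \<in> tensor_relations A"
    and "\<And>a y z. a \<in> carrier A \<Longrightarrow>
      E f (frag_of (a, y + z) - frag_of (a, y) - frag_of (a, z)) \<in> tensor_relations A"
  shows "E f ` tensor_relations A \<subseteq> tensor_relations A"
proof safe
  let ?X = "{frag_of (a \<otimes>\<^bsub>A\<^esub> b, z) - frag_of (a, z) - frag_of (b, z) | a b z.
           a \<in> carrier A \<and> b \<in> carrier A} \<union>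
        {frag_of (a, y + z) - frag_of (a, y) - frag_of (a, z) | a y z. a \<in> carrier A}"
  have X: "?X \<subseteq> carrier F"
    using R.subset unfolding tensor_relations_def by (blast intro: generate.incl)
  have gen: "E f x \<in> tensor_relations A" if "x \<in> ?X" for x using that assms by blast
  fix x assume "x \<in> tensor_relations A"
  then have "x \<in> generate F ?X" by (simp add: tensor_relations_def)
  then show "E f x \<in> tensor_relations A"
  proof induction
    case one
    then show ?case using R.one_closed by simp
  next
    case (incl h)
    then show ?case by (rule gen)
  next
    case (inv h)
    then have "h \<in> carrier F" using X by blast
    then have "Poly_Mapping.keys h \<subseteq> S" by simp
    then show ?case using tensor_relations_diff[OF _ gen[OF inv], of 0] R.one_closed
      by (simp add: frag_extend_minus)
  next
    case (eng h1 h2)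
    then show ?case using R.m_closed[of "E f h1" "E f h2"] by (simp add: frag_extend_add)
  qed
qed

lemma tensor_relationsI:
  "a \<in> carrier A \<Longrightarrow> b \<in> carrier A \<Longrightarrow>
    frag_of (a \<otimes>\<^bsub>A\<^esub> b, z) - frag_of (a, z) - frag_of (b, z) \<in> tensor_relations A"
  "a \<in> carrier A \<Longrightarrow>
    frag_of (a, y + z) - frag_of (a, y) - frag_of (a, z) \<in> tensor_relations A"
  unfolding tensor_relations_def by (rule generate.incl, blast)+

lemma smult_tensor_coset:
  assumes "c \<in> carrier F"
  shows "z \<odot>\<^bsub>complexification A\<^esub> tensor_coset A c = tensor_coset A (E (\<lambda>(a, y). (a, z * y)) c)"
proof -
  have "tensor_induced A (\<lambda>(a, y). (a, z * y)) (tensor_coset A c)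
      = tensor_coset A (E (\<lambda>(a, y). (a, z * y)) c)"
    using assms
    by (intro tensor_induced_coset tensor_relations_image)
      (auto simp: frag_extend_diff distrib_left intro: tensor_relationsI)
  then show ?thesis by (simp add: complexification_def Let_def)
qed

lemma complexification_map_tensor_coset:
  assumes h: "h \<in> hom A A" and c: "c \<in> carrier F"
  shows "complexification_map A h (tensor_coset A c) = tensor_coset A (E (\<lambda>(a, y). (h a, y)) c)"
proof -
  have "h a \<in> carrier A" if "a \<in> carrier A" for a using h that by (auto simp: hom_def)
  then show ?thesis
    unfolding complexification_map_def using c hom_mult[OF h]
    by (intro tensor_induced_coset tensor_relations_image)
      (auto simp: frag_extend_diff intro: tensor_relationsI)
qed

lemma E_closed:
  "c \<in> carrier F \<Longrightarrow> (\<And>p. p \<in> S \<Longrightarrow> f p \<in> S) \<Longrightarrow> E f c \<in> carrier F"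
  using keys_frag_extend_frag_of[of c S f S] by simp

lemma E_compose: "E f (E g c) = E (\<lambda>p. f (g p)) c"
  using frag_extend_compose[of "\<lambda>p. frag_of (f p)" g c] by (simp add: comp_def)

lemma E_scale_closed: "c \<in> carrier F \<Longrightarrow> E (\<lambda>(a, y). (a, z * y)) c \<in> carrier F"
  by (intro E_closed) auto

lemma vectorspace_complexification: "vectorspace class_ring (complexification A)"
proof -
  let ?V = "complexification A"
  note add = tensor_coset_add and sm = smult_tensor_coset and cV = carrier_complexification
    and z = zero_complexification
  have F0: "0 \<in> carrier F" by simp
  have VE: "\<exists>c\<in>carrier F. v = tensor_coset A c" if "v \<in> carrier ?V" for v
    using that by (auto simp: cV)
  show ?thesis
  proof (rule vs_criteria; (intro allI ballI impI; (elim conjE)?)?)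
    show "field (class_ring :: complex ring)" by (rule class_field)
    show "\<zero>\<^bsub>?V\<^esub> \<in> carrier ?V" unfolding z cV using F0 by blast
    fix v assume "v \<in> carrier ?V"
    then obtain c where v: "v = tensor_coset A c" and c: "c \<in> carrier F" using VE by blast
    show "\<exists>w\<in>carrier ?V. v \<oplus>\<^bsub>?V\<^esub> w = \<zero>\<^bsub>?V\<^esub>"
      unfolding v z cV using c add[OF c F_uminus_closed[OF c]] F_uminus_closed[OF c] by force
    show "v \<oplus>\<^bsub>?V\<^esub> \<zero>\<^bsub>?V\<^esub> = v" unfolding v z using add[OF c F0] by simp
    have "E (\<lambda>(a, y). (a, 1 * y)) c = c" by (simp add: case_prod_beta frag_expansion[symmetric])
    then show "\<one>\<^bsub>class_ring\<^esub> \<odot>\<^bsub>?V\<^esub> v = v" unfolding v using sm[OF c, of 1] by simp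
    {
      fix x :: complex
      show "x \<odot>\<^bsub>?V\<^esub> v \<in> carrier ?V" unfolding v sm[OF c] cV using E_scale_closed[OF c] by blast
      fix y :: complex
      show "x \<otimes>\<^bsub>class_ring\<^esub> y \<odot>\<^bsub>?V\<^esub> v = x \<odot>\<^bsub>?V\<^esub> (y \<odot>\<^bsub>?V\<^esub> v)"
        unfolding v sm[OF c] sm[OF E_scale_closed[OF c]] E_compose
        by (simp add: case_prod_beta mult.assoc)
      \<comment> \<open>Distributivity over a sum of scalars holds only modulo the second family of
        relations; it is checked on the generators and extended to formal differences.\<close>
      have "E (\<lambda>(a, u). (a, (x + y) * u)) d - E (\<lambda>(a, u). (a, x * u)) d
          - E (\<lambda>(a, u). (a, y * u)) d \<in> tensor_relations A"
        if "Poly_Mapping.keys d \<subseteq> S" for d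
        using that
      proof (induction d rule: frag_induction)
        case zero
        then show ?case using R.one_closed by simp
      next
        case (one p)
        then show ?case by (auto simp: distrib_right intro: tensor_relationsI)
      next
        case (diff a b)
        have *: "p - q \<in> tensor_relations A \<Longrightarrow> p - q = p' \<Longrightarrow> p' \<in> tensor_relations A" for p q p'
          by simp
        show ?case
          by (rule *[OF tensor_relations_diff[OF diff]]) (simp add: frag_extend_diff)
      qed
      then show "(x \<oplus>\<^bsub>class_ring\<^esub> y) \<odot>\<^bsub>?V\<^esub> v = x \<odot>\<^bsub>?V\<^esub> v \<oplus>\<^bsub>?V\<^esub> y \<odot>\<^bsub>?V\<^esub> v"
        unfolding v sm[OF c] add[OF E_scale_closed[OF c] E_scale_closed[OF c]]
        using c E_scale_closed[OF c] F_add_closed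
        by (intro tensor_coset_eqI) (simp_all add: diff_diff_eq)
    }
    fix w assume "w \<in> carrier ?V"
    then obtain d where w: "w = tensor_coset A d" and d: "d \<in> carrier F" using VE by blast
    show "v \<oplus>\<^bsub>?V\<^esub> w \<in> carrier ?V"
      unfolding v w add[OF c d] cV using F_add_closed[OF c d] by blast
    show "v \<oplus>\<^bsub>?V\<^esub> w = w \<oplus>\<^bsub>?V\<^esub> v"
      unfolding v w add[OF c d] add[OF d c] by (simp add: add.commute)
    show "x \<odot>\<^bsub>?V\<^esub> (v \<oplus>\<^bsub>?V\<^esub> w) = x \<odot>\<^bsub>?V\<^esub> v \<oplus>\<^bsub>?V\<^esub> x \<odot>\<^bsub>?V\<^esub> w" for x :: complex
      unfolding v w add[OF c d] sm[OF c] sm[OF d] sm[OF F_add_closed[OF c d]]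
        add[OF E_scale_closed[OF c] E_scale_closed[OF d]]
      by (simp add: frag_extend_add)
    fix u assume "u \<in> carrier ?V"
    then obtain e where u: "u = tensor_coset A e" and e: "e \<in> carrier F" using VE by blast
    show "v \<oplus>\<^bsub>?V\<^esub> w \<oplus>\<^bsub>?V\<^esub> u = v \<oplus>\<^bsub>?V\<^esub> (w \<oplus>\<^bsub>?V\<^esub> u)"
      unfolding v w u add[OF c d] add[OF d e] add[OF c F_add_closed[OF d e]]
        add[OF F_add_closed[OF c d] e]
      by (simp add: add.assoc)
  qed
qed

section \<open>Pure tensors: induction and linear functionals\<close>

interpretation V: vectorspace class_ring "complexification A"
  by (rule vectorspace_complexification)

lemma pure_tensor_closed: "a \<in> carrier A \<Longrightarrow> pure_tensor A a \<in> carrier (complexification A)"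
  by (auto simp: pure_tensor_def carrier_complexification)

lemma pure_tensor_mult:
  assumes "a \<in> carrier A" "b \<in> carrier A"
  shows "pure_tensor A (a \<otimes>\<^bsub>A\<^esub> b) = pure_tensor A a \<oplus>\<^bsub>complexification A\<^esub> pure_tensor A b"
proof -
  have ab: "a \<otimes>\<^bsub>A\<^esub> b \<in> carrier A" using A assms by (simp add: monoid.m_closed)
  have c: "frag_of (a, 1) \<in> carrier F" "frag_of (b, 1) \<in> carrier F"
    "frag_of (a \<otimes>\<^bsub>A\<^esub> b, 1) \<in> carrier F" using assms ab by auto
  show ?thesis
    unfolding pure_tensor_def tensor_coset_add[OF c(1,2)]
    using tensor_relationsI(1)[OF assms, of 1] F_add_closed[OF c(1,2)] c(3)
    by (intro tensor_coset_eqI) (simp_all add: diff_diff_eq)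
qed

text \<open>Pure tensors span. Zero and differences come from the scalars 0 and -1, so closure under
  addition and scalars suffices.\<close>

lemma complexification_induct [consumes 1, case_names pure add smult]:
  assumes "v \<in> carrier (complexification A)"
    and pure: "\<And>a. a \<in> carrier A \<Longrightarrow> P (pure_tensor A a)"
    and add: "\<And>u v. u \<in> carrier (complexification A) \<Longrightarrow> v \<in> carrier (complexification A) \<Longrightarrow>
      P u \<Longrightarrow> P v \<Longrightarrow> P (u \<oplus>\<^bsub>complexification A\<^esub> v)"
    and smult: "\<And>c v. v \<in> carrier (complexification A) \<Longrightarrow> P v \<Longrightarrow> P (c \<odot>\<^bsub>complexification A\<^esub> v)"
  shows "P v"
proof -
  have gen: "P (tensor_coset A (frag_of p))" if pS: "p \<in> S" for p
  proof -
    obtain a z where p: "p = (a, z)" "a \<in> carrier A" using pS by (cases p) auto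
    have "tensor_coset A (frag_of p) = z \<odot>\<^bsub>complexification A\<^esub> pure_tensor A a"
      unfolding pure_tensor_def using p by (subst smult_tensor_coset) auto
    then show ?thesis using smult[OF pure_tensor_closed pure] p by simp
  qed
  \<comment> \<open>The support condition is part of the claim because the step for differences in
    \<open>frag_induction\<close> hands over the claim alone.\<close>
  have "Poly_Mapping.keys d \<subseteq> S \<and> P (tensor_coset A d)" if "Poly_Mapping.keys d \<subseteq> S" for d
    using that
  proof (induction d rule: frag_induction)
    case zero
    have "\<zero>\<^bsub>complexification A\<^esub> = 0 \<odot>\<^bsub>complexification A\<^esub> pure_tensor A \<one>\<^bsub>A\<^esub>"
      using V.smult_l_null[of "pure_tensor A \<one>\<^bsub>A\<^esub>"] pure_tensor_closed A by (simp add: monoid.one_closed)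
    then show ?case using smult[OF pure_tensor_closed pure, of "\<one>\<^bsub>A\<^esub>"] A
      by (simp add: zero_complexification monoid.one_closed)
  next
    case (one p)
    then show ?case using gen by auto
  next
    case (diff a b)
    then have ab: "a \<in> carrier F" "b \<in> carrier F" by auto
    have vc: "tensor_coset A a \<in> carrier (complexification A)"
      "tensor_coset A b \<in> carrier (complexification A)"
      using ab by (auto simp: carrier_complexification)
    have "tensor_coset A a = tensor_coset A (a - b) \<oplus>\<^bsub>complexification A\<^esub> tensor_coset A b"
      using ab F_add_closed[OF ab(1) F_uminus_closed[OF ab(2)]] by (simp add: tensor_coset_add)
    moreover have ab': "a - b \<in> carrier F"
      using F_add_closed[OF ab(1) F_uminus_closed[OF ab(2)]] by simp
    moreover have "tensor_coset A (a - b) \<in> carrier (complexification A)"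
      using ab' unfolding carrier_complexification by (rule imageI)
    moreover have "(- 1) \<odot>\<^bsub>complexification A\<^esub> tensor_coset A b
        = \<ominus>\<^bsub>complexification A\<^esub> tensor_coset A b"
      using V.smult_minus_1[OF vc(2)] by (simp add: class_ring_simps)
    ultimately have "tensor_coset A (a - b)
        = tensor_coset A a \<oplus>\<^bsub>complexification A\<^esub> (- 1) \<odot>\<^bsub>complexification A\<^esub> tensor_coset A b"
      using vc by (simp add: V.a_assoc V.r_neg)
    then show ?case using diff vc ab' add[OF vc(1) _ _ smult[OF vc(2)]] by simp
  qed
  then show ?thesis using assms(1) by (auto simp: carrier_complexification)
qed

text \<open>The universal property of the tensor product, for the biadditive map that sends (a, z)
  to z times \<open>\<phi> a\<close>.\<close>

lemma complexification_functional:
  assumes \<phi>: "\<And>a b. a \<in> carrier A \<Longrightarrow> b \<in> carrier A \<Longrightarrow> \<phi> (a \<otimes>\<^bsub>A\<^esub> b) = \<phi> a + (\<phi> b :: complex)"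
  obtains f where
    "\<And>u v. u \<in> carrier (complexification A) \<Longrightarrow> v \<in> carrier (complexification A) \<Longrightarrow>
      f (u \<oplus>\<^bsub>complexification A\<^esub> v) = f u + (f v :: complex)"
    "\<And>c v. v \<in> carrier (complexification A) \<Longrightarrow> f (c \<odot>\<^bsub>complexification A\<^esub> v) = c * f v"
    "\<And>a. a \<in> carrier A \<Longrightarrow> f (pure_tensor A a) = \<phi> a"
proof -
  \<comment> \<open>The additive group of the complex numbers as a monoid record, the target
    required by \<open>free_Abelian_group_universal\<close>.\<close>
  define C :: "complex monoid" where "C = \<lparr>carrier = UNIV, monoid.mult = (+), one = 0\<rparr>"
  have "comm_group C"
  proof (rule comm_groupI)
    fix x assume "x \<in> carrier C"
    show "\<exists>y\<in>carrier C. y \<otimes>\<^bsub>C\<^esub> x = \<one>\<^bsub>C\<^esub>"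
      by (intro bexI[of _ "- x"]) (simp_all add: C_def)
  qed (simp_all add: C_def)
  then interpret C: comm_group C .
  obtain g where g: "g \<in> hom F C" "\<And>p. p \<in> S \<Longrightarrow> g (frag_of p) = (case p of (a, z) \<Rightarrow> z * \<phi> a)"
    using C.free_Abelian_group_universal[of "\<lambda>(a, z). z * \<phi> a" S] by (auto simp: C_def)
  have gadd: "g (c + d) = g c + g d" if "c \<in> carrier F" "d \<in> carrier F" for c d
    using hom_mult[OF g(1) that] by (simp add: C_def)
  have gdiff: "g (c - d) = g c - g d" if "c \<in> carrier F" "d \<in> carrier F" for c d
    using gadd[of "c - d" d] that F_add_closed[OF that(1) F_uminus_closed[OF that(2)]] by simp
  have g0: "g 0 = 0" using gadd[of 0 0] by simp
  have "g r = 0" if "r \<in> tensor_relations A" for r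
  proof -
    let ?X = "{frag_of (a \<otimes>\<^bsub>A\<^esub> b, z) - frag_of (a, z) - frag_of (b, z) | a b z.
           a \<in> carrier A \<and> b \<in> carrier A} \<union>
        {frag_of (a, y + z) - frag_of (a, y) - frag_of (a, z) | a y z. a \<in> carrier A}"
    have X: "?X \<subseteq> carrier F"
      using R.subset unfolding tensor_relations_def by (blast intro: generate.incl)
    have diffc: "c - d \<in> carrier F" if "c \<in> carrier F" "d \<in> carrier F" for c d
      using F_add_closed[OF that(1) F_uminus_closed[OF that(2)]] by simp
    have fc: "frag_of (a, z) \<in> carrier F" if "a \<in> carrier A" for a z using that by auto
    have gX: "g x = 0" if "x \<in> ?X" for x
      using that
    proof
      assume "x \<in> {frag_of (a \<otimes>\<^bsub>A\<^esub> b, z) - frag_of (a, z) - frag_of (b, z) | a b z.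
           a \<in> carrier A \<and> b \<in> carrier A}"
      then obtain a b z where x: "x = frag_of (a \<otimes>\<^bsub>A\<^esub> b, z) - frag_of (a, z) - frag_of (b, z)"
        "a \<in> carrier A" "b \<in> carrier A" by blast
      have ab: "a \<otimes>\<^bsub>A\<^esub> b \<in> carrier A" using A x by (simp add: monoid.m_closed)
      show ?thesis
        unfolding x(1) gdiff[OF diffc[OF fc[OF ab] fc[OF x(2)]] fc[OF x(3)]]
          gdiff[OF fc[OF ab] fc[OF x(2)]]
        using x ab g(2) \<phi> by (simp add: distrib_left)
    next
      assume "x \<in> {frag_of (a, y + z) - frag_of (a, y) - frag_of (a, z) | a y z. a \<in> carrier A}"
      then obtain a y z where x: "x = frag_of (a, y + z) - frag_of (a, y) - frag_of (a, z)"
        "a \<in> carrier A" by blast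
      show ?thesis
        unfolding x(1) gdiff[OF diffc[OF fc[OF x(2)] fc[OF x(2)]] fc[OF x(2)]]
          gdiff[OF fc[OF x(2)] fc[OF x(2)]]
        using x g(2) by (simp add: distrib_right)
    qed
    have "r \<in> generate F ?X" using that by (simp add: tensor_relations_def)
    then show ?thesis
    proof induction
      case one
      then show ?case by (simp add: g0)
    next
      case (incl h)
      then show ?case by (rule gX)
    next
      case (inv h)
      then have h: "h \<in> carrier F" using X by blast
      then have "Poly_Mapping.keys h \<subseteq> S" by simp
      then show ?case using gdiff[of 0 h] gX[OF inv] g0 h by simp
    next
      case (eng h1 h2)
      then have "h1 \<in> carrier F" "h2 \<in> carrier F" using F.generate_in_carrier[OF X] by blast+
      with eng show ?case by (simp add: gadd)
    qed
  qed
  then have geq: "g c = g d" if "c \<in> carrier F" "d \<in> carrier F" "tensor_coset A c = tensor_coset A d" for c d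
    using tensor_coset_eqD[OF that] gdiff[OF that(1,2)] by simp
  \<comment> \<open>\<open>g\<close> is constant on cosets, so any representative serves.\<close>
  define f where "f v = g (SOME c. c \<in> carrier F \<and> tensor_coset A c = v)" for v
  have f: "f (tensor_coset A c) = g c" if "c \<in> carrier F" for c
  proof -
    have "(SOME d. d \<in> carrier F \<and> tensor_coset A d = tensor_coset A c) \<in> carrier F \<and>
      tensor_coset A (SOME d. d \<in> carrier F \<and> tensor_coset A d = tensor_coset A c) = tensor_coset A c"
      by (rule someI[of _ c]) (use that in blast)
    then show ?thesis unfolding f_def using geq that by blast
  qed
  show thesis
  proof (rule that)
    fix u v assume "u \<in> carrier (complexification A)" "v \<in> carrier (complexification A)"
    then obtain c d where "u = tensor_coset A c" "c \<in> carrier F" "v = tensor_coset A d" "d \<in> carrier F"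
      unfolding carrier_complexification by blast
    then show "f (u \<oplus>\<^bsub>complexification A\<^esub> v) = f u + f v"
      by (simp only: tensor_coset_add f gadd F_add_closed)
  next
    fix z v assume "v \<in> carrier (complexification A)"
    then obtain c where c: "v = tensor_coset A c" "c \<in> carrier F"
      unfolding carrier_complexification by blast
    have "Poly_Mapping.keys d \<subseteq> S \<and> g (E (\<lambda>(a, y). (a, z * y)) d) = z * g d"
      if "Poly_Mapping.keys d \<subseteq> S" for d
      using that
    proof (induction d rule: frag_induction)
      case (diff a b)
      then have ab: "a \<in> carrier F" "b \<in> carrier F" by auto
      have "Poly_Mapping.keys (a - b) \<subseteq> S" using ab keys_diff[of a b] by auto
      moreover have "g (E (\<lambda>(a, y). (a, z * y)) (a - b)) = z * g (a - b)"
        using diff gdiff[OF ab] gdiff[OF E_scale_closed[OF ab(1)] E_scale_closed[OF ab(2)], of z z]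
        by (simp add: frag_extend_diff right_diff_distrib)
      ultimately show ?case ..
    qed (auto simp: g0 g(2))
    then show "f (z \<odot>\<^bsub>complexification A\<^esub> v) = z * f v"
      using c by (simp add: smult_tensor_coset f[OF E_scale_closed] f)
  next
    fix a assume "a \<in> carrier A"
    then show "f (pure_tensor A a) = \<phi> a" by (simp add: pure_tensor_def f g(2))
  qed
qed

section \<open>The endomorphism induced on the complexification\<close>

context
  fixes h assumes h: "h \<in> hom A A"
begin

lemma E_map_closed: "c \<in> carrier F \<Longrightarrow> E (\<lambda>(a, y). (h a, y)) c \<in> carrier F"
  using h by (intro E_closed) (auto simp: hom_def)

lemma complexification_map_closed:
  assumes "v \<in> carrier (complexification A)"
  shows "complexification_map A h v \<in> carrier (complexification A)"
proof -
  obtain c where c: "v = tensor_coset A c" "c \<in> carrier F"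
    using assms unfolding carrier_complexification by blast
  show ?thesis
    unfolding c(1) complexification_map_tensor_coset[OF h c(2)] carrier_complexification
    using E_map_closed[OF c(2)] by blast
qed

lemma complexification_map_add:
  assumes "u \<in> carrier (complexification A)" "v \<in> carrier (complexification A)"
  shows "complexification_map A h (u \<oplus>\<^bsub>complexification A\<^esub> v)
    = complexification_map A h u \<oplus>\<^bsub>complexification A\<^esub> complexification_map A h v"
proof -
  obtain c d where c: "u = tensor_coset A c" "c \<in> carrier F" "v = tensor_coset A d" "d \<in> carrier F"
    using assms unfolding carrier_complexification by blast
  then show ?thesis
    by (simp only: tensor_coset_add complexification_map_tensor_coset[OF h] F_add_closed
        E_map_closed frag_extend_add)
qed

lemma complexification_map_smult:
  assumes "v \<in> carrier (complexification A)"
  shows "complexification_map A h (z \<odot>\<^bsub>complexification A\<^esub> v)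
    = z \<odot>\<^bsub>complexification A\<^esub> complexification_map A h v"
proof -
  obtain c where c: "v = tensor_coset A c" "c \<in> carrier F"
    using assms unfolding carrier_complexification by blast
  show ?thesis
    unfolding c(1) smult_tensor_coset[OF c(2)] complexification_map_tensor_coset[OF h c(2)]
      complexification_map_tensor_coset[OF h E_scale_closed[OF c(2)]]
      smult_tensor_coset[OF E_map_closed[OF c(2)]] E_compose
    by (simp add: case_prod_beta)
qed

lemma complexification_map_pure:
  "a \<in> carrier A \<Longrightarrow> complexification_map A h (pure_tensor A a) = pure_tensor A (h a)"
  by (simp add: pure_tensor_def complexification_map_tensor_coset[OF h])

end

end

section \<open>Free groups and presentations\<close>

declare One_nat_def [simp del]

lemma carrier_free_group: "u \<in> carrier (free_group X) \<longleftrightarrow> reduced u \<and> fst ` set u \<subseteq> X"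
  and mult_free_group: "u \<otimes>\<^bsub>free_group X\<^esub> v = foldr reduced_cons u v"
  and one_free_group: "\<one>\<^bsub>free_group X\<^esub> = []"
  by (auto simp: free_group_def)

lemma free_gen_closed: "x \<in> X \<Longrightarrow> free_gen x \<in> carrier (free_group X)"
  by (simp add: carrier_free_group free_gen_def reduced_def)

lemma inv_free_gen:
  assumes "x \<in> X"
  shows "inv\<^bsub>free_group X\<^esub> free_gen x = [(x, False)]"
proof -
  interpret group "free_group X" by (rule group_free_group)
  show ?thesis
  proof (rule inv_equality)
    show "[(x, False)] \<otimes>\<^bsub>free_group X\<^esub> free_gen x = \<one>\<^bsub>free_group X\<^esub>"
      by (simp add: mult_free_group one_free_group free_gen_def cancels_def)
  qed (use assms in \<open>auto simp: carrier_free_group free_gen_def reduced_def\<close>)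
qed

section \<open>Evaluation of words and homomorphisms from free groups\<close>

definition letter_eval :: "('h, 'b) monoid_scheme \<Rightarrow> ('a \<Rightarrow> 'h) \<Rightarrow> 'a \<times> bool \<Rightarrow> 'h" where
  "letter_eval H c a = (if snd a then c (fst a) else inv\<^bsub>H\<^esub> c (fst a))"

definition word_eval :: "('h, 'b) monoid_scheme \<Rightarrow> ('a \<Rightarrow> 'h) \<Rightarrow> 'a word \<Rightarrow> 'h" where
  "word_eval H c u = foldr (\<lambda>a h. letter_eval H c a \<otimes>\<^bsub>H\<^esub> h) u \<one>\<^bsub>H\<^esub>"

lemma word_eval_simps [simp]:
  "word_eval H c [] = \<one>\<^bsub>H\<^esub>"
  "word_eval H c (a # u) = letter_eval H c a \<otimes>\<^bsub>H\<^esub> word_eval H c u"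
  by (simp_all add: word_eval_def)

context group
begin

lemma letter_eval_closed: "c \<in> X \<rightarrow> carrier G \<Longrightarrow> fst a \<in> X \<Longrightarrow> letter_eval G c a \<in> carrier G"
  by (auto simp: letter_eval_def)

lemma word_eval_closed:
  assumes "c \<in> X \<rightarrow> carrier G"
  shows "fst ` set u \<subseteq> X \<Longrightarrow> word_eval G c u \<in> carrier G"
  by (induction u) (auto intro: letter_eval_closed[OF assms])

text \<open>A pair of letters removed by free reduction is also cancelled by evaluation; this makes
  \<open>word_eval\<close> multiplicative on the free group.\<close>

lemma word_eval_reduced_cons:
  assumes c: "c \<in> X \<rightarrow> carrier G" and "fst a \<in> X" "fst ` set u \<subseteq> X"
  shows "word_eval G c (reduced_cons a u) = letter_eval G c a \<otimes> word_eval G c u"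
proof (cases u)
  case (Cons b v)
  show ?thesis
  proof (cases "cancels a b")
    case True
    have "letter_eval G c a \<otimes> letter_eval G c b = \<one>"
      using True funcset_mem[OF c, of "fst a"] assms(2) by (auto simp: letter_eval_def cancels_def)
    moreover have "letter_eval G c a \<in> carrier G" "letter_eval G c b \<in> carrier G"
      "word_eval G c v \<in> carrier G"
      using assms Cons by (auto intro: letter_eval_closed word_eval_closed)
    ultimately show ?thesis using True Cons by (simp add: m_assoc[symmetric])
  qed (use Cons in simp)
qed simp

lemma word_eval_hom:
  assumes c: "c \<in> X \<rightarrow> carrier G"
  shows "word_eval G c \<in> hom (free_group X) G"
proof (rule homI)
  fix u v assume u: "u \<in> carrier (free_group X)" and v: "v \<in> carrier (free_group X)"
  have "word_eval G c (foldr reduced_cons u v) = word_eval G c u \<otimes> word_eval G c v"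
    if "fst ` set u \<subseteq> X" "fst ` set v \<subseteq> X" for u v
    using that
  proof (induction u)
    case Nil
    then show ?case using word_eval_closed[OF c, of v] by simp
  next
    case (Cons a u)
    have s: "fst ` set (foldr reduced_cons u v) \<subseteq> X"
      using set_foldr_reduced_cons[of u v] Cons.prems by fastforce
    have "letter_eval G c a \<in> carrier G" "word_eval G c u \<in> carrier G" "word_eval G c v \<in> carrier G"
      using Cons.prems by (auto intro: letter_eval_closed[OF c] word_eval_closed[OF c])
    then show ?case
      using Cons word_eval_reduced_cons[OF c _ s, of a] by (simp add: m_assoc)
  qed
  then show "word_eval G c (u \<otimes>\<^bsub>free_group X\<^esub> v) = word_eval G c u \<otimes> word_eval G c v"
    using u v by (simp add: mult_free_group carrier_free_group)
qed (simp add: carrier_free_group word_eval_closed[OF c])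

lemma word_eval_free_gen: "c \<in> X \<rightarrow> carrier G \<Longrightarrow> x \<in> X \<Longrightarrow> word_eval G c (free_gen x) = c x"
  using funcset_mem[of c X _ x] by (auto simp: free_gen_def letter_eval_def)

lemma hom_free_group_eq_word_eval:
  assumes \<rho>: "\<rho> \<in> hom (free_group X) G"
  shows "u \<in> carrier (free_group X) \<Longrightarrow> \<rho> u = word_eval G (\<lambda>x. \<rho> (free_gen x)) u"
proof (induction u)
  case Nil
  then show ?case using hom_one[OF \<rho> group_free_group] by (simp add: one_free_group is_group)
next
  case (Cons a u)
  interpret F: group "free_group X" by (rule group_free_group)
  interpret \<rho>: group_hom "free_group X" G \<rho>
    by unfold_locales (rule \<rho>)
  have u: "u \<in> carrier (free_group X)" and a: "fst a \<in> X" "[a] \<in> carrier (free_group X)"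
    using Cons.prems by (auto simp: carrier_free_group reduced_def successively_Cons)
  \<comment> \<open>Since \<open>a # u\<close> is reduced, no cancellation takes place in this
    product.\<close>
  have "a # u = [a] \<otimes>\<^bsub>free_group X\<^esub> u"
    using Cons.prems by (cases u) (auto simp: mult_free_group carrier_free_group reduced_def)
  then have "\<rho> (a # u) = \<rho> [a] \<otimes> \<rho> u" using u a by simp
  moreover have "\<rho> [a] = letter_eval G (\<lambda>x. \<rho> (free_gen x)) a"
    using a inv_free_gen[OF a(1)] \<rho>.hom_inv[OF free_gen_closed[OF a(1)]]
    by (cases a) (auto simp: letter_eval_def free_gen_def)
  ultimately show ?case using Cons.IH[OF u] by simp
qed

section \<open>Normal closures and relators\<close>

lemma normal_closure_normal:
  assumes "R \<subseteq> carrier G"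
  shows "normal_closure G R \<lhd> G"
  unfolding normal_closure_def
proof (rule normal_generateI)
  let ?R = "{g \<otimes> r \<otimes> inv g |g r. g \<in> carrier G \<and> r \<in> R}"
  show "?R \<subseteq> carrier G" using assms by auto
  fix h g assume "h \<in> ?R" and g: "g \<in> carrier G"
  then obtain g' r where h: "h = g' \<otimes> r \<otimes> inv g'" "g' \<in> carrier G" "r \<in> R" by blast
  then have "g \<otimes> h \<otimes> inv g = (g \<otimes> g') \<otimes> r \<otimes> inv (g \<otimes> g')"
    using g assms by (auto simp: m_assoc inv_mult_group)
  then show "g \<otimes> h \<otimes> inv g \<in> ?R" using g h by blast
qed

lemma normal_closure_subset:
  assumes "N \<lhd> G" "R \<subseteq> N"
  shows "normal_closure G R \<subseteq> N"
  unfolding normal_closure_def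
  using assms normal.inv_op_closed2[OF assms(1)]
  by (intro generate_subgroup_incl) (auto simp: normal_imp_subgroup)

lemma normal_closure_incl:
  assumes "R \<subseteq> carrier G" "r \<in> R"
  shows "r \<in> normal_closure G R"
  unfolding normal_closure_def
  by (rule generate.incl) (use assms in \<open>force intro: exI[of _ \<one>] exI[of _ r]\<close>)

end

lemma C_relators_closed:
  assumes "C_presentation m l w"
  shows "C_relators m l w \<subseteq> carrier (free_group {1..m})"
proof -
  interpret F: group "free_group {1..m}" by (rule group_free_group)
  show ?thesis
    using assms free_gen_closed[of _ "{1..m}"]
    by (auto simp: C_relators_def C_presentation_def Let_def intro!: F.m_closed F.inv_closed)
qed

text \<open>Translates relators into relations under any homomorphism; it serves both to read off
  the relations of a presented group and to check them in a target group.\<close>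

lemma hom_relator:
  assumes "group_hom F H \<rho>" "x \<in> carrier F" "y \<in> carrier F" "v \<in> carrier F"
  shows "\<rho> (inv\<^bsub>F\<^esub> x \<otimes>\<^bsub>F\<^esub> (inv\<^bsub>F\<^esub> v \<otimes>\<^bsub>F\<^esub> y \<otimes>\<^bsub>F\<^esub> v)) = \<one>\<^bsub>H\<^esub> \<longleftrightarrow>
    \<rho> x = inv\<^bsub>H\<^esub> \<rho> v \<otimes>\<^bsub>H\<^esub> \<rho> y \<otimes>\<^bsub>H\<^esub> \<rho> v"
proof -
  interpret group_hom F H \<rho> by fact
  have c: "\<rho> x \<in> carrier H" "inv\<^bsub>H\<^esub> \<rho> v \<otimes>\<^bsub>H\<^esub> \<rho> y \<otimes>\<^bsub>H\<^esub> \<rho> v \<in> carrier H" using assms(2-4) by auto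
  have "\<rho> (inv\<^bsub>F\<^esub> x \<otimes>\<^bsub>F\<^esub> (inv\<^bsub>F\<^esub> v \<otimes>\<^bsub>F\<^esub> y \<otimes>\<^bsub>F\<^esub> v))
      = inv\<^bsub>H\<^esub> \<rho> x \<otimes>\<^bsub>H\<^esub> (inv\<^bsub>H\<^esub> \<rho> v \<otimes>\<^bsub>H\<^esub> \<rho> y \<otimes>\<^bsub>H\<^esub> \<rho> v)"
    using assms(2-4) by simp
  then show ?thesis using c
    by (metis H.inv_equality H.inv_inv H.inv_closed H.l_inv)
qed

section \<open>Groups with a chosen C-presentation\<close>

locale C_group = group G for G :: "('g, 'b) monoid_scheme" (structure) +
  fixes S :: "'g set" and m :: nat and l :: "nat \<Rightarrow> nat \<Rightarrow> nat"
    and w :: "nat \<Rightarrow> nat \<Rightarrow> nat \<Rightarrow> nat word" and \<phi> :: "nat word set \<Rightarrow> 'g"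
  assumes presentation: "C_presentation m l w"
    and iso: "\<phi> \<in> iso (C_presented_group m l w) G"
    and S_eq: "\<phi> ` C_presented_generators m l w = S"
begin

definition gen :: "nat \<Rightarrow> 'g" where
  "gen i = \<phi> (C_presented_gen m l w i)"

abbreviation "FG \<equiv> free_group {1..m}"
abbreviation "K \<equiv> normal_closure FG (C_relators m l w)"

interpretation F: group FG by (rule group_free_group)
interpretation K: normal K FG by (rule F.normal_closure_normal[OF C_relators_closed[OF presentation]])
interpretation P: group "C_presented_group m l w"
  unfolding C_presented_group_def by (rule K.factorgroup_is_group)
interpretation \<phi>: group_hom "C_presented_group m l w" G \<phi>
  using iso by unfold_locales (simp add: iso_def)

lemma m_pos: "1 \<le> m"
  using presentation by (simp add: C_presentation_def)

lemma presentation_hom: "(\<lambda>u. \<phi> (K #>\<^bsub>FG\<^esub> u)) \<in> hom FG G"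
proof -
  have "(\<lambda>u. K #>\<^bsub>FG\<^esub> u) \<in> hom FG (C_presented_group m l w)"
    unfolding C_presented_group_def by (rule K.r_coset_hom_Mod)
  from Group.hom_compose[OF this \<phi>.homh] show ?thesis by (simp add: comp_def)
qed

lemma gen_closed: "i \<in> {1..m} \<Longrightarrow> gen i \<in> carrier G"
  using hom_in_carrier[OF presentation_hom free_gen_closed] by (simp add: gen_def C_presented_gen_def)

lemma gen_fun: "gen \<in> {1..m} \<rightarrow> carrier G"
  using gen_closed by blast

lemma presentation_hom_eq:
  "u \<in> carrier FG \<Longrightarrow> \<phi> (K #>\<^bsub>FG\<^esub> u) = word_eval G gen u"
  using hom_free_group_eq_word_eval[OF presentation_hom]
  by (simp add: gen_def[abs_def] C_presented_gen_def)

lemma word_eval_surj: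
  assumes "g \<in> carrier G"
  shows "\<exists>u\<in>carrier FG. g = word_eval G gen u"
proof -
  have "g \<in> \<phi> ` carrier (C_presented_group m l w)"
    using iso assms by (auto simp: iso_def bij_betw_def)
  then obtain u where "u \<in> carrier FG" "g = \<phi> (K #>\<^bsub>FG\<^esub> u)"
    by (auto simp: C_presented_group_def carrier_FactGroup)
  then show ?thesis using presentation_hom_eq by auto
qed

text \<open>Every element is the value of a word, and the steps peel off its first letter.
  Properties of crossed homomorphisms spread from the generators in this way.\<close>

lemma gen_induct [consumes 1, case_names one gen inv]:
  assumes "g \<in> carrier G"
    and one: "P \<one>"
    and gen: "\<And>i g. i \<in> {1..m} \<Longrightarrow> g \<in> carrier G \<Longrightarrow> P g \<Longrightarrow> P (gen i \<otimes> g)"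
    and inv: "\<And>i g. i \<in> {1..m} \<Longrightarrow> g \<in> carrier G \<Longrightarrow> P g \<Longrightarrow> P (inv (gen i) \<otimes> g)"
  shows "P g"
proof -
  have "P (word_eval G gen u)" if "fst ` set u \<subseteq> {1..m}" for u
    using that
  proof (induction u)
    case (Cons a u)
    then show ?case
      using gen[of "fst a" "word_eval G gen u"] inv[of "fst a" "word_eval G gen u"]
        word_eval_closed[OF gen_fun, of u]
      by (auto simp: letter_eval_def)
  qed (simp add: one)
  then show ?thesis using word_eval_surj[OF assms(1)] by (auto simp: carrier_free_group)
qed

lemma word_closed:
  assumes "i \<in> {1..m}" "j \<in> {1..m}" "k \<in> {1..l i j}"
  shows "w i j k \<in> carrier FG" "word_eval G gen (w i j k) \<in> carrier G"
proof -
  show "w i j k \<in> carrier FG" using assms presentation by (simp add: C_presentation_def)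
  then show "word_eval G gen (w i j k) \<in> carrier G"
    using word_eval_closed[OF gen_fun] by (simp add: carrier_free_group)
qed

lemma relator_mem:
  assumes "i \<in> {1..m}" "j \<in> {1..m}" "k \<in> {1..l i j}"
  shows "inv\<^bsub>FG\<^esub> free_gen i \<otimes>\<^bsub>FG\<^esub> (inv\<^bsub>FG\<^esub> w i j k \<otimes>\<^bsub>FG\<^esub> free_gen j \<otimes>\<^bsub>FG\<^esub> w i j k)
    \<in> C_relators m l w"
  using assms unfolding C_relators_def Let_def by blast

lemma relation:
  assumes "i \<in> {1..m}" "j \<in> {1..m}" "k \<in> {1..l i j}"
  shows "gen i = inv (word_eval G gen (w i j k)) \<otimes> gen j \<otimes> word_eval G gen (w i j k)"
proof -
  interpret h: group_hom FG G "word_eval G gen"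
    by (intro group_hom.intro group_hom_axioms.intro F.group_axioms group_axioms word_eval_hom[OF gen_fun])
  let ?r = "inv\<^bsub>FG\<^esub> free_gen i \<otimes>\<^bsub>FG\<^esub> (inv\<^bsub>FG\<^esub> w i j k \<otimes>\<^bsub>FG\<^esub> free_gen j \<otimes>\<^bsub>FG\<^esub> w i j k)"
  note c = free_gen_closed[OF assms(1)] free_gen_closed[OF assms(2)] word_closed(1)[OF assms]
  have "?r \<in> K"
    by (rule F.normal_closure_incl[OF C_relators_closed[OF presentation] relator_mem[OF assms]])
  then have "K #>\<^bsub>FG\<^esub> ?r = K" by (rule K.rcos_const[OF F.group_axioms])
  then have "\<phi> (K #>\<^bsub>FG\<^esub> ?r) = \<one>" using \<phi>.hom_one by (simp add: C_presented_group_def)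
  then have "word_eval G gen ?r = \<one>" using presentation_hom_eq[of ?r] c by simp
  then show ?thesis
    using hom_relator[OF h.group_hom_axioms c] word_eval_free_gen[OF gen_fun] assms by simp
qed

text \<open>Von Dyck's theorem: evaluation at \<open>c\<close> kills the relators, hence their
  normal closure, and so factors through the presented group.\<close>

lemma lift_exists:
  fixes H :: "('h, 'c) monoid_scheme"
  assumes H: "group H" and c: "c \<in> {1..m} \<rightarrow> carrier H"
    and rel: "\<And>i j k. i \<in> {1..m} \<Longrightarrow> j \<in> {1..m} \<Longrightarrow> k \<in> {1..l i j} \<Longrightarrow>
      c i = inv\<^bsub>H\<^esub> word_eval H c (w i j k) \<otimes>\<^bsub>H\<^esub> c j \<otimes>\<^bsub>H\<^esub> word_eval H c (w i j k)"
  shows "\<exists>\<rho>\<in>hom G H. \<forall>i\<in>{1..m}. \<rho> (gen i) = c i"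
proof -
  interpret H: group H by (rule H)
  interpret h: group_hom FG H "word_eval H c"
    by (intro group_hom.intro group_hom_axioms.intro F.group_axioms H.group_axioms H.word_eval_hom[OF c])
  have "C_relators m l w \<subseteq> kernel FG H (word_eval H c)"
  proof
    fix r assume r: "r \<in> C_relators m l w"
    then obtain i j k where ijk: "i \<in> {1..m}" "j \<in> {1..m}" "k \<in> {1..l i j}"
      and req: "r = inv\<^bsub>FG\<^esub> free_gen i \<otimes>\<^bsub>FG\<^esub> (inv\<^bsub>FG\<^esub> w i j k \<otimes>\<^bsub>FG\<^esub> free_gen j \<otimes>\<^bsub>FG\<^esub> w i j k)"
      unfolding C_relators_def Let_def by blast
    have "word_eval H c r = \<one>\<^bsub>H\<^esub>"
      unfolding req
      using hom_relator[OF h.group_hom_axioms free_gen_closed[OF ijk(1)] free_gen_closed[OF ijk(2)]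
          word_closed(1)[OF ijk]] rel[OF ijk] H.word_eval_free_gen[OF c] ijk by simp
    moreover have "r \<in> carrier FG" using r C_relators_closed[OF presentation] by blast
    ultimately show "r \<in> kernel FG H (word_eval H c)" by (simp add: kernel_def)
  qed
  then have K: "K \<subseteq> kernel FG H (word_eval H c)"
    by (intro F.normal_closure_subset h.normal_kernel)
  obtain \<sigma> where \<sigma>: "\<sigma> \<in> hom (C_presented_group m l w) H"
    "\<And>u. u \<in> carrier FG \<Longrightarrow> \<sigma> (K #>\<^bsub>FG\<^esub> u) = word_eval H c u"
    unfolding C_presented_group_def
  proof (rule FactGroup_universal[OF h.homh K.normal_axioms])
    fix u v assume uv: "u \<in> carrier FG" "v \<in> carrier FG" "K #>\<^bsub>FG\<^esub> u = K #>\<^bsub>FG\<^esub> v"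
    then have "u \<in> K #>\<^bsub>FG\<^esub> v" using F.rcos_self[OF uv(1) K.subgroup_axioms] by simp
    then obtain r where r: "r \<in> K" "u = r \<otimes>\<^bsub>FG\<^esub> v" by (auto simp: r_coset_def)
    then show "word_eval H c u = word_eval H c v"
      using K K.subset uv h.hom_mult[of r v] by (auto simp: kernel_def)
  qed blast
  let ?\<rho> = "\<sigma> \<circ> inv_into (carrier (C_presented_group m l w)) \<phi>"
  have "?\<rho> \<in> hom G H"
    using P.iso_set_sym[OF iso] \<sigma>(1) by (intro Group.hom_compose) (auto simp: iso_def)
  moreover have "?\<rho> (gen i) = c i" if i: "i \<in> {1..m}" for i
  proof -
    have "C_presented_gen m l w i \<in> carrier (C_presented_group m l w)"
      using free_gen_closed[OF i]
      by (auto simp: C_presented_gen_def C_presented_group_def carrier_FactGroup)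
    then have "inv_into (carrier (C_presented_group m l w)) \<phi> (gen i) = C_presented_gen m l w i"
      using iso unfolding gen_def by (simp add: iso_def bij_betw_def inv_into_f_f)
    then show ?thesis
      using \<sigma>(2)[OF free_gen_closed[OF i]] H.word_eval_free_gen[OF c i]
      by (simp add: C_presented_gen_def)
  qed
  ultimately show ?thesis by blast
qed

text \<open>\<open>\<phi>\<close> carries conjugates to conjugates and is onto, so the conjugating
  elements may range over \<open>G\<close> itself.\<close>

lemma C_generators: "S = {inv g \<otimes> gen i \<otimes> g | g i. g \<in> carrier G \<and> i \<in> {1..m}}"
proof -
  let ?P = "C_presented_group m l w" and ?x = "C_presented_gen m l w"
  have x: "?x i \<in> carrier ?P" if "i \<in> {1..m}" for i
    using free_gen_closed[OF that]
    by (auto simp: C_presented_gen_def C_presented_group_def carrier_FactGroup)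
  have conj: "\<phi> (inv\<^bsub>?P\<^esub> p \<otimes>\<^bsub>?P\<^esub> ?x i \<otimes>\<^bsub>?P\<^esub> p) = inv (\<phi> p) \<otimes> gen i \<otimes> \<phi> p"
    if "p \<in> carrier ?P" "i \<in> {1..m}" for p i
    using that(1) x[OF that(2)] by (simp add: gen_def \<phi>.hom_mult \<phi>.hom_inv P.m_closed P.inv_closed)
  have surj: "\<phi> ` carrier ?P = carrier G" using iso by (auto simp: iso_def bij_betw_def)
  show ?thesis
  proof safe
    fix s assume "s \<in> S"
    then obtain p i where "p \<in> carrier ?P" "i \<in> {1..m}"
      "s = \<phi> (inv\<^bsub>?P\<^esub> p \<otimes>\<^bsub>?P\<^esub> ?x i \<otimes>\<^bsub>?P\<^esub> p)"
      unfolding S_eq[symmetric] C_presented_generators_def Let_def by blast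
    then show "\<exists>g i. s = inv g \<otimes> gen i \<otimes> g \<and> g \<in> carrier G \<and> i \<in> {1..m}"
      using conj \<phi>.hom_closed by blast
  next
    fix g i assume "g \<in> carrier G" "i \<in> {1..m}"
    then obtain p where "p \<in> carrier ?P" "g = \<phi> p" using surj by blast
    then have "inv g \<otimes> gen i \<otimes> g = \<phi> (inv\<^bsub>?P\<^esub> p \<otimes>\<^bsub>?P\<^esub> ?x i \<otimes>\<^bsub>?P\<^esub> p)"
      using conj \<open>i \<in> {1..m}\<close> by simp
    moreover have "inv\<^bsub>?P\<^esub> p \<otimes>\<^bsub>?P\<^esub> ?x i \<otimes>\<^bsub>?P\<^esub> p \<in> C_presented_generators m l w"
      unfolding C_presented_generators_def Let_def
      using \<open>p \<in> carrier ?P\<close> \<open>i \<in> {1..m}\<close> by blast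
    ultimately show "inv g \<otimes> gen i \<otimes> g \<in> S" unfolding S_eq[symmetric] by simp
  qed
qed

section \<open>The degree homomorphism\<close>

definition deg :: "'g \<Rightarrow> int" where "deg = C_degree G S"

text \<open>Justifies the definite description in \<open>C_degree\<close>. Conjugation is trivial in
  the integers, so the constant map 1 respects all relations and lifts; uniqueness holds because the
  generators lie in \<open>S\<close>.\<close>

lemma deg_exists: "\<exists>!\<nu>. \<nu> \<in> hom G integer_group \<and> \<nu> \<in> extensional (carrier G) \<and> (\<forall>s\<in>S. \<nu> s = 1)"
proof -
  interpret Z: group integer_group by (rule group_integer_group)
  obtain \<rho> where \<rho>: "\<rho> \<in> hom G integer_group" "\<And>i. i \<in> {1..m} \<Longrightarrow> \<rho> (gen i) = 1"
  proof -
    have "\<exists>\<rho>\<in>hom G integer_group. \<forall>i\<in>{1..m}. \<rho> (gen i) = 1"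
    proof (rule lift_exists[OF group_integer_group, of "\<lambda>_. 1"])
      fix i j k
      show "1 = inv\<^bsub>integer_group\<^esub> word_eval integer_group (\<lambda>_. 1) (w i j k) \<otimes>\<^bsub>integer_group\<^esub> 1
          \<otimes>\<^bsub>integer_group\<^esub> word_eval integer_group (\<lambda>_. 1) (w i j k)"
        using inv_integer_group by (simp add: integer_group_def[symmetric])
    qed simp
    then show thesis using that by blast
  qed
  let ?\<nu> = "restrict \<rho> (carrier G)"
  have \<nu>h: "?\<nu> \<in> hom G integer_group"
    using \<rho>(1) by (auto simp: hom_def)
  have conj: "\<nu> (inv g \<otimes> gen i \<otimes> g) = \<nu> (gen i)"
    if \<nu>: "\<nu> \<in> hom G integer_group" and gi: "g \<in> carrier G" "i \<in> {1..m}" for \<nu> g i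
  proof -
    interpret \<nu>: group_hom G integer_group \<nu> by unfold_locales (rule \<nu>)
    show ?thesis using gi gen_closed[of i] by simp
  qed
  show ?thesis
  proof (rule ex1I[of _ ?\<nu>])
    show "?\<nu> \<in> hom G integer_group \<and> ?\<nu> \<in> extensional (carrier G) \<and> (\<forall>s\<in>S. ?\<nu> s = 1)"
      unfolding C_generators using \<nu>h conj[OF \<rho>(1)] \<rho>(2) gen_closed by auto
    fix \<nu> assume \<nu>: "\<nu> \<in> hom G integer_group \<and> \<nu> \<in> extensional (carrier G) \<and> (\<forall>s\<in>S. \<nu> s = 1)"
    interpret \<nu>: group_hom G integer_group \<nu> using \<nu> by unfold_locales simp
    interpret \<rho>: group_hom G integer_group \<rho> using \<rho> by unfold_locales simp
    have g1: "\<nu> (gen i) = 1" if "i \<in> {1..m}" for i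
    proof -
      have "inv \<one> \<otimes> gen i \<otimes> \<one> \<in> S" unfolding C_generators using that by blast
      then show ?thesis using \<nu> gen_closed[OF that] by simp
    qed
    have "\<nu> g = \<rho> g" if "g \<in> carrier G" for g
      using that
    proof (induction g rule: gen_induct)
      case one
      then show ?case using \<nu>.hom_one \<rho>.hom_one by simp
    next
      case (gen i g)
      then show ?case using g1 \<rho>(2) gen_closed by simp
    next
      case (inv i g)
      then show ?case using g1 \<rho>(2) gen_closed by simp
    qed
    then show "\<nu> = ?\<nu>" using \<nu> by (intro extensionalityI[of _ "carrier G"]) auto
  qed
qed

lemma deg_props: "deg \<in> hom G integer_group" "s \<in> S \<Longrightarrow> deg s = 1"
  using theI'[OF deg_exists] by (simp_all add: deg_def C_degree_def)

sublocale deg: group_hom G integer_group deg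
  by (intro group_hom.intro group_hom_axioms.intro is_group group_integer_group deg_props)

lemma deg_one: "deg \<one> = 0"
  using deg.hom_one by simp

lemma S_closed: "s \<in> S \<Longrightarrow> s \<in> carrier G"
  unfolding C_generators using gen_closed by auto

lemma gen_in_S:
  assumes "i \<in> {1..m}"
  shows "gen i \<in> S"
proof -
  have "inv \<one> \<otimes> gen i \<otimes> \<one> \<in> S" unfolding C_generators using assms by blast
  then show ?thesis using gen_closed[OF assms] by simp
qed

lemma deg_gen: "i \<in> {1..m} \<Longrightarrow> deg (gen i) = 1"
  by (rule deg_props(2)[OF gen_in_S])

end

section \<open>The Alexander module\<close>

lemma (in group) inv_cancel:
  assumes "x \<in> carrier G" "y \<in> carrier G"
  shows "x \<otimes> (inv x \<otimes> y) = y" and "inv x \<otimes> (x \<otimes> y) = y"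
  using assms by (simp_all add: m_assoc[symmetric])

context C_group
begin

abbreviation "N \<equiv> C_kernel G S"
abbreviation "A \<equiv> alexander_module G S"
abbreviation "aut \<equiv> alexander_automorphism G S"

text \<open>A coset in all of \<open>G\<close>, so that representatives may be multiplied and
  conjugated there; for elements of \<open>N\<close> it is the class in N/N'.\<close>

definition cls :: "'g \<Rightarrow> 'g set" where "cls g = derived G N #> g"

lemma mem_N: "g \<in> N \<longleftrightarrow> g \<in> carrier G \<and> deg g = 0"
  by (simp add: C_kernel_def kernel_def deg_def integer_group_def)

lemma N_closed: "g \<in> N \<Longrightarrow> g \<in> carrier G"
  by (simp add: mem_N)

lemma normal_N: "N \<lhd> G"
  using deg.normal_kernel by (simp add: C_kernel_def deg_def)

interpretation N: normal N G by (rule normal_N)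
interpretation N': normal "derived G N" G by (rule derived_is_normal[OF normal_N])

declare N.mem_carrier [simp del] N'.mem_carrier [simp del]

lemma conj_N: "g \<in> N \<Longrightarrow> x \<in> carrier G \<Longrightarrow> inv x \<otimes> g \<otimes> x \<in> N"
  by (simp add: mem_N)

lemma carrier_alexander_module: "carrier A = cls ` N"
  by (simp add: alexander_module_def carrier_FactGroup cls_def r_coset_def)

lemma cls_in_carrier: "g \<in> N \<Longrightarrow> cls g \<in> carrier A"
  by (simp add: carrier_alexander_module)

lemma cls_mult: "g \<in> carrier G \<Longrightarrow> h \<in> carrier G \<Longrightarrow> cls (g \<otimes> h) = cls g \<otimes>\<^bsub>A\<^esub> cls h"
  using N'.rcos_sum[of g h] by (simp add: alexander_module_def cls_def set_mult_def)

lemma group_alexander_module: "group A"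
  unfolding alexander_module_def
  by (rule normal.factorgroup_is_group[OF derived_subgroup_is_normal[OF N.subgroup_axioms]])

lemma monoid_alexander_module: "monoid A"
  by (rule group.is_monoid[OF group_alexander_module])

lemma cls_eqI:
  assumes "g \<in> carrier G" "h \<in> carrier G" "g \<otimes> inv h \<in> derived G N"
  shows "cls g = cls h"
proof -
  have "g = (g \<otimes> inv h) \<otimes> h" using assms by (simp add: m_assoc)
  then have "g \<in> derived G N #> h" using assms(3) unfolding r_coset_def by blast
  then show ?thesis unfolding cls_def by (rule repr_independence[OF _ assms(2) N'.subgroup_axioms, symmetric])
qed

text \<open>The two representatives differ by the commutator of \<open>inv u\<close> and
  \<open>g\<close>.\<close>

lemma cls_conj_N:
  assumes "g \<in> N" "u \<in> N"
  shows "cls (inv u \<otimes> g \<otimes> u) = cls g"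
proof (rule cls_eqI)
  have "inv u \<otimes> g \<otimes> inv (inv u) \<otimes> inv g \<in> derived_set G N"
    using assms N.m_inv_closed[OF assms(2)] by blast
  then show "inv u \<otimes> g \<otimes> u \<otimes> inv g \<in> derived G N"
    using N_closed[OF assms(2)] unfolding derived_def by (simp add: generate.incl)
qed (use assms N_closed in auto)

text \<open>Elements of equal degree differ by an element of \<open>N\<close>, whose conjugation is
  trivial on N/N'. This is why h does not depend on the C-generator.\<close>

lemma cls_conj_eq:
  assumes g: "g \<in> N" and xy: "x \<in> carrier G" "y \<in> carrier G" "deg x = deg y"
  shows "cls (inv x \<otimes> g \<otimes> x) = cls (inv y \<otimes> g \<otimes> y)"
proof -
  let ?u = "inv y \<otimes> x" and ?g = "inv y \<otimes> g \<otimes> y"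
  have u: "?u \<in> N" using xy by (simp add: mem_N)
  have "inv ?u \<otimes> ?g \<otimes> ?u = inv x \<otimes> g \<otimes> x"
    using N_closed[OF g] xy(1,2) by (simp add: inv_mult_group m_assoc inv_cancel)
  then show ?thesis using cls_conj_N[OF conj_N[OF g xy(2)] u] by simp
qed

lemma S_nonempty: "S \<noteq> {}"
  using gen_in_S[of 1] m_pos by auto

text \<open>Removes the arbitrary choice in \<open>alexander_automorphism\<close>: any element of
  degree 1 computes it, in particular \<open>gen 1\<close>. Conjugation maps cosets onto cosets
  because N' is normal in \<open>G\<close>.\<close>

lemma aut_cls:
  assumes g: "g \<in> N" and y: "y \<in> carrier G" "deg y = 1"
  shows "aut (cls g) = cls (inv y \<otimes> g \<otimes> y)"
proof -
  define x where "x = (SOME s. s \<in> S)"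
  have "x \<in> S" unfolding x_def using S_nonempty by (rule some_in_eq[THEN iffD2])
  then have x: "x \<in> carrier G" "deg x = 1" by (auto simp: S_closed deg_props)
  have "aut (cls g) = (\<lambda>h. inv x \<otimes> h \<otimes> x) ` cls g"
    by (simp add: alexander_automorphism_def x_def Let_def)
  also have "\<dots> = cls (inv x \<otimes> g \<otimes> x)"
  proof safe
    fix h assume "h \<in> cls g"
    then obtain d where d: "d \<in> derived G N" "h = d \<otimes> g" by (auto simp: cls_def r_coset_def)
    have "d \<in> carrier G" using d N'.subset by blast
    then have "inv x \<otimes> h \<otimes> x = (inv x \<otimes> d \<otimes> x) \<otimes> (inv x \<otimes> g \<otimes> x)"
      using d(2) x(1) N_closed[OF g] by (simp add: m_assoc inv_cancel)
    moreover have "inv x \<otimes> d \<otimes> x \<in> derived G N" using N'.inv_op_closed1[OF x(1) d(1)] .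
    ultimately show "inv x \<otimes> h \<otimes> x \<in> cls (inv x \<otimes> g \<otimes> x)"
      by (auto simp: cls_def r_coset_def)
  next
    fix h assume "h \<in> cls (inv x \<otimes> g \<otimes> x)"
    then obtain d where d: "d \<in> derived G N" "h = d \<otimes> (inv x \<otimes> g \<otimes> x)"
      by (auto simp: cls_def r_coset_def)
    have dc: "d \<in> carrier G" using d N'.subset by blast
    have "h = inv x \<otimes> (x \<otimes> d \<otimes> inv x \<otimes> g) \<otimes> x"
      using d(2) dc x(1) N_closed[OF g] by (simp add: m_assoc inv_cancel)
    moreover have "x \<otimes> d \<otimes> inv x \<in> derived G N" using N'.inv_op_closed2[OF x(1) d(1)] .
    ultimately show "h \<in> (\<lambda>h. inv x \<otimes> h \<otimes> x) ` cls g"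
      by (auto simp: cls_def r_coset_def)
  qed
  also have "\<dots> = cls (inv y \<otimes> g \<otimes> y)" using cls_conj_eq[OF g x(1) y(1)] x y by simp
  finally show ?thesis .
qed

lemma gen1: "gen 1 \<in> carrier G" "deg (gen 1) = 1"
  using gen_closed[of 1] deg_gen[of 1] m_pos by auto

lemma aut_hom: "aut \<in> hom A A"
proof (rule homI)
  fix a assume "a \<in> carrier A"
  then obtain g where "g \<in> N" "a = cls g" by (auto simp: carrier_alexander_module)
  then show "aut a \<in> carrier A" using aut_cls[OF _ gen1] conj_N[OF _ gen1(1)] cls_in_carrier by simp
next
  fix a b assume "a \<in> carrier A" "b \<in> carrier A"
  then obtain g h where g: "g \<in> N" "a = cls g" and h: "h \<in> N" "b = cls h"
    by (auto simp: carrier_alexander_module)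
  let ?x = "gen 1"
  note c = N_closed[OF g(1)] N_closed[OF h(1)] gen1(1)
  have "inv ?x \<otimes> (g \<otimes> h) \<otimes> ?x = inv ?x \<otimes> g \<otimes> ?x \<otimes> (inv ?x \<otimes> h \<otimes> ?x)"
    using c by (simp add: m_assoc inv_cancel)
  then have "aut (cls (g \<otimes> h)) = cls (inv ?x \<otimes> g \<otimes> ?x) \<otimes>\<^bsub>A\<^esub> cls (inv ?x \<otimes> h \<otimes> ?x)"
    using aut_cls[OF N.m_closed[OF g(1) h(1)] gen1] c by (simp add: cls_mult)
  then show "aut (a \<otimes>\<^bsub>A\<^esub> b) = aut a \<otimes>\<^bsub>A\<^esub> aut b"
    using g h c aut_cls[OF _ gen1] by (simp add: cls_mult)
qed

text \<open>Only the degree of \<open>y\<close> matters, so a central \<open>y\<close> of degree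
  \<open>p\<close> will show that the \<open>p\<close>-th power is the identity. The induction peels
  off a factor \<open>gen 1\<close>.\<close>

lemma aut_funpow_cls:
  assumes g: "g \<in> N"
  shows "y \<in> carrier G \<Longrightarrow> deg y = int p \<Longrightarrow> (aut ^^ p) (cls g) = cls (inv y \<otimes> g \<otimes> y)"
proof (induction p arbitrary: y)
  case 0
  then show ?case using cls_conj_N[OF g, of y] by (simp add: mem_N)
next
  case (Suc p)
  let ?x = "gen 1"
  let ?y = "y \<otimes> inv ?x"
  have y: "?y \<in> carrier G" "deg ?y = int p" using Suc.prems gen1 by auto
  have "(aut ^^ Suc p) (cls g) = aut (cls (inv ?y \<otimes> g \<otimes> ?y))"
    using Suc.IH[OF y] by simp
  also have "\<dots> = cls (inv ?x \<otimes> (inv ?y \<otimes> g \<otimes> ?y) \<otimes> ?x)"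
    by (rule aut_cls[OF conj_N[OF g y(1)] gen1])
  also have "inv ?x \<otimes> (inv ?y \<otimes> g \<otimes> ?y) \<otimes> ?x = inv y \<otimes> g \<otimes> y"
    using N_closed[OF g] Suc.prems(1) gen1(1) by (simp add: inv_mult_group m_assoc inv_cancel)
  finally show ?case .
qed

section \<open>The complexified Alexander module and its operator\<close>

abbreviation "V \<equiv> complexification A"
abbreviation "T \<equiv> complexification_map A aut"

lemmas vectorspace_V = vectorspace_complexification[OF monoid_alexander_module]
lemmas V_induct [consumes 1, case_names pure add smult] =
  complexification_induct[OF monoid_alexander_module]
lemmas T_closed = complexification_map_closed[OF monoid_alexander_module aut_hom]
lemmas T_add = complexification_map_add[OF monoid_alexander_module aut_hom]
lemmas T_smult = complexification_map_smult[OF monoid_alexander_module aut_hom]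
lemmas T_pure = complexification_map_pure[OF monoid_alexander_module aut_hom]

interpretation V: vectorspace class_ring V by (rule vectorspace_V)

text \<open>Conjugation by the central element \<open>y\<close> is trivial, so the power fixes all
  pure tensors, and these span.\<close>

lemma T_funpow_eq_id:
  assumes y: "y \<in> carrier G" "deg y = int p" "\<And>g. g \<in> carrier G \<Longrightarrow> y \<otimes> g = g \<otimes> y"
    and v: "v \<in> carrier V"
  shows "(T ^^ p) v = v"
proof -
  have aut_closed: "(aut ^^ q) a \<in> carrier A" if "a \<in> carrier A" for q a
    using that by (induction q) (use aut_hom in \<open>auto simp: hom_def\<close>)
  have closed: "(T ^^ q) v \<in> carrier V" if "v \<in> carrier V" for q v
    using that by (induction q) (auto intro: T_closed)
  have Tadd: "(T ^^ q) (u \<oplus>\<^bsub>V\<^esub> v) = (T ^^ q) u \<oplus>\<^bsub>V\<^esub> (T ^^ q) v"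
    if "u \<in> carrier V" "v \<in> carrier V" for q u v
    using that by (induction q) (simp_all add: T_add closed)
  have Tsmult: "(T ^^ q) (c \<odot>\<^bsub>V\<^esub> v) = c \<odot>\<^bsub>V\<^esub> (T ^^ q) v" if "v \<in> carrier V" for q c v
    using that by (induction q) (simp_all add: T_smult closed)
  have tens: "(T ^^ q) (pure_tensor A a) = pure_tensor A ((aut ^^ q) a)" if "a \<in> carrier A" for q a
    using that by (induction q) (simp_all add: T_pure aut_closed)
  show ?thesis
    using v
  proof (induction v rule: V_induct)
    case (pure a)
    then obtain g where g: "g \<in> N" "a = cls g" by (auto simp: carrier_alexander_module)
    have "inv y \<otimes> g \<otimes> y = inv y \<otimes> (y \<otimes> g)"
      using y N_closed[OF g(1)] by (simp add: m_assoc)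
    also have "\<dots> = g" using y(1) N_closed[OF g(1)] by (simp add: m_assoc[symmetric])
    finally show ?case using pure tens aut_funpow_cls[OF g(1) y(1,2)] g(2) by simp
  next
    case (add u v)
    then show ?case by (simp add: Tadd)
  next
    case (smult c v)
    then show ?case by (simp add: Tsmult)
  qed
qed

section \<open>A section of the degree and crossed homomorphisms\<close>

definition base_power :: "int \<Rightarrow> 'g" where "base_power i = gen 1 [^] i"

lemma base_power_closed: "base_power i \<in> carrier G"
  unfolding base_power_def using gen1(1) by simp

lemma base_power_add: "base_power (i + j) = base_power i \<otimes> base_power j"
  unfolding base_power_def using gen1(1) by (rule int_pow_mult)

lemma base_power_1: "base_power 1 = gen 1" and base_power_0: "base_power 0 = \<one>"
  unfolding base_power_def using gen1(1) by (simp_all add: int_pow_1)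

lemma base_power_uminus: "base_power (- i) = inv base_power i"
  unfolding base_power_def using gen1(1) by (simp add: int_pow_neg)

lemma deg_base_power: "deg (base_power i) = i"
  unfolding base_power_def using gen1 deg.hom_int_pow[of "gen 1" i] by simp

text \<open>Retracts \<open>G\<close> onto \<open>N\<close> along the powers of
  \<open>gen 1\<close>. It sends \<open>gen 1\<close> to the identity, which is the source of the
  normalization c_1 = 0.\<close>

definition normalize :: "'g \<Rightarrow> 'g" where
  "normalize g = g \<otimes> base_power (- deg g)"

lemma normalize_in_N: "g \<in> carrier G \<Longrightarrow> normalize g \<in> N"
  by (simp add: mem_N normalize_def base_power_closed deg_base_power)

lemma normalize_N: "g \<in> N \<Longrightarrow> normalize g = g"
  by (simp add: mem_N normalize_def base_power_0)

text \<open>The cocycle identity behind crossed homomorphisms: moving the power of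
  \<open>gen 1\<close> past \<open>h\<close> conjugates \<open>normalize h\<close>.\<close>

lemma normalize_mult:
  assumes "g \<in> carrier G" "h \<in> carrier G"
  shows "normalize (g \<otimes> h)
    = normalize g \<otimes> (inv base_power (- deg g) \<otimes> normalize h \<otimes> base_power (- deg g))"
proof -
  have "normalize g \<otimes> (inv base_power (- deg g) \<otimes> normalize h \<otimes> base_power (- deg g))
      = g \<otimes> h \<otimes> base_power (- deg h + - deg g)"
    using assms base_power_closed
    by (simp add: normalize_def m_assoc inv_cancel base_power_add[symmetric] add.commute)
  then show ?thesis using assms by (simp add: normalize_def m_assoc base_power_closed add.commute)
qed

text \<open>\<open>z\<close> acts as the power of \<open>aut\<close> given by its degree. For
  negative degree the identity for \<open>inv z\<close> is solved for the other value, which is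
  possible as \<open>\<mu>\<close> is nonzero.\<close>

lemma functional_conj:
  fixes \<psi> :: "'g set \<Rightarrow> complex"
  assumes \<psi>: "\<And>a. a \<in> carrier A \<Longrightarrow> \<psi> (aut a) = \<mu> * \<psi> a" and \<mu>: "\<mu> \<noteq> 0"
    and g: "g \<in> N" and z: "z \<in> carrier G"
  shows "\<psi> (cls (inv z \<otimes> g \<otimes> z)) = \<mu> powi deg z * \<psi> (cls g)"
proof -
  have aut_closed: "(aut ^^ q) a \<in> carrier A" if "a \<in> carrier A" for q a
    using that by (induction q) (use aut_hom in \<open>auto simp: hom_def\<close>)
  have pow: "\<psi> ((aut ^^ q) a) = \<mu> ^ q * \<psi> a" if "a \<in> carrier A" for q a
    using that by (induction q) (simp_all add: \<psi> aut_closed)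
  have nonneg: "\<psi> (cls (inv z \<otimes> g \<otimes> z)) = \<mu> ^ q * \<psi> (cls g)"
    if "g \<in> N" "z \<in> carrier G" "deg z = int q" for g z q
    using aut_funpow_cls[OF that] pow[OF cls_in_carrier[OF that(1)], of q] by simp
  show ?thesis
  proof (cases "deg z \<ge> 0")
    case True
    then show ?thesis using nonneg[OF g z, of "nat (deg z)"] by (simp add: power_int_def)
  next
    case False
    let ?g = "inv z \<otimes> g \<otimes> z" and ?q = "nat (- deg z)"
    have "inv (inv z) \<otimes> ?g \<otimes> inv z = g"
      using z N_closed[OF g] by (simp add: m_assoc inv_cancel)
    then have "\<psi> (cls g) = \<mu> ^ ?q * \<psi> (cls ?g)"
      using nonneg[OF conj_N[OF g z], of "inv z" ?q] z False by simp
    then show ?thesis using False \<mu> by (simp add: power_int_def power_inverse field_simps)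
  qed
qed

text \<open>A functional on the Alexander module that is an eigenvector of the transpose of \<open>aut\<close> extends
  along \<open>normalize\<close> to a crossed homomorphism of the whole group; conversely, crossed homomorphisms
  restrict to such functionals. This reduces eigenvalue multiplicities to solving for the values on
  the generators.\<close>

lemma crossed_hom_of_functional:
  fixes \<psi> :: "'g set \<Rightarrow> complex"
  assumes \<psi>: "\<And>a. a \<in> carrier A \<Longrightarrow> \<psi> (aut a) = \<mu> * \<psi> a" and \<mu>: "\<mu> \<noteq> 0"
    and add: "\<And>a b. a \<in> carrier A \<Longrightarrow> b \<in> carrier A \<Longrightarrow> \<psi> (a \<otimes>\<^bsub>A\<^esub> b) = \<psi> a + \<psi> b"
    and gh: "g \<in> carrier G" "h \<in> carrier G"
  shows "\<psi> (cls (normalize (g \<otimes> h)))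
    = \<psi> (cls (normalize g)) + \<mu> powi (- deg g) * \<psi> (cls (normalize h))"
proof -
  let ?z = "base_power (- deg g)"
  let ?h = "inv ?z \<otimes> normalize h \<otimes> ?z"
  have h: "?h \<in> N" by (rule conj_N[OF normalize_in_N[OF gh(2)] base_power_closed])
  have "cls (normalize (g \<otimes> h)) = cls (normalize g) \<otimes>\<^bsub>A\<^esub> cls ?h"
    unfolding normalize_mult[OF gh] using N_closed[OF h] N_closed[OF normalize_in_N[OF gh(1)]]
    by (rule cls_mult[rotated])
  then show ?thesis
    using add[OF cls_in_carrier cls_in_carrier, OF normalize_in_N[OF gh(1)] h]
      functional_conj[of \<psi> \<mu>, OF \<psi> \<mu> normalize_in_N[OF gh(2)] base_power_closed[of "- deg g"]]
    by (simp add: deg_base_power)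
qed

text \<open>On \<open>N\<close> the twist is trivial, so \<open>\<delta>\<close> is additive there,
  vanishes on commutators and factors through N/N'. In the value at a conjugate by
  \<open>gen 1\<close> the two contributions of \<open>gen 1\<close> cancel, and the factor left is
  \<open>inverse \<mu>\<close> because the inverse stands on the left.\<close>

lemma functional_of_crossed_hom:
  fixes \<delta> :: "'g \<Rightarrow> complex"
  assumes \<delta>: "\<And>g h. g \<in> carrier G \<Longrightarrow> h \<in> carrier G \<Longrightarrow> \<delta> (g \<otimes> h) = \<delta> g + \<mu> powi deg g * \<delta> h"
    and \<mu>: "\<mu> \<noteq> 0"
  shows "\<exists>f :: _ \<Rightarrow> complex.
    (\<forall>u\<in>carrier V. \<forall>v\<in>carrier V. f (u \<oplus>\<^bsub>V\<^esub> v) = f u + f v) \<and>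
    (\<forall>c. \<forall>v\<in>carrier V. f (c \<odot>\<^bsub>V\<^esub> v) = c * f v) \<and>
    (\<forall>g\<in>N. f (pure_tensor A (cls g)) = \<delta> g) \<and>
    (\<forall>v\<in>carrier V. f (T v) = inverse \<mu> * f v)"
proof -
  have \<delta>1: "\<delta> \<one> = 0" using \<delta>[of \<one> \<one>] by (simp add: deg_one)
  have \<delta>inv: "\<delta> (inv g) = - (\<mu> powi (- deg g) * \<delta> g)" if "g \<in> carrier G" for g
    using \<delta>[of "inv g" g] that \<delta>1 by (simp add: eq_neg_iff_add_eq_0)
  have \<delta>N: "\<delta> (g \<otimes> h) = \<delta> g + \<delta> h" if "g \<in> N" "h \<in> carrier G" for g h
    using \<delta>[of g h] that by (simp add: mem_N)
  have der: "d \<in> N \<and> \<delta> d = 0" if "d \<in> derived G N" for d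
    using that unfolding derived_def
  proof induction
    case one
    then show ?case using \<delta>1 N.one_closed by simp
  next
    case (incl d)
    then obtain a b where d: "a \<in> N" "b \<in> N" "d = a \<otimes> b \<otimes> inv a \<otimes> inv b" by blast
    have "\<delta> d = 0"
      using d(1,2) unfolding d(3) by (simp add: \<delta>N \<delta>inv N_closed mem_N)
    then show ?case using d by simp
  next
    case (inv d)
    then obtain a b where d: "a \<in> N" "b \<in> N" "d = a \<otimes> b \<otimes> inv a \<otimes> inv b" by blast
    have "\<delta> d = 0"
      using d(1,2) unfolding d(3) by (simp add: \<delta>N \<delta>inv N_closed mem_N)
    moreover have "d \<in> N" using d by simp
    ultimately show ?case using \<delta>inv[of d] N_closed[of d] by simp
  next
    case (eng d e)
    then show ?case using \<delta>N[of d e] N_closed by simp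
  qed
  have "\<delta> g = \<delta> h" if "g \<in> N" "h \<in> N" "cls g = cls h" for g h
  proof -
    have "g \<in> derived G N #> h"
      using that rcos_self[OF N_closed[OF that(1)] N'.subgroup_axioms] by (simp add: cls_def)
    then obtain d where "d \<in> derived G N" "g = d \<otimes> h" by (auto simp: r_coset_def)
    then show ?thesis using der[of d] \<delta>N[of d h] that N_closed by simp
  qed
  then obtain \<psi> where \<psi>: "\<And>g. g \<in> N \<Longrightarrow> \<psi> (cls g) = \<delta> g"
    using function_factors_left_gen[of "\<lambda>g. g \<in> N" cls \<delta>] by metis
  have \<psi>add: "\<psi> (a \<otimes>\<^bsub>A\<^esub> b) = \<psi> a + \<psi> b" if "a \<in> carrier A" "b \<in> carrier A" for a b
  proof -
    obtain g h where "g \<in> N" "a = cls g" "h \<in> N" "b = cls h"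
      using \<open>a \<in> carrier A\<close> \<open>b \<in> carrier A\<close> by (auto simp: carrier_alexander_module)
    then show ?thesis
      using \<delta>N[of g h] N_closed \<psi>[of "g \<otimes> h"] \<psi> by (simp add: cls_mult[symmetric])
  qed
  obtain f where f: "\<And>u v. u \<in> carrier V \<Longrightarrow> v \<in> carrier V \<Longrightarrow> f (u \<oplus>\<^bsub>V\<^esub> v) = f u + f v"
    "\<And>c v. v \<in> carrier V \<Longrightarrow> f (c \<odot>\<^bsub>V\<^esub> v) = c * f v"
    "\<And>a. a \<in> carrier A \<Longrightarrow> f (pure_tensor A a) = \<psi> a"
    using complexification_functional[OF monoid_alexander_module \<psi>add] by blast
  have \<psi>aut: "\<psi> (aut a) = inverse \<mu> * \<psi> a" if "a \<in> carrier A" for a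
  proof -
    obtain g where g: "g \<in> N" "a = cls g"
      using \<open>a \<in> carrier A\<close> by (auto simp: carrier_alexander_module)
    have gc: "g \<in> carrier G" "deg g = 0" using g by (auto simp: mem_N)
    have "\<delta> (inv gen 1 \<otimes> g \<otimes> gen 1) = inverse \<mu> * \<delta> g"
      using gc gen1 by (simp add: \<delta> \<delta>inv power_int_minus algebra_simps)
    then show ?thesis
      using \<psi>[OF g(1)] \<psi>[OF conj_N[OF g(1) gen1(1)]] aut_cls[OF g(1) gen1] g(2) by simp
  qed
  have fT: "f (T v) = inverse \<mu> * f v" if "v \<in> carrier V" for v
    using that
  proof (induction v rule: V_induct)
    case (pure a)
    moreover have "aut a \<in> carrier A" using pure aut_hom by (auto simp: hom_def)
    ultimately show ?case by (simp add: T_pure f \<psi>aut)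
  next
    case (add u v)
    then show ?case by (simp add: T_add f T_closed distrib_left)
  next
    case (smult c v)
    then show ?case by (simp add: T_smult f T_closed)
  qed
  have fp: "f (pure_tensor A (cls g)) = \<delta> g" if "g \<in> N" for g
    using f(3)[OF cls_in_carrier[OF that]] \<psi>[OF that] by simp
  show ?thesis by (intro exI[of _ f]) (simp add: f(1,2) fp fT)
qed

end

section \<open>The inequality\<close>

text \<open>The pair (a, b) stands for the map z -> a z + b, with composition as product. A
  homomorphism into this group with linear part \<open>\<mu> powi deg g\<close> has a crossed
  homomorphism as its translation part.\<close>

definition affine_group :: "(complex \<times> complex) monoid" where
  "affine_group = \<lparr>carrier = {p. fst p \<noteq> 0},
     monoid.mult = (\<lambda>p q. (fst p * fst q, snd p + fst p * snd q)), one = (1, 0)\<rparr>"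

lemma affine_group_simps [simp]:
  "p \<in> carrier affine_group \<longleftrightarrow> fst p \<noteq> 0"
  "p \<otimes>\<^bsub>affine_group\<^esub> q = (fst p * fst q, snd p + fst p * snd q)"
  "\<one>\<^bsub>affine_group\<^esub> = (1, 0)"
  by (simp_all add: affine_group_def)

lemma group_affine_group: "group affine_group"
proof (rule groupI)
  fix p :: "complex \<times> complex" assume p: "p \<in> carrier affine_group"
  show "\<exists>q\<in>carrier affine_group. q \<otimes>\<^bsub>affine_group\<^esub> p = \<one>\<^bsub>affine_group\<^esub>"
    using p by (intro bexI[of _ "(inverse (fst p), - inverse (fst p) * snd p)"]) auto
qed (auto simp: algebra_simps)

lemma inv_affine_group:
  assumes "fst p \<noteq> 0"
  shows "inv\<^bsub>affine_group\<^esub> p = (inverse (fst p), - inverse (fst p) * snd p)"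
  by (rule group.inv_equality[OF group_affine_group]) (use assms in auto)

lemma (in group) word_eval_foldr_free_gen:
  assumes c: "c \<in> X \<rightarrow> carrier G" and xs: "set xs \<subseteq> X"
  shows "word_eval G c (foldr (\<otimes>\<^bsub>free_group X\<^esub>) (map free_gen xs) \<one>\<^bsub>free_group X\<^esub>)
    = foldr (\<otimes>) (map c xs) \<one>"
proof -
  interpret F: group "free_group X" by (rule group_free_group)
  have "foldr (\<otimes>\<^bsub>free_group X\<^esub>) (map free_gen xs) \<one>\<^bsub>free_group X\<^esub> \<in> carrier (free_group X) \<and> ?thesis"
    using xs
  proof (induction xs)
    case Nil
    then show ?case by (simp add: one_free_group carrier_free_group reduced_def)
  next
    case (Cons x xs)
    then show ?case
      using free_gen_closed[of x X] hom_mult[OF word_eval_hom[OF c]] word_eval_free_gen[OF c, of x]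
      by simp
  qed
  then show ?thesis ..
qed

context C_group
begin

text \<open>\<open>rel\<close> is the relation cleared of inverses: in W x_i = x_j W the linear
  parts agree automatically, and the translation parts give the stated equation.\<close>

lemma crossed_hom_exists:
  fixes c :: "nat \<Rightarrow> complex"
  assumes \<mu>: "\<mu> \<noteq> 0"
    and rel: "\<And>i j k W. i \<in> {1..m} \<Longrightarrow> j \<in> {1..m} \<Longrightarrow> k \<in> {1..l i j} \<Longrightarrow>
      W = word_eval affine_group (\<lambda>i. (\<mu>, c i)) (w i j k) \<Longrightarrow>
      fst W * c i = c j - (1 - \<mu>) * snd W"
  shows "\<exists>\<delta>. (\<forall>g\<in>carrier G. \<forall>h\<in>carrier G. \<delta> (g \<otimes> h) = \<delta> g + \<mu> powi deg g * \<delta> h) \<and>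
    (\<forall>i\<in>{1..m}. \<delta> (gen i) = c i)"
proof -
  interpret Aff: group affine_group by (rule group_affine_group)
  let ?c = "\<lambda>i. (\<mu>, c i)"
  have c: "?c \<in> {1..m} \<rightarrow> carrier affine_group" using \<mu> by simp
  have "\<exists>\<rho>\<in>hom G affine_group. \<forall>i\<in>{1..m}. \<rho> (gen i) = ?c i"
  proof (rule lift_exists[OF group_affine_group c])
    fix i j k assume ijk: "i \<in> {1..m}" "j \<in> {1..m}" "k \<in> {1..l i j}"
    let ?W = "word_eval affine_group ?c (w i j k)"
    have W: "fst ?W \<noteq> 0"
      using Aff.word_eval_closed[OF c] word_closed(1)[OF ijk] by (simp add: carrier_free_group)
    have "c i = inverse (fst ?W) * (c j - (1 - \<mu>) * snd ?W)"
      using rel[OF ijk refl] W by (simp add: field_simps)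
    then show "?c i = inv\<^bsub>affine_group\<^esub> ?W \<otimes>\<^bsub>affine_group\<^esub> ?c j \<otimes>\<^bsub>affine_group\<^esub> ?W"
      using W by (simp add: inv_affine_group algebra_simps)
  qed
  then obtain \<rho> where \<rho>: "\<rho> \<in> hom G affine_group" "\<And>i. i \<in> {1..m} \<Longrightarrow> \<rho> (gen i) = ?c i" by blast
  interpret \<rho>: group_hom G affine_group \<rho>
    by (intro group_hom.intro group_hom_axioms.intro group_axioms group_affine_group \<rho>(1))
  have fst_\<rho>: "fst (\<rho> g) = \<mu> powi deg g" if "g \<in> carrier G" for g
    using that
  proof (induction g rule: gen_induct)
    case one
    then show ?case using \<rho>.hom_one by (simp add: deg_one)
  next
    case (gen i g)
    then show ?case
      using gen_closed deg_gen \<rho>(2) \<mu> by (simp add: power_int_add)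
  next
    case (inv i g)
    then show ?case
      using gen_closed deg_gen \<rho>(2) \<mu>
      by (simp add: inv_affine_group power_int_diff divide_inverse power_int_add power_int_minus)
  qed
  show ?thesis
    by (intro exI[of _ "\<lambda>g. snd (\<rho> g)"]) (simp add: fst_\<rho> \<rho>(2))
qed

section \<open>Classes of generators under the relations\<close>

definition linked :: "(nat \<times> nat) set" where
  "linked = {(i, j). i \<in> {1..m} \<and> j \<in> {1..m} \<and> (l i j \<ge> 1 \<or> l j i \<ge> 1)}"

text \<open>Taking the least index makes 1 the representative of its own class, so the values of
  \<open>rep\<close> on \<open>{1..m}\<close> other than 1 number r - 1.\<close>

definition rep :: "nat \<Rightarrow> nat" where
  "rep i = (LEAST j. (i, j) \<in> linked\<^sup>*)"

lemma linked_rtrancl_sym: "(i, j) \<in> linked\<^sup>* \<Longrightarrow> (j, i) \<in> linked\<^sup>*"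
  by (rule symD[OF sym_rtrancl]) (auto simp: sym_def linked_def)

lemma rep_linked: "(i, rep i) \<in> linked\<^sup>*"
  unfolding rep_def by (rule LeastI) (rule rtrancl_refl)

lemma linked_rtrancl_range: "(i, j) \<in> linked\<^sup>* \<Longrightarrow> i \<in> {1..m} \<Longrightarrow> j \<in> {1..m}"
  by (induction rule: rtrancl_induct) (auto simp: linked_def)

lemma rep_range: "i \<in> {1..m} \<Longrightarrow> rep i \<in> {1..m}"
  using linked_rtrancl_range rep_linked by blast

lemma rep_eq:
  assumes "(i, j) \<in> linked\<^sup>*"
  shows "rep i = rep j"
proof -
  have "(i, x) \<in> linked\<^sup>* \<longleftrightarrow> (j, x) \<in> linked\<^sup>*" for x
    using assms linked_rtrancl_sym[OF assms] by (meson rtrancl_trans)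
  then show ?thesis by (simp add: rep_def)
qed

lemma rep_rep: "rep (rep i) = rep i"
  using rep_eq[OF rep_linked] by simp

lemma rep_1: "rep 1 = 1"
proof -
  have "rep 1 \<le> 1" unfolding rep_def by (rule Least_le) (rule rtrancl_refl)
  moreover have "rep 1 \<ge> 1" using rep_range[of 1] m_pos by simp
  ultimately show ?thesis by simp
qed

section \<open>Crossed homomorphisms with sign -1\<close>

definition lattice :: "('g \<Rightarrow> complex) \<Rightarrow> complex set" where
  "lattice \<delta> = {\<Sum>j\<in>{1..m}. of_int (M j) * \<delta> (gen j) | M :: nat \<Rightarrow> int. True}"

lemma lattice_gen:
  assumes "i \<in> {1..m}"
  shows "\<delta> (gen i) \<in> lattice \<delta>"
proof -
  have "(\<Sum>j\<in>{1..m}. of_int (if j = i then 1 else 0) * \<delta> (gen j))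
      = (\<Sum>j\<in>{1..m}. if j = i then \<delta> (gen i) else 0)"
    by (intro sum.cong) auto
  then show ?thesis
    unfolding lattice_def mem_Collect_eq using assms
    by (intro exI[of _ "\<lambda>j. if j = i then 1 else 0"]) simp
qed

lemma lattice_add: "x \<in> lattice \<delta> \<Longrightarrow> y \<in> lattice \<delta> \<Longrightarrow> x + y \<in> lattice \<delta>"
proof -
  assume "x \<in> lattice \<delta>" "y \<in> lattice \<delta>"
  then obtain M M' where "x = (\<Sum>j\<in>{1..m}. of_int (M j) * \<delta> (gen j))"
    "y = (\<Sum>j\<in>{1..m}. of_int (M' j) * \<delta> (gen j))" by (auto simp: lattice_def)
  then show ?thesis
    unfolding lattice_def mem_Collect_eq
    by (intro exI[of _ "\<lambda>j. M j + M' j"]) (simp add: sum.distrib distrib_right)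
qed

lemma lattice_uminus: "x \<in> lattice \<delta> \<Longrightarrow> - x \<in> lattice \<delta>"
proof -
  assume "x \<in> lattice \<delta>"
  then obtain M where "x = (\<Sum>j\<in>{1..m}. of_int (M j) * \<delta> (gen j))" by (auto simp: lattice_def)
  then show ?thesis
    unfolding lattice_def mem_Collect_eq
    by (intro exI[of _ "\<lambda>j. - M j"]) (simp add: sum_negf)
qed

lemma lattice_diff: "x \<in> lattice \<delta> \<Longrightarrow> y \<in> lattice \<delta> \<Longrightarrow> x - y \<in> lattice \<delta>"
  using lattice_add[OF _ lattice_uminus, of x \<delta> y] by simp

lemma lattice_zero: "0 \<in> lattice \<delta>"
  unfolding lattice_def mem_Collect_eq by (rule exI[of _ "\<lambda>_. 0"]) simp

text \<open>Linked generators have values that agree modulo twice the lattice spanned by all values, so the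
  values of a crossed homomorphism vanishing on representatives solve an integral linear system with
  odd diagonal and even off-diagonal coefficients.\<close>

lemma sign_crossed_hom_vanish:
  fixes \<delta> :: "'g \<Rightarrow> complex"
  assumes \<delta>: "\<And>g h. g \<in> carrier G \<Longrightarrow> h \<in> carrier G \<Longrightarrow>
      \<delta> (g \<otimes> h) = \<delta> g + (- 1) powi deg g * \<delta> h"
    and rep0: "\<And>i. i \<in> {1..m} \<Longrightarrow> \<delta> (gen (rep i)) = 0"
    and g: "g \<in> carrier G"
  shows "\<delta> g = 0"
proof -
  have sign: "(- 1 :: complex) powi i = 1 \<or> (- 1 :: complex) powi i = - 1" for i
    by (cases "even i") simp_all
  have \<delta>1: "\<delta> \<one> = 0" using \<delta>[of \<one> \<one>] by (simp add: deg_one)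
  have \<delta>inv: "\<delta> (inv h) = - ((- 1) powi (- deg h) * \<delta> h)" if "h \<in> carrier G" for h
    using \<delta>[of "inv h" h] that \<delta>1 by (simp add: eq_neg_iff_add_eq_0)
  \<comment> \<open>All twists are signs, so every value of \<open>\<delta>\<close> is an integral
    combination of the values on generators.\<close>
  have lat: "\<delta> h \<in> lattice \<delta>" if "h \<in> carrier G" for h
    using that
  proof (induction h rule: gen_induct)
    case one
    then show ?case by (simp add: \<delta>1 lattice_zero)
  next
    case (gen i h)
    then show ?case using \<delta>[of "gen i" h] gen_closed lattice_gen[of i \<delta>]
      by (simp add: deg_gen lattice_diff)
  next
    case (inv i h)
    have "\<delta> (inv gen i \<otimes> h) = \<delta> (gen i) + - \<delta> h"
      using inv \<delta>[of "inv gen i" h] gen_closed by (simp add: \<delta>inv deg_gen)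
    then show ?case using inv lattice_gen[of i \<delta>]
      by (metis lattice_add lattice_uminus)
  qed
  \<comment> \<open>With c for the values on generators, W x_i = x_j W gives \<delta>(W) + c_i = c_j
    - \<delta>(W) or \<delta>(W) - c_i = c_j - \<delta>(W), by the parity of deg W. Either way c_i -
    c_j is twice an element of the lattice.\<close>
  have rel_step: "\<exists>x\<in>lattice \<delta>. \<delta> (gen i) - \<delta> (gen j) = 2 * x"
    if ijk: "i \<in> {1..m}" "j \<in> {1..m}" "l i j \<ge> 1" for i j
  proof -
    let ?W = "word_eval G gen (w i j 1)"
    have k1: "1 \<in> {1..l i j}" using ijk by simp
    have W: "?W \<in> carrier G" by (rule word_closed(2)[OF ijk(1,2) k1])
    have "?W \<otimes> gen i = ?W \<otimes> (inv ?W \<otimes> gen j \<otimes> ?W)"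
      using relation[OF ijk(1,2) k1] by simp
    also have "\<dots> = gen j \<otimes> ?W" using W gen_closed[OF ijk(2)] by (simp add: m_assoc inv_cancel)
    finally have "\<delta> ?W + (- 1) powi deg ?W * \<delta> (gen i) = \<delta> (gen j) - \<delta> ?W"
      using \<delta>[OF W gen_closed[OF ijk(1)]] \<delta>[OF gen_closed[OF ijk(2)] W] deg_gen[OF ijk(2)] by simp
    then consider "\<delta> (gen i) - \<delta> (gen j) = 2 * (- \<delta> ?W)"
      | "\<delta> (gen i) - \<delta> (gen j) = 2 * (\<delta> ?W + - \<delta> (gen j))"
      using sign[of "deg ?W"] by (auto simp: algebra_simps)
    then show ?thesis
      using lat[OF W] lattice_gen[OF ijk(2), of \<delta>] by cases (metis lattice_add lattice_uminus)+
  qed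
  have linked: "\<exists>x\<in>lattice \<delta>. \<delta> (gen i) - \<delta> (gen j) = 2 * x" if "(i, j) \<in> linked\<^sup>*" for i j
    using that
  proof (induction rule: rtrancl_induct)
    case base
    show ?case using lattice_zero by force
  next
    case (step j k)
    then obtain x where x: "x \<in> lattice \<delta>" "\<delta> (gen i) - \<delta> (gen j) = 2 * x" by blast
    have "\<exists>y\<in>lattice \<delta>. \<delta> (gen j) - \<delta> (gen k) = 2 * y"
    proof (cases "l j k \<ge> 1")
      case True
      then show ?thesis using rel_step[of j k] step.hyps(2) by (auto simp: linked_def)
    next
      case False
      then obtain y where "y \<in> lattice \<delta>" "\<delta> (gen k) - \<delta> (gen j) = 2 * y"
        using rel_step[of k j] step.hyps(2) by (auto simp: linked_def)
      then show ?thesis by (intro bexI[of _ "- y"] lattice_uminus) (auto simp: algebra_simps)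
    qed
    then obtain y where y: "y \<in> lattice \<delta>" "\<delta> (gen j) - \<delta> (gen k) = 2 * y" by blast
    have "\<delta> (gen i) - \<delta> (gen k) = 2 * (x + y)" using x(2) y(2) by (simp add: algebra_simps)
    then show ?case using lattice_add[OF x(1) y(1)] by blast
  qed
  have "\<exists>M :: nat \<Rightarrow> int. \<delta> (gen i) = (\<Sum>j\<in>{1..m}. of_int (2 * M j) * \<delta> (gen j))"
    if "i \<in> {1..m}" for i
  proof -
    obtain x where x: "x \<in> lattice \<delta>" "\<delta> (gen i) - \<delta> (gen (rep i)) = 2 * x"
      using linked[OF rep_linked] by blast
    then obtain M :: "nat \<Rightarrow> int" where "x = (\<Sum>j\<in>{1..m}. of_int (M j) * \<delta> (gen j))"
      by (auto simp: lattice_def)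
    then show ?thesis using x(2) rep0[OF that]
      by (intro exI[of _ M]) (simp add: sum_distrib_left mult.assoc)
  qed
  then obtain M :: "nat \<Rightarrow> nat \<Rightarrow> int" where
    M: "\<And>i. i \<in> {1..m} \<Longrightarrow> \<delta> (gen i) = (\<Sum>j\<in>{1..m}. of_int (2 * M i j) * \<delta> (gen j))" by metis
  have gen0: "\<delta> (gen i) = 0" if "i \<in> {1..m}" for i
  \<comment> \<open>The equations c = 2Mc are rewritten with the coefficient matrix 1 - 2M.\<close>
  proof (rule odd_diagonal_system_trivial[of "{1..m}" "\<lambda>i j. (if i = j then 1 else 0) - 2 * M i j"])
    fix i assume i: "i \<in> {1..m}"
    have "(\<Sum>j\<in>{1..m}. of_int ((if i = j then 1 else 0) - 2 * M i j) * \<delta> (gen j))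
        = (\<Sum>j\<in>{1..m}. if j = i then \<delta> (gen j) else 0)
          - (\<Sum>j\<in>{1..m}. of_int (2 * M i j) * \<delta> (gen j))"
      unfolding sum_subtractf[symmetric] by (intro sum.cong) (auto simp: left_diff_distrib)
    then show "(\<Sum>j\<in>{1..m}. of_int ((if i = j then 1 else 0) - 2 * M i j) * \<delta> (gen j)) = 0"
      using M[OF i] i by simp
  qed (use that in auto)
  show ?thesis
    using g
  proof (induction g rule: gen_induct)
    case one
    then show ?case by (rule \<delta>1)
  next
    case (gen i h)
    then show ?case using \<delta> gen_closed gen0 by simp
  next
    case (inv i h)
    then show ?case using \<delta> gen_closed gen0 by (simp add: \<delta>inv)
  qed
qed

section \<open>Multiplicities of the eigenvalues -1 and 1\<close>

lemma normalize_gen_1: "normalize (gen 1) = \<one>"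
  using gen1 by (simp add: normalize_def base_power_uminus base_power_1)

text \<open>Each coordinate with eigenvalue -1 yields a crossed homomorphism. If there were more of
  them than classes other than that of 1, a nontrivial combination would vanish at all
  representatives, hence everywhere, against the independence of the coordinates.\<close>

lemma eigenvalue_minus_one_bound:
  assumes k: "coordinates V (length as) \<kappa>"
    and eigen: "\<And>i v. i < length as \<Longrightarrow> v \<in> carrier V \<Longrightarrow> \<kappa> i (T v) = as ! i * \<kappa> i v"
  shows "card {i. i < length as \<and> as ! i = - 1} \<le> card (rep ` {1..m} - {1})"
proof (rule ccontr)
  let ?I = "{i. i < length as \<and> as ! i = - 1}" and ?J = "rep ` {1..m} - {1}"
  define \<psi> where "\<psi> i a = \<kappa> i (pure_tensor A a)" for i a
  note pure_closed = pure_tensor_closed[OF monoid_alexander_module]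
  assume "\<not> card ?I \<le> card ?J"
  then obtain x where x: "\<exists>i\<in>?I. x i \<noteq> 0"
    "\<And>j. j \<in> ?J \<Longrightarrow> (\<Sum>i\<in>?I. \<psi> i (cls (normalize (gen j))) * x i) = 0"
    using exists_nonzero_homogeneous_solution[of ?J ?I "\<lambda>j i. \<psi> i (cls (normalize (gen j)))"] by auto
  define \<delta> where "\<delta> g = (\<Sum>i\<in>?I. \<psi> i (cls (normalize g)) * x i)" for g
  have crossed: "\<psi> i (cls (normalize (g \<otimes> h)))
      = \<psi> i (cls (normalize g)) + (- 1) powi deg g * \<psi> i (cls (normalize h))"
    if i: "i \<in> ?I" and "g \<in> carrier G" "h \<in> carrier G" for i g h
  proof -
    have "\<psi> i (cls (normalize (g \<otimes> h)))
        = \<psi> i (cls (normalize g)) + (- 1) powi (- deg g) * \<psi> i (cls (normalize h))"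
    proof (rule crossed_hom_of_functional[OF _ _ _ that(2,3)])
      show "\<psi> i (aut a) = - 1 * \<psi> i a" if "a \<in> carrier A" for a
        using eigen[of i "pure_tensor A a"] i that pure_closed by (simp add: \<psi>_def T_pure)
      show "\<psi> i (a \<otimes>\<^bsub>A\<^esub> b) = \<psi> i a + \<psi> i b" if "a \<in> carrier A" "b \<in> carrier A" for a b
        using i that pure_closed
        by (simp add: \<psi>_def pure_tensor_mult[OF monoid_alexander_module] coordinatesD(1)[OF k])
    qed simp
    \<comment> \<open>As -1 is its own inverse, the exponent \<open>- deg g\<close> of the
      eigenfunctional may be replaced by \<open>deg g\<close>.\<close>
    moreover have "(- 1 :: complex) powi (- deg g) = (- 1) powi deg g"
      by (cases "even (deg g)") simp_all
    ultimately show ?thesis by simp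
  qed
  have \<delta>: "\<delta> (g \<otimes> h) = \<delta> g + (- 1) powi deg g * \<delta> h" if "g \<in> carrier G" "h \<in> carrier G" for g h
    using that by (simp add: \<delta>_def crossed distrib_right sum.distrib sum_distrib_left mult.assoc)
  have \<delta>1: "\<delta> \<one> = 0" using \<delta>[of \<one> \<one>] by (simp add: deg_one)
  \<comment> \<open>\<open>gen 1\<close> normalizes to the identity, so the class of 1 imposes no
    equation; hence the count r - 1.\<close>
  have "normalize \<one> = \<one>" by (simp add: normalize_def deg_one base_power_0)
  then have "\<delta> (gen 1) = 0" using \<delta>1 by (simp add: \<delta>_def normalize_gen_1)
  then have "\<delta> (gen (rep i)) = 0" if "i \<in> {1..m}" for i
    using x(2)[of "rep i"] that by (cases "rep i = 1") (auto simp: \<delta>_def)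
  then have \<delta>0: "\<delta> g = 0" if "g \<in> carrier G" for g using sign_crossed_hom_vanish[OF \<delta>] that by blast
  have zero_cls: "(\<Sum>i\<in>?I. \<kappa> i (pure_tensor A (cls g)) * x i) = 0" if "g \<in> N" for g
    using \<delta>0[OF N_closed[OF that]] by (simp add: \<delta>_def \<psi>_def normalize_N[OF that])
  have zero: "(\<Sum>i\<in>?I. \<kappa> i v * x i) = 0" if "v \<in> carrier V" for v
    using that
  proof (induction v rule: V_induct)
    case (pure a)
    then show ?case using zero_cls by (auto simp: carrier_alexander_module)
  next
    case (add u v)
    then show ?case by (simp add: coordinatesD(1)[OF k] distrib_right sum.distrib)
  next
    case (smult c v)
    then show ?case by (simp add: coordinatesD(2)[OF k] mult.assoc sum_distrib_left[symmetric])
  qed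
  obtain i where i: "i \<in> ?I" "x i \<noteq> 0" using x(1) by blast
  obtain v where v: "v \<in> carrier V" "\<And>j. j < length as \<Longrightarrow> \<kappa> j v = (if j = i then 1 else 0)"
    using coordinatesD(4)[OF k, of "\<lambda>j. if j = i then 1 else 0"] by blast
  have "(\<Sum>j\<in>?I. \<kappa> j v * x j) = (\<Sum>j\<in>?I. if j = i then x i else 0)"
    using v by (intro sum.cong) auto
  then show False using zero[OF v(1)] i by simp
qed

lemma fst_word_eval_affine_one: "fst (word_eval affine_group (\<lambda>i. (1, c i)) u) = 1"
  by (induction u) (auto simp: letter_eval_def inv_affine_group)

text \<open>Indicator functions of the classes other than that of 1 respect the relations and extend
  to homomorphisms into the complex numbers, hence to functionals invariant under \<open>T\<close>.
  These involve only coordinates with eigenvalue 1, and their values at x_j x_1^{-1} show that they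
  are independent.\<close>

lemma eigenvalue_one_bound:
  assumes k: "coordinates V (length as) \<kappa>"
    and eigen: "\<And>i v. i < length as \<Longrightarrow> v \<in> carrier V \<Longrightarrow> \<kappa> i (T v) = as ! i * \<kappa> i v"
  shows "card (rep ` {1..m} - {1}) \<le> card {i. i < length as \<and> as ! i = 1}"
proof (rule ccontr)
  let ?I = "{i. i < length as \<and> as ! i = 1}" and ?J = "rep ` {1..m} - {1}"
  \<comment> \<open>\<open>t i * as ! i = t i\<close> says that \<open>t\<close> is supported on the
    coordinates with eigenvalue 1.\<close>
  define Q where "Q j t \<delta> \<longleftrightarrow> (\<forall>i<length as. t i * as ! i = t i) \<and>
      (\<forall>g\<in>N. (\<Sum>i<length as. t i * \<kappa> i (pure_tensor A (cls g))) = \<delta> g) \<and>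
      (\<forall>i\<in>{1..m}. \<delta> (gen i \<otimes> inv gen 1) = (if rep i = j then 1 else 0))"
    for j and t :: "nat \<Rightarrow> complex" and \<delta> :: "'g \<Rightarrow> complex"
  have "\<exists>t \<delta>. Q j t \<delta>" if j: "j \<in> ?J" for j
  proof -
    define c :: "nat \<Rightarrow> complex" where "c i = (if rep i = j then 1 else 0)" for i
    have ceq: "c i = c j'" if "i \<in> {1..m}" "j' \<in> {1..m}" "k \<in> {1..l i j'}" for i j' k
    proof -
      have "(i, j') \<in> linked" using that by (auto simp: linked_def)
      then show ?thesis using rep_eq[OF r_into_rtrancl, of i j'] by (simp add: c_def)
    qed
    have "\<exists>\<delta>. (\<forall>g\<in>carrier G. \<forall>h\<in>carrier G. \<delta> (g \<otimes> h) = \<delta> g + 1 powi deg g * \<delta> h) \<and>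
        (\<forall>i\<in>{1..m}. \<delta> (gen i) = c i)"
      by (rule crossed_hom_exists) (use ceq in \<open>simp_all add: fst_word_eval_affine_one\<close>)
    then obtain \<delta> where \<delta>: "\<And>g h. g \<in> carrier G \<Longrightarrow> h \<in> carrier G \<Longrightarrow>
        \<delta> (g \<otimes> h) = \<delta> g + 1 powi deg g * \<delta> h"
      "\<And>i. i \<in> {1..m} \<Longrightarrow> \<delta> (gen i) = c i" by blast
    obtain f where f:
      "\<And>u v. u \<in> carrier V \<Longrightarrow> v \<in> carrier V \<Longrightarrow> f (u \<oplus>\<^bsub>V\<^esub> v) = f u + (f v :: complex)"
      "\<And>c v. v \<in> carrier V \<Longrightarrow> f (c \<odot>\<^bsub>V\<^esub> v) = c * f v"
      "\<And>g. g \<in> N \<Longrightarrow> f (pure_tensor A (cls g)) = \<delta> g"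
      "\<And>v. v \<in> carrier V \<Longrightarrow> f (T v) = inverse 1 * f v"
      using functional_of_crossed_hom[OF \<delta>(1) one_neq_zero] by blast
    obtain t where t: "\<And>v. v \<in> carrier V \<Longrightarrow> f v = (\<Sum>i<length as. t i * \<kappa> i v)"
      using coordinates_functional[OF vectorspace_V k f(1,2)] by blast
    have "t i * as ! i = t i" if i: "i < length as" for i
    proof -
      obtain v where v: "v \<in> carrier V" "\<And>j. j < length as \<Longrightarrow> \<kappa> j v = (if j = i then 1 else 0)"
        using coordinatesD(4)[OF k, of "\<lambda>j. if j = i then 1 else 0"] by blast
      have "f (T v) = (\<Sum>j<length as. if j = i then t i * as ! i else 0)"
        unfolding t[OF T_closed[OF v(1)]] using v by (intro sum.cong) (auto simp: eigen)
      moreover have "f v = (\<Sum>j<length as. if j = i then t i else 0)"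
        unfolding t[OF v(1)] using v by (intro sum.cong) auto
      ultimately show ?thesis using f(4)[OF v(1)] i by simp
    qed
    moreover have "(\<Sum>i<length as. t i * \<kappa> i (pure_tensor A (cls g))) = \<delta> g" if "g \<in> N" for g
      using t[OF pure_tensor_closed[OF monoid_alexander_module cls_in_carrier[OF that]]] f(3)[OF that]
      by simp
    moreover have "\<delta> (gen i \<otimes> inv gen 1) = (if rep i = j then 1 else 0)" if i: "i \<in> {1..m}" for i
    proof -
      have "\<delta> (gen 1) = 0" using \<delta>(2)[of 1] m_pos j by (auto simp: c_def rep_1)
      moreover have "\<delta> \<one> = 0" using \<delta>(1)[of \<one> \<one>] by (simp add: deg_one)
      ultimately have "\<delta> (inv gen 1) = 0" using \<delta>(1)[of "gen 1" "inv gen 1"] gen1 by simp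
      then show ?thesis using \<delta>(1)[of "gen i" "inv gen 1"] \<delta>(2)[OF i] gen_closed[OF i] gen1
        by (simp add: c_def)
    qed
    ultimately show ?thesis unfolding Q_def by blast
  qed
  then obtain t \<delta> where Q: "\<And>j. j \<in> ?J \<Longrightarrow> Q j (t j) (\<delta> j)" by metis
  have t: "\<And>j i. j \<in> ?J \<Longrightarrow> i < length as \<Longrightarrow> t j i * as ! i = t j i"
    "\<And>j g. j \<in> ?J \<Longrightarrow> g \<in> N \<Longrightarrow> (\<Sum>i<length as. t j i * \<kappa> i (pure_tensor A (cls g))) = \<delta> j g"
    "\<And>j i. j \<in> ?J \<Longrightarrow> i \<in> {1..m} \<Longrightarrow> \<delta> j (gen i \<otimes> inv gen 1) = (if rep i = j then 1 else 0)"
    using Q unfolding Q_def by blast+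
  assume "\<not> card ?J \<le> card ?I"
  then obtain x where x: "\<exists>j\<in>?J. x j \<noteq> 0" "\<And>i. i \<in> ?I \<Longrightarrow> (\<Sum>j\<in>?J. t j i * x j) = 0"
    using exists_nonzero_homogeneous_solution[of ?I ?J "\<lambda>i j. t j i"] by auto
  have tx: "(\<Sum>j\<in>?J. t j i * x j) = 0" if "i < length as" for i
  proof (cases "as ! i = 1")
    case False
    then have "t j i = 0" if "j \<in> ?J" for j using t(1)[OF that \<open>i < length as\<close>] by auto
    then show ?thesis by simp
  qed (use x(2) that in simp)
  have zero: "(\<Sum>j\<in>?J. \<delta> j g * x j) = 0" if "g \<in> N" for g
  proof -
    have "(\<Sum>j\<in>?J. \<delta> j g * x j)
        = (\<Sum>j\<in>?J. \<Sum>i<length as. t j i * x j * \<kappa> i (pure_tensor A (cls g)))"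
      using t(2)[OF _ that, symmetric] by (simp add: sum_distrib_left mult_ac)
    also have "\<dots> = (\<Sum>i<length as. (\<Sum>j\<in>?J. t j i * x j) * \<kappa> i (pure_tensor A (cls g)))"
      by (subst sum.swap) (simp add: sum_distrib_right)
    finally show ?thesis using tx by simp
  qed
  obtain j where j: "j \<in> ?J" "x j \<noteq> 0" using x(1) by blast
  then have jm: "j \<in> {1..m}" "rep j = j" using rep_range rep_rep by auto
  have "gen j \<otimes> inv gen 1 \<in> N" using gen_closed[OF jm(1)] gen1 deg_gen[OF jm(1)] by (simp add: mem_N)
  then have "(\<Sum>i\<in>?J. \<delta> i (gen j \<otimes> inv gen 1) * x i) = 0" by (rule zero)
  moreover have "(\<Sum>i\<in>?J. \<delta> i (gen j \<otimes> inv gen 1) * x i) = (\<Sum>i\<in>?J. if i = j then x j else 0)"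
    using t(3) jm by (intro sum.cong) auto
  ultimately show False using j by simp
qed

section \<open>Central elements and the Hurwitz relations\<close>

lemma central_of_commutes_gen:
  assumes y: "y \<in> carrier G" and comm: "\<And>i. i \<in> {1..m} \<Longrightarrow> y \<otimes> gen i = gen i \<otimes> y"
    and "g \<in> carrier G"
  shows "y \<otimes> g = g \<otimes> y"
  using assms(3)
proof (induction g rule: gen_induct)
  case one
  then show ?case using y by simp
next
  case (gen i g)
  then show ?case using comm[of i] y gen_closed[of i] by (metis m_assoc)
next
  case (inv i g)
  have "inv gen i \<otimes> y = inv gen i \<otimes> (y \<otimes> gen i) \<otimes> inv gen i"
    using y gen_closed[OF inv(1)] by (simp add: m_assoc)
  also have "\<dots> = y \<otimes> inv gen i"
    using y gen_closed[OF inv(1)] comm[OF inv(1)] by (simp add: m_assoc inv_cancel)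
  finally have "inv gen i \<otimes> y = y \<otimes> inv gen i" .
  then show ?case using inv y gen_closed[OF inv(1)] by (metis m_assoc inv_closed)
qed

text \<open>Conjugating a generator to itself means commuting with it. The Hurwitz relations and the
  self-relations of the example are used in this form.\<close>

lemma self_relation_commutes:
  assumes "i \<in> {1..m}" "k \<in> {1..l i i}"
  shows "word_eval G gen (w i i k) \<otimes> gen i = gen i \<otimes> word_eval G gen (w i i k)"
proof -
  let ?W = "word_eval G gen (w i i k)"
  have W: "?W \<in> carrier G" by (rule word_closed(2)[OF assms(1,1,2)])
  have "?W \<otimes> gen i = ?W \<otimes> (inv ?W \<otimes> gen i \<otimes> ?W)"
    using relation[OF assms(1,1,2)] by simp
  also have "\<dots> = gen i \<otimes> ?W" using W gen_closed[OF assms(1)] by (simp add: m_assoc inv_cancel)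
  finally show ?thesis .
qed

lemma hurwitz_T_power:
  assumes hur: "hurwitz_C_presentation m l w" and v: "v \<in> carrier V"
  shows "(T ^^ m) v = v"
proof -
  let ?y = "foldr (\<otimes>) (map gen [1..<Suc m]) \<one>"
  have y: "?y \<in> carrier G" "deg ?y = int m"
  proof -
    have "foldr (\<otimes>) (map gen xs) \<one> \<in> carrier G \<and> deg (foldr (\<otimes>) (map gen xs) \<one>) = int (length xs)"
      if "set xs \<subseteq> {1..m}" for xs
      using that by (induction xs) (auto simp: deg_one gen_closed deg_gen)
    moreover have "set [1..<Suc m] \<subseteq> {1..m}" "length [1..<Suc m] = m" by auto
    ultimately show "?y \<in> carrier G" "deg ?y = int m" by metis+
  qed
  have comm: "?y \<otimes> gen i = gen i \<otimes> ?y" if i: "i \<in> {1..m}" for i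
  proof -
    have "1 \<in> {1..l i i}" "w i i 1 = foldr (\<otimes>\<^bsub>FG\<^esub>) (map free_gen [1..<Suc m]) \<one>\<^bsub>FG\<^esub>"
      using hur i by (simp_all add: hurwitz_C_presentation_def)
    moreover have "word_eval G gen (foldr (\<otimes>\<^bsub>FG\<^esub>) (map free_gen [1..<Suc m]) \<one>\<^bsub>FG\<^esub>) = ?y"
      by (rule word_eval_foldr_free_gen[OF gen_fun]) auto
    ultimately show ?thesis using self_relation_commutes[OF i, of 1] by simp
  qed
  show ?thesis
    by (rule T_funpow_eq_id[OF y central_of_commutes_gen[OF y(1) comm] v])
qed

text \<open>A nonzero polynomial excludes the infinite-dimensional case. Comparing root
  multiplicities identifies \<open>n\<close> and \<open>k\<close> with the numbers of coordinates of
  eigenvalue 1 and -1, which lie on opposite sides of r - 1.\<close>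

lemma hurwitz_alexander_polynomial_bound:
  assumes hur: "hurwitz_C_presentation m l w"
    and P: "alexander_polynomial G S = Polynomial.smult c ([:- 1, 1:] ^ n * [:1, 1:] ^ k)" and c: "c \<noteq> 0"
  shows "k \<le> n"
proof -
  let ?P = "Polynomial.smult c ([:- 1, 1:] ^ n * [:1, 1:] ^ k)"
  have P0: "?P \<noteq> 0" using c by simp
  have fd: "vectorspace.fin_dim class_ring V" and det: "det_minus_t V T = ?P"
    using P P0 by (auto simp: alexander_polynomial_def Let_def split: if_splits)
  have mp: "m > 0" using m_pos by simp
  show ?thesis
  proof (rule finite_order_coordinates[OF vectorspace_V fd T_closed T_add T_smult hurwitz_T_power[OF hur] mp])
    fix as \<kappa>
    assume k: "coordinates V (length as) \<kappa>"
      and eigen: "\<And>i v. i < length as \<Longrightarrow> v \<in> carrier V \<Longrightarrow> \<kappa> i (T v) = as ! i * \<kappa> i v"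
      and D: "det_minus_t V T = (- 1) ^ length as * (\<Prod>a\<leftarrow>as. [:- a, 1:])"
    have "(- 1 :: complex poly) ^ length as = [:(- 1) ^ length as:]"
      by (induction as) (simp_all add: one_pCons)
    then have "Polynomial.smult ((- 1) ^ length as) (\<Prod>a\<leftarrow>as. [:- a, 1:]) = ?P" using D det by simp
    then have "order a (\<Prod>a\<leftarrow>as. [:- a, 1:]) = order a ([:- 1, 1:] ^ n * [:1, 1:] ^ k)" for a
      using order_smult[of "(- 1) ^ length as" a "\<Prod>a\<leftarrow>as. [:- a, 1:]"] order_smult[OF c, of a] by simp
    then have cnt: "count_list as a = order a ([:- 1, 1:] ^ n) + order a ([:1, 1:] ^ k)" for a
      unfolding order_prod_list_linear by (subst order_mult[symmetric]) simp_all
    have "count_list as (- 1) = k" using cnt[of "- 1"] by (simp add: order_linear_power)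
    moreover have "count_list as 1 = n" using cnt[of 1] by (simp add: order_linear_power)
    ultimately show ?thesis
      using eigenvalue_minus_one_bound[OF k eigen] eigenvalue_one_bound[OF k eigen]
      by (simp add: card_index_eq_count_list)
  qed
qed

end

section \<open>Existence\<close>

context C_group
begin

interpretation V: vectorspace class_ring V by (rule vectorspace_V)

text \<open>A crossed homomorphism with values in \<open>V\<close> that restricts to the pure
  tensors on \<open>N\<close>; \<open>tau_mult\<close> gives its twist when \<open>T\<close> is an
  involution.\<close>

definition tau :: "'g \<Rightarrow> ('g set \<times> complex \<Rightarrow>\<^sub>0 int) set" where
  "tau g = pure_tensor A (cls (normalize g))"

lemma tau_closed: "g \<in> carrier G \<Longrightarrow> tau g \<in> carrier V"
  unfolding tau_def by (intro pure_tensor_closed monoid_alexander_module cls_in_carrier normalize_in_N)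

text \<open>The twist is \<open>T\<close> to the power \<open>- deg g\<close>; as \<open>T\<close>
  is an involution, both degrees give \<open>T\<close> itself.\<close>

lemma tau_mult:
  assumes TT: "\<And>v. v \<in> carrier V \<Longrightarrow> T (T v) = v"
    and gh: "g \<in> carrier G" "h \<in> carrier G" and dg: "deg g = 1 \<or> deg g = - 1"
  shows "tau (g \<otimes> h) = tau g \<oplus>\<^bsub>V\<^esub> T (tau h)"
proof -
  let ?z = "base_power (- deg g)"
  let ?h = "inv ?z \<otimes> normalize h \<otimes> ?z"
  note z = base_power_closed[of "- deg g"] and N = normalize_in_N[OF gh(1)] normalize_in_N[OF gh(2)]
  note pc = pure_tensor_closed[OF monoid_alexander_module cls_in_carrier]
  have h: "?h \<in> N" by (rule conj_N[OF N(2) z])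
  have "tau (g \<otimes> h) = tau g \<oplus>\<^bsub>V\<^esub> pure_tensor A (cls ?h)"
    unfolding tau_def normalize_mult[OF gh] cls_mult[OF N_closed[OF N(1)] N_closed[OF h]]
    by (rule pure_tensor_mult[OF monoid_alexander_module cls_in_carrier[OF N(1)] cls_in_carrier[OF h]])
  moreover have "pure_tensor A (cls ?h) = T (tau h)"
    using dg
  proof
    assume "deg g = - 1"
    then have "deg ?z = 1" by (simp add: deg_base_power)
    then show ?thesis
      unfolding tau_def T_pure[OF cls_in_carrier[OF N(2)]] using aut_cls[OF N(2) z] by simp
  next
    assume "deg g = 1"
    then have "deg (inv ?z) = 1" using z by (simp add: deg_base_power)
    then have "aut (cls ?h) = cls (inv (inv ?z) \<otimes> ?h \<otimes> inv ?z)"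
      using aut_cls[OF h, of "inv ?z"] z by simp
    also have "inv (inv ?z) \<otimes> ?h \<otimes> inv ?z = normalize h"
      using z N_closed[OF N(2)] by (simp add: m_assoc inv_cancel)
    finally have "T (pure_tensor A (cls ?h)) = tau h"
      unfolding tau_def T_pure[OF cls_in_carrier[OF h]] by simp
    then show ?thesis using TT[OF pc[OF h]] by simp
  qed
  ultimately show ?thesis by simp
qed

text \<open>For an involution \<open>T\<close> and \<open>v = T u\<close> the summands are the
  components of \<open>u\<close> in the eigenspaces for 1 and -1.\<close>

lemma half_sum_half_difference:
  assumes "u \<in> carrier V" "v \<in> carrier V"
  shows "(1 / 2) \<odot>\<^bsub>V\<^esub> (u \<oplus>\<^bsub>V\<^esub> v) \<oplus>\<^bsub>V\<^esub> (1 / 2) \<odot>\<^bsub>V\<^esub> (u \<oplus>\<^bsub>V\<^esub> (- 1) \<odot>\<^bsub>V\<^esub> v) = u"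
proof -
  have sc: "c \<odot>\<^bsub>V\<^esub> u \<in> carrier V" "c \<odot>\<^bsub>V\<^esub> v \<in> carrier V" for c :: complex using assms by auto
  have "(1 / 2) \<odot>\<^bsub>V\<^esub> (u \<oplus>\<^bsub>V\<^esub> v) \<oplus>\<^bsub>V\<^esub> (1 / 2) \<odot>\<^bsub>V\<^esub> (u \<oplus>\<^bsub>V\<^esub> (- 1) \<odot>\<^bsub>V\<^esub> v)
      = ((1 / 2) \<odot>\<^bsub>V\<^esub> u \<oplus>\<^bsub>V\<^esub> (1 / 2) \<odot>\<^bsub>V\<^esub> u) \<oplus>\<^bsub>V\<^esub> ((1 / 2) \<odot>\<^bsub>V\<^esub> v \<oplus>\<^bsub>V\<^esub> (- 1 / 2) \<odot>\<^bsub>V\<^esub> v)"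
    using assms sc V.smult_assoc1[of "1 / 2" "- 1" v]
    by (simp add: V.smult_r_distr V.a_assoc V.a_lcomm)
  also have "\<dots> = (1 / 2 + 1 / 2) \<odot>\<^bsub>V\<^esub> u \<oplus>\<^bsub>V\<^esub> (1 / 2 + - 1 / 2) \<odot>\<^bsub>V\<^esub> v"
    using assms V.smult_l_distr[of "1 / 2" "1 / 2" u] V.smult_l_distr[of "1 / 2" "- 1 / 2" v] by simp
  also have "\<dots> = u"
    using assms V.smult_one[of u] V.smult_l_null[of v] by simp
  finally show ?thesis .
qed

lemma T_finsum:
  assumes "finite J" "\<And>j. j \<in> J \<Longrightarrow> f j \<in> carrier V"
  shows "T (\<Oplus>\<^bsub>V\<^esub>j\<in>J. f j) = (\<Oplus>\<^bsub>V\<^esub>j\<in>J. T (f j))"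
  using assms
proof (induction J rule: finite_induct)
  case empty
  have "T \<zero>\<^bsub>V\<^esub> = \<zero>\<^bsub>V\<^esub>" using T_add[of "\<zero>\<^bsub>V\<^esub>" "\<zero>\<^bsub>V\<^esub>"] T_closed[of "\<zero>\<^bsub>V\<^esub>"] by simp
  then show ?case by simp
next
  case (insert j J)
  then have *: "f \<in> J \<rightarrow> carrier V" "f j \<in> carrier V" "(\<lambda>j. T (f j)) \<in> J \<rightarrow> carrier V"
    using T_closed by auto
  then have "(\<Oplus>\<^bsub>V\<^esub>i\<in>J. f i) \<in> carrier V" by (intro V.finsum_closed)
  then show ?case using insert * T_closed by (simp add: T_add)
qed

text \<open>The crossed homomorphisms supply n + k eigenfunctionals, whose dual vectors are the
  halves of (1 + h) y_a and (1 - h) y_a. That nothing else occurs follows from the projection onto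
  the span of these vectors: its fixed vectors form a subspace stable under \<open>T\<close> that
  contains the classes of all generators, hence everything.\<close>

lemma alexander_polynomial_eigenbasis:
  fixes x :: "nat \<Rightarrow> 'g"
  assumes k: "k \<le> n"
    and x: "\<And>a. a < n \<Longrightarrow> x a \<in> carrier G" "\<And>a. a < n \<Longrightarrow> deg (x a) = 1"
    and gens: "\<And>i. i \<in> {1..m} \<Longrightarrow> gen i = gen 1 \<or> (\<exists>a<n. gen i = x a)"
    and square: "\<And>g. g \<in> carrier G \<Longrightarrow> gen 1 \<otimes> gen 1 \<otimes> g = g \<otimes> (gen 1 \<otimes> gen 1)"
    and commute: "\<And>a. k \<le> a \<Longrightarrow> a < n \<Longrightarrow> gen 1 \<otimes> x a = x a \<otimes> gen 1"
    and crossed: "\<And>a \<mu>. \<mu> = 1 \<and> a < n \<or> \<mu> = - 1 \<and> a < k \<Longrightarrow>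
      \<exists>\<delta> :: 'g \<Rightarrow> complex.
        (\<forall>g\<in>carrier G. \<forall>h\<in>carrier G. \<delta> (g \<otimes> h) = \<delta> g + \<mu> powi deg g * \<delta> h) \<and>
        \<delta> (gen 1) = 0 \<and> (\<forall>b<n. \<delta> (x b) = (if b = a then 1 else 0))"
  shows "alexander_polynomial G S
    = Polynomial.smult ((- 1) ^ (n + k)) ([:- 1, 1:] ^ n * [:1, 1:] ^ k)"
proof -
  let ?d = "n + k"
  \<comment> \<open>An index \<open>i < n\<close> stands for eigenvalue 1 and the vector
    \<open>v i\<close>, an index \<open>n + a\<close> with \<open>a < k\<close> for eigenvalue -1
    and the vector \<open>v a\<close>.\<close>
  define \<sigma> :: "nat \<Rightarrow> complex" where "\<sigma> i = (if i < n then 1 else - 1)" for i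
  define v where "v a = tau (x a)" for a
  have vc: "v a \<in> carrier V" if "a < n" for a using tau_closed x(1) that by (simp add: v_def)
  have TT: "T (T u) = u" if "u \<in> carrier V" for u
    using T_funpow_eq_id[of "gen 1 \<otimes> gen 1" 2 u] square gen1 that
    by (simp add: numeral_2_eq_2)
  have normalize_x: "normalize (x a) = x a \<otimes> inv gen 1" if "a < n" for a
    using x(2)[OF that] gen1(1) by (simp add: normalize_def base_power_uminus base_power_1)
  define Q where "Q \<mu> a f \<longleftrightarrow>
      (\<forall>u\<in>carrier V. \<forall>w\<in>carrier V. f (u \<oplus>\<^bsub>V\<^esub> w) = f u + f w) \<and>
      (\<forall>c. \<forall>u\<in>carrier V. f (c \<odot>\<^bsub>V\<^esub> u) = c * f u) \<and>
      (\<forall>b<n. f (v b) = (if b = a then 1 else 0)) \<and>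
      (\<forall>u\<in>carrier V. f (T u) = \<mu> * f u)"
    for \<mu> :: complex and a and f :: "_ \<Rightarrow> complex"
  have functional: "\<exists>f. Q \<mu> a f" if \<mu>: "\<mu> = 1 \<and> a < n \<or> \<mu> = - 1 \<and> a < k" for \<mu> a
  proof -
    obtain \<delta> :: "'g \<Rightarrow> complex" where \<delta>: "\<And>g h. g \<in> carrier G \<Longrightarrow> h \<in> carrier G \<Longrightarrow>
        \<delta> (g \<otimes> h) = \<delta> g + \<mu> powi deg g * \<delta> h"
      "\<delta> (gen 1) = 0" "\<And>b. b < n \<Longrightarrow> \<delta> (x b) = (if b = a then 1 else 0)"
      using crossed[OF \<mu>] by blast
    have \<mu>0: "\<mu> \<noteq> 0" "inverse \<mu> = \<mu>" using \<mu> by auto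
    obtain f where f: "\<forall>u\<in>carrier V. \<forall>w\<in>carrier V. f (u \<oplus>\<^bsub>V\<^esub> w) = f u + (f w :: complex)"
      "\<forall>c. \<forall>u\<in>carrier V. f (c \<odot>\<^bsub>V\<^esub> u) = c * f u"
      "\<forall>g\<in>N. f (pure_tensor A (cls g)) = \<delta> g"
      "\<forall>u\<in>carrier V. f (T u) = inverse \<mu> * f u"
      using functional_of_crossed_hom[OF \<delta>(1) \<mu>0(1)] by blast
    have "\<delta> \<one> = 0" using \<delta>(1)[of \<one> \<one>] by (simp add: deg_one)
    then have "\<delta> (inv gen 1) = 0"
      using \<delta>(1)[of "gen 1" "inv gen 1"] \<delta>(2) gen1 \<mu>0 by simp
    then have "\<delta> (x b \<otimes> inv gen 1) = (if b = a then 1 else 0)" if "b < n" for b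
      using \<delta>(1)[of "x b" "inv gen 1"] \<delta>(3)[OF that] x(1)[OF that] gen1 by simp
    then have "f (v b) = (if b = a then 1 else 0)" if "b < n" for b
      using f(3) normalize_in_N[OF x(1)[OF that]] that by (simp add: v_def tau_def normalize_x)
    then show ?thesis using f(1,2,4) \<mu>0(2) unfolding Q_def by (intro exI[of _ f]) simp
  qed
  define R where "R i f \<longleftrightarrow> Q (\<sigma> i) (if i < n then i else i - n) f" for i f
  have "\<exists>f. R i f" if "i < ?d" for i
    unfolding R_def using that by (intro functional) (auto simp: \<sigma>_def)
  then obtain \<kappa> where R: "\<And>i. i < ?d \<Longrightarrow> R i (\<kappa> i)" by metis
  have \<kappa>add: "\<kappa> i (u \<oplus>\<^bsub>V\<^esub> w) = \<kappa> i u + \<kappa> i w" if "i < ?d" "u \<in> carrier V" "w \<in> carrier V" for i u w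
    using R[OF that(1)] that(2,3) unfolding R_def Q_def by blast
  have \<kappa>smult: "\<kappa> i (c \<odot>\<^bsub>V\<^esub> u) = c * \<kappa> i u" if "i < ?d" "u \<in> carrier V" for i c u
    using R[OF that(1)] that(2) unfolding R_def Q_def by blast
  have \<kappa>v: "\<kappa> i (v b) = (if b = (if i < n then i else i - n) then 1 else 0)" if "i < ?d" "b < n" for i b
    using R[OF that(1)] that(2) unfolding R_def Q_def by blast
  have \<kappa>T: "\<kappa> i (T u) = \<sigma> i * \<kappa> i u" if "i < ?d" "u \<in> carrier V" for i u
    using R[OF that(1)] that(2) unfolding R_def Q_def by blast
  define e where "e i = (let w = v (if i < n then i else i - n) in
      (1 / 2) \<odot>\<^bsub>V\<^esub> (w \<oplus>\<^bsub>V\<^esub> \<sigma> i \<odot>\<^bsub>V\<^esub> T w))" for i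
  have idx: "(if i < n then i else i - n) < n" if "i < ?d" for i using that k by auto
  have ec: "e i \<in> carrier V" if "i < ?d" for i
    using vc[OF idx[OF that]] T_closed by (simp add: e_def Let_def)
  have \<sigma>\<sigma>: "\<sigma> i * \<sigma> i = 1" for i by (simp add: \<sigma>_def)
  have Te: "T (e i) = \<sigma> i \<odot>\<^bsub>V\<^esub> e i" if "i < ?d" for i
  proof -
    let ?w = "v (if i < n then i else i - n)"
    have w: "?w \<in> carrier V" "T ?w \<in> carrier V" using vc[OF idx[OF that]] T_closed by auto
    have sw: "c \<odot>\<^bsub>V\<^esub> ?w \<in> carrier V" "c \<odot>\<^bsub>V\<^esub> T ?w \<in> carrier V" for c :: complex using w by auto
    have "T (e i) = (1 / 2) \<odot>\<^bsub>V\<^esub> (T ?w \<oplus>\<^bsub>V\<^esub> \<sigma> i \<odot>\<^bsub>V\<^esub> ?w)"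
      using w sw by (simp add: e_def Let_def T_smult T_add TT)
    moreover have "\<sigma> i \<odot>\<^bsub>V\<^esub> e i
        = (\<sigma> i * (1 / 2)) \<odot>\<^bsub>V\<^esub> (?w \<oplus>\<^bsub>V\<^esub> \<sigma> i \<odot>\<^bsub>V\<^esub> T ?w)"
      using w sw V.smult_assoc1[of "\<sigma> i" "1 / 2" "?w \<oplus>\<^bsub>V\<^esub> \<sigma> i \<odot>\<^bsub>V\<^esub> T ?w"]
      by (simp add: e_def Let_def)
    moreover have "\<dots> = (1 / 2) \<odot>\<^bsub>V\<^esub> (\<sigma> i \<odot>\<^bsub>V\<^esub> (?w \<oplus>\<^bsub>V\<^esub> \<sigma> i \<odot>\<^bsub>V\<^esub> T ?w))"
      using w sw V.smult_assoc1[of "1 / 2" "\<sigma> i" "?w \<oplus>\<^bsub>V\<^esub> \<sigma> i \<odot>\<^bsub>V\<^esub> T ?w"] by (simp add: mult.commute)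
    moreover have "\<sigma> i \<odot>\<^bsub>V\<^esub> (?w \<oplus>\<^bsub>V\<^esub> \<sigma> i \<odot>\<^bsub>V\<^esub> T ?w) = T ?w \<oplus>\<^bsub>V\<^esub> \<sigma> i \<odot>\<^bsub>V\<^esub> ?w"
      using w sw V.smult_assoc1[of "\<sigma> i" "\<sigma> i" "T ?w"] V.smult_one[of "T ?w"] \<sigma>\<sigma>[of i]
      by (simp add: V.smult_r_distr V.a_comm)
    ultimately show ?thesis by simp
  qed
  \<comment> \<open>The value is half of \<open>1 + \<sigma> j * \<sigma> i\<close> times that of
    \<open>\<kappa> i\<close> at \<open>?w\<close>: opposite signs cancel, equal signs leave the
    dual pairing.\<close>
  have \<kappa>e: "\<kappa> i (e j) = (if i = j then 1 else 0)" if ij: "i < ?d" "j < ?d" for i j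
  proof -
    let ?w = "v (if j < n then j else j - n)"
    have w: "?w \<in> carrier V" "T ?w \<in> carrier V" "\<sigma> j \<odot>\<^bsub>V\<^esub> T ?w \<in> carrier V"
      using vc[OF idx[OF ij(2)]] T_closed by auto
    have "\<kappa> i (e j) = (1 / 2) * (\<kappa> i ?w + \<sigma> j * (\<sigma> i * \<kappa> i ?w))"
      using w by (simp add: e_def Let_def \<kappa>smult[OF ij(1)] \<kappa>add[OF ij(1)] \<kappa>T[OF ij(1)])
    then show ?thesis
      unfolding \<kappa>v[OF ij(1) idx[OF ij(2)]]
      using ij by (cases "i < n"; cases "j < n") (auto simp: \<sigma>_def)
  qed
  \<comment> \<open>\<open>L\<close> projects onto the span of the \<open>e i\<close>; once it is
    the identity, the coordinates are injective.\<close>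
  define L where "L u = (\<Oplus>\<^bsub>V\<^esub>i\<in>{..<?d}. \<kappa> i u \<odot>\<^bsub>V\<^esub> e i)" for u
  have ecs: "c \<odot>\<^bsub>V\<^esub> e i \<in> carrier V" if "i < ?d" for i and c :: complex using ec[OF that] by simp
  have Ladd: "L (u \<oplus>\<^bsub>V\<^esub> w) = L u \<oplus>\<^bsub>V\<^esub> L w" if "u \<in> carrier V" "w \<in> carrier V" for u w
  proof -
    have "L (u \<oplus>\<^bsub>V\<^esub> w) = (\<Oplus>\<^bsub>V\<^esub>i\<in>{..<?d}. \<kappa> i u \<odot>\<^bsub>V\<^esub> e i \<oplus>\<^bsub>V\<^esub> \<kappa> i w \<odot>\<^bsub>V\<^esub> e i)"
      unfolding L_def
      by (rule V.finsum_cong') (use that ec V.smult_l_distr in \<open>auto simp: \<kappa>add\<close>)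
    also have "\<dots> = L u \<oplus>\<^bsub>V\<^esub> L w"
      unfolding L_def by (rule V.finsum_addf) (use ecs in auto)
    finally show ?thesis .
  qed
  have Lsmult: "L (c \<odot>\<^bsub>V\<^esub> u) = c \<odot>\<^bsub>V\<^esub> L u" if "u \<in> carrier V" for c u
  proof -
    have "L (c \<odot>\<^bsub>V\<^esub> u) = (\<Oplus>\<^bsub>V\<^esub>i\<in>{..<?d}. c \<odot>\<^bsub>V\<^esub> (\<kappa> i u \<odot>\<^bsub>V\<^esub> e i))"
      unfolding L_def
      by (rule V.finsum_cong') (use that ec V.smult_assoc1 in \<open>auto simp: \<kappa>smult\<close>)
    also have "\<dots> = c \<odot>\<^bsub>V\<^esub> L u"
      unfolding L_def by (rule V.finsum_smult[symmetric]) (use ecs in auto)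
    finally show ?thesis .
  qed
  have LT: "L (T u) = T (L u)" if "u \<in> carrier V" for u
  proof -
    have "T (L u) = (\<Oplus>\<^bsub>V\<^esub>i\<in>{..<?d}. T (\<kappa> i u \<odot>\<^bsub>V\<^esub> e i))"
      unfolding L_def by (rule T_finsum) (use ecs in auto)
    also have "\<dots> = L (T u)"
      unfolding L_def
    proof (rule V.finsum_cong')
      fix i assume "i \<in> {..<?d}"
      then have i: "i < ?d" by simp
      show "T (\<kappa> i u \<odot>\<^bsub>V\<^esub> e i) = \<kappa> i (T u) \<odot>\<^bsub>V\<^esub> e i"
        using V.smult_assoc1[of "\<kappa> i u" "\<sigma> i" "e i"] ec[OF i]
        by (simp add: T_smult Te[OF i] \<kappa>T[OF i that] mult.commute)
    qed (use ecs in auto)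
    finally show ?thesis by simp
  qed
  have Le: "L (e j) = e j" if j: "j < ?d" for j
  proof -
    have "L (e j) = (\<Oplus>\<^bsub>V\<^esub>i\<in>{..<?d}. if j = i then e i else \<zero>\<^bsub>V\<^esub>)"
      unfolding L_def
      by (rule V.finsum_cong') (use ec j V.smult_one V.smult_l_null in \<open>auto simp: \<kappa>e\<close>)
    also have "\<dots> = e j"
      using j ec by (intro V.add.finprod_singleton) auto
    finally show ?thesis .
  qed
  define W where "W = {u \<in> carrier V. L u = u}"
  have Wadd: "u \<oplus>\<^bsub>V\<^esub> w \<in> W" if "u \<in> W" "w \<in> W" for u w using that by (simp add: W_def Ladd)
  have Wsmult: "c \<odot>\<^bsub>V\<^esub> u \<in> W" if "u \<in> W" for c u using that by (simp add: W_def Lsmult)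
  have WT: "T u \<in> W" if "u \<in> W" for u using that by (simp add: W_def LT T_closed)
  have We: "e i \<in> W" if "i < ?d" for i using ec Le that by (simp add: W_def)
  \<comment> \<open>For \<open>a < k\<close> both components of \<open>v a\<close> are among the
    \<open>e i\<close>. Otherwise \<open>x a\<close> commutes with \<open>gen 1\<close>, so
    \<open>T\<close> fixes \<open>v a\<close> and the component for -1 is zero.\<close>
  have Wv: "v a \<in> W" if a: "a < n" for a
  proof (cases "a < k")
    case True
    have "v a = e a \<oplus>\<^bsub>V\<^esub> e (n + a)"
      using half_sum_half_difference[OF vc[OF a] T_closed[OF vc[OF a]]] a T_closed[OF vc[OF a]]
        V.smult_one[of "T (v a)"]
      by (simp add: e_def Let_def \<sigma>_def)
    then show ?thesis using Wadd[OF We We, of a "n + a"] a True by simp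
  next
    case False
    have "inv gen 1 \<otimes> (x a \<otimes> inv gen 1) \<otimes> gen 1 = x a \<otimes> inv gen 1"
      using x(1)[OF a] gen1(1) commute[of a] a False
      by (simp add: m_assoc) (metis inv_closed inv_solve_left m_assoc m_closed r_inv r_one)
    then have "T (v a) = v a"
      using aut_cls[OF normalize_in_N[OF x(1)[OF a]] gen1]
        T_pure[OF cls_in_carrier[OF normalize_in_N[OF x(1)[OF a]]]]
      by (simp add: v_def tau_def normalize_x[OF a])
    then have "v a = e a"
      using half_sum_half_difference[OF vc[OF a] vc[OF a]] vc[OF a] a V.smult_one[of "v a"]
        V.smult_minus_1[of "v a"] V.r_neg[of "v a"]
      by (simp add: e_def Let_def \<sigma>_def class_ring_simps)
    then show ?thesis using We[of a] a by simp
  qed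
  have tau_one: "tau \<one> = \<zero>\<^bsub>V\<^esub>"
  proof -
    have "normalize \<one> = \<one>" by (simp add: normalize_def deg_one base_power_0)
    then have "tau \<one> \<oplus>\<^bsub>V\<^esub> tau \<one> = tau \<one>"
      using pure_tensor_mult[OF monoid_alexander_module cls_in_carrier cls_in_carrier, of \<one> \<one>]
        cls_mult[of \<one> \<one>] by (simp add: tau_def mem_N deg_one)
    then show ?thesis using tau_closed[of \<one>] by simp
  qed
  have Wzero: "\<zero>\<^bsub>V\<^esub> \<in> W"
    using Lsmult[of "\<zero>\<^bsub>V\<^esub>" 0] V.smult_l_null[of "\<zero>\<^bsub>V\<^esub>"] V.smult_l_null[of "L \<zero>\<^bsub>V\<^esub>"] ecs
    by (simp add: W_def L_def V.finsum_closed Pi_I)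
  have Wgen: "tau (gen i) \<in> W" if "i \<in> {1..m}" for i
  proof -
    have "tau (gen 1) = tau \<one>"
      by (simp add: tau_def normalize_gen_1 normalize_def[of \<one>] deg_one base_power_0)
    then have "tau (gen 1) \<in> W" using Wzero tau_one by simp
    then show ?thesis using gens[OF that] Wv by (auto simp: v_def)
  qed
  have Wtau: "tau g \<in> W" if "g \<in> carrier G" for g
    using that
  proof (induction g rule: gen_induct)
    case one
    then show ?case using Wzero tau_one by simp
  next
    case (gen i g)
    then show ?case
      using tau_mult[OF TT gen_closed, of i g] Wadd[OF Wgen WT] by (simp add: deg_gen)
  next
    case (inv i g)
    note gi = gen_closed[OF inv(1)]
    \<comment> \<open>The product rule applied to a generator times its inverse expresses the class
      of the inverse through that of the generator.\<close>
    have "tau (gen i) \<oplus>\<^bsub>V\<^esub> T (tau (inv gen i)) = \<zero>\<^bsub>V\<^esub>"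
      using tau_mult[OF TT gi inv_closed[OF gi]] gi tau_one inv(1) by (simp add: deg_gen)
    then have "T (tau (inv gen i)) = (- 1) \<odot>\<^bsub>V\<^esub> tau (gen i)"
      using V.minus_equality[of "T (tau (inv gen i))" "tau (gen i)"] V.smult_minus_1[of "tau (gen i)"]
        T_closed tau_closed gi inv_closed[OF gi] V.a_comm
      by (simp add: class_ring_simps)
    then have "T (tau (inv gen i)) \<in> W" using Wsmult[OF Wgen[OF inv(1)]] by simp
    then have "tau (inv gen i) \<in> W" using WT TT[OF tau_closed[OF inv_closed[OF gi]]] by metis
    then show ?case
      using tau_mult[OF TT inv_closed[OF gi] inv(2)] Wadd[OF _ WT[OF inv(3)]] gi inv(1)
      by (simp add: deg_gen)
  qed
  have WV: "L u = u" if "u \<in> carrier V" for u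
  proof -
    have "u \<in> W"
      using that
    proof (induction u rule: V_induct)
      case (pure a)
      then obtain g where g: "g \<in> N" "a = cls g" by (auto simp: carrier_alexander_module)
      then show ?case using Wtau[OF N_closed[OF g(1)]] by (simp add: tau_def normalize_N)
    qed (simp_all add: Wadd Wsmult)
    then show ?thesis by (simp add: W_def)
  qed
  have coords: "coordinates V ?d \<kappa>"
    unfolding coordinates_def
  proof (intro conjI allI ballI impI)
    fix u w assume uw: "u \<in> carrier V" "w \<in> carrier V" "\<forall>i<?d. \<kappa> i u = \<kappa> i w"
    have "L u = L w" unfolding L_def by (rule V.finsum_cong') (use uw ecs in auto)
    then show "u = w" using WV uw by simp
  next
    fix y :: "nat \<Rightarrow> complex"
    let ?u = "\<Oplus>\<^bsub>V\<^esub>j\<in>{..<?d}. y j \<odot>\<^bsub>V\<^esub> e j"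
    have uc: "?u \<in> carrier V" by (rule V.finsum_closed) (use ecs in auto)
    have "\<kappa> i (\<Oplus>\<^bsub>V\<^esub>j\<in>J. y j \<odot>\<^bsub>V\<^esub> e j) = (\<Sum>j\<in>J. if j = i then y i else 0)"
      if i: "i < ?d" and J: "finite J" "J \<subseteq> {..<?d}" for i J
      using J
    proof (induction J rule: finite_induct)
      case empty
      have "\<kappa> i \<zero>\<^bsub>V\<^esub> = 0" using \<kappa>add[OF i, of "\<zero>\<^bsub>V\<^esub>" "\<zero>\<^bsub>V\<^esub>"] by simp
      then show ?case by simp
    next
      case (insert j J)
      have c: "(\<lambda>j. y j \<odot>\<^bsub>V\<^esub> e j) \<in> J \<rightarrow> carrier V" "y j \<odot>\<^bsub>V\<^esub> e j \<in> carrier V"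
        using insert.prems ecs by auto
      then have "(\<Oplus>\<^bsub>V\<^esub>j\<in>J. y j \<odot>\<^bsub>V\<^esub> e j) \<in> carrier V" by (intro V.finsum_closed)
      then show ?case
        using insert c ec by (simp add: \<kappa>add[OF i] \<kappa>smult[OF i] \<kappa>e[OF i])
    qed
    from this[of _ "{..<?d}"] show "\<exists>u\<in>carrier V. \<forall>i<?d. \<kappa> i u = y i"
      using uc by (intro bexI[of _ ?u]) auto
  qed (use \<kappa>add \<kappa>smult in auto)
  define M where "M = mat ?d ?d (\<lambda>(i, j). if i = j then \<sigma> i else 0)"
  have M: "M \<in> carrier_mat ?d ?d" by (simp add: M_def)
  have MT: "\<kappa> i (T u) = (\<Sum>j<?d. M $$ (i, j) * \<kappa> j u)" if "i < ?d" "u \<in> carrier V" for i u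
  proof -
    have "(\<Sum>j<?d. M $$ (i, j) * \<kappa> j u) = (\<Sum>j<?d. if j = i then \<sigma> i * \<kappa> i u else 0)"
      using that by (intro sum.cong) (auto simp: M_def)
    then show ?thesis using that by (simp add: \<kappa>T)
  qed
  note det = det_minus_t_coordinates[where T = T, OF vectorspace_V coords M T_closed MT]
  have "diag_mat M = map \<sigma> [0..<?d]" by (auto simp: diag_mat_def M_def)
  moreover have "upper_triangular M" by (auto simp: M_def)
  moreover have "[0..<?d] = [0..<n] @ [n..<?d]" by (rule upt_add_eq_append) simp
  moreover have "(\<Prod>a\<leftarrow>map \<sigma> [0..<n]. [:- a, 1:]) = [:- 1, 1:] ^ n"
  proof -
    have "map \<sigma> [0..<n] = replicate n 1" by (rule nth_equalityI) (auto simp: \<sigma>_def)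
    then show ?thesis by simp
  qed
  moreover have "(\<Prod>a\<leftarrow>map \<sigma> [n..<?d]. [:- a, 1:]) = [:1, 1:] ^ k"
  proof -
    have "map \<sigma> [n..<?d] = replicate k (- 1)" by (rule nth_equalityI) (auto simp: \<sigma>_def)
    then show ?thesis by simp
  qed
  ultimately have "char_poly M = [:- 1, 1:] ^ n * [:1, 1:] ^ k"
    using char_poly_upper_triangular[OF M] by simp
  moreover have "(- 1 :: complex poly) ^ d = [:(- 1) ^ d:]" for d
    by (induction d) (simp_all add: one_pCons)
  ultimately show ?thesis
    using det by (simp add: alexander_polynomial_def Let_def)
qed

end

text \<open>In the following presentation the generators come in equal pairs
  \<open>x\<^bsub>2a-1\<^esub> = x\<^bsub>2a\<^esub>\<close>, so that in the representation by point reflections of the complex plane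
  the product of all generators is trivial; moreover \<open>x\<^sub>1\<^sup>2\<close> is central, and \<open>x\<^sub>i\<close> commutes
  with \<open>x\<^sub>1\<close> for \<open>i > 2k + 2\<close>. The self-relations \<open>w\<^bsub>i,i,1\<^esub>\<close>, \<open>w\<^bsub>i,i,2\<^esub>\<close>, \<open>w\<^bsub>i,i,3\<^esub>\<close> express
  these in turn.\<close>

definition example_length :: "nat \<Rightarrow> nat \<Rightarrow> nat" where
  "example_length i j = (if i = j then 3 else if Suc i div 2 = Suc j div 2 then 1 else 0)"

definition example_word :: "nat \<Rightarrow> nat \<Rightarrow> nat \<Rightarrow> nat \<Rightarrow> nat \<Rightarrow> nat word" where
  "example_word m k i j q =
     (let F = free_group {1..m} in
      if i \<noteq> j then \<one>\<^bsub>F\<^esub>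
      else if q = 1 then foldr (\<otimes>\<^bsub>F\<^esub>) (map free_gen [1..<Suc m]) \<one>\<^bsub>F\<^esub>
      else if q = 2 then free_gen 1 \<otimes>\<^bsub>F\<^esub> free_gen 1
      else if i > 2 * k + 2 then free_gen 1
      else \<one>\<^bsub>F\<^esub>)"

lemma example_presentation:
  assumes "1 \<le> m"
  shows "hurwitz_C_presentation m example_length (example_word m k)"
proof -
  interpret F: group "free_group {1..m}" by (rule group_free_group)
  have prod: "foldr (\<otimes>\<^bsub>free_group {1..m}\<^esub>) (map free_gen xs) \<one>\<^bsub>free_group {1..m}\<^esub>
      \<in> carrier (free_group {1..m})" if "set xs \<subseteq> {1..m}" for xs
    using that by (induction xs) (simp_all add: free_gen_closed)
  have "set [1..<Suc m] \<subseteq> {1..m}" by auto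
  note product_closed = prod[OF this]
  have "example_word m k i j q \<in> carrier (free_group {1..m})" for i j q
    using assms product_closed free_gen_closed[of 1 "{1..m}"]
    by (auto simp: example_word_def Let_def simp del: upt_Suc)
  then show ?thesis
    using assms by (simp add: hurwitz_C_presentation_def C_presentation_def example_length_def
        example_word_def[of m k _ _ 1] Let_def)
qed

text \<open>The affine map with linear part -1 is an involution, so two equal neighbours contribute
  the identity whatever their translation part.\<close>

lemma paired_product_affine:
  assumes "\<And>a. c (2 * a + 1) = c (2 * a + 2)"
  shows "foldr (\<otimes>\<^bsub>affine_group\<^esub>) (map (\<lambda>i. (- 1, c i)) [1..<Suc (2 * n)]) (1, 0) = (1, 0)"
proof (induction n)
  case (Suc n)
  have "[1..<Suc (2 * Suc n)] = [1..<Suc (2 * n)] @ [2 * n + 1, 2 * n + 2]" by simp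
  then show ?case using Suc assms[of n] by (simp del: upt_Suc)
qed simp

lemma hurwitz_C_group_exists:
  assumes k: "k \<le> n"
  shows "\<exists>(G :: nat word set monoid) S. hurwitz_C_group G S \<and>
    alexander_polynomial G S = Polynomial.smult ((- 1) ^ (n + k)) ([:- 1, 1:] ^ n * [:1, 1:] ^ k)"
proof -
  \<comment> \<open>There are n + 1 pairs: the first contains the base generator x_1, each other one
    gives one y_a.\<close>
  define m where "m = 2 * n + 2"
  let ?l = example_length and ?w = "example_word m k"
  let ?G = "C_presented_group m ?l ?w" and ?S = "C_presented_generators m ?l ?w"
  have one_m: "1 \<in> {1..m}" by (simp add: m_def)
  have hur: "hurwitz_C_presentation m ?l ?w" by (rule example_presentation) (simp add: m_def)
  then have pres: "C_presentation m ?l ?w" by (simp add: hurwitz_C_presentation_def)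
  interpret F: group "free_group {1..m}" by (rule group_free_group)
  have grp: "group ?G"
    unfolding C_presented_group_def
    by (rule normal.factorgroup_is_group[OF F.normal_closure_normal[OF C_relators_closed[OF pres]]])
  have id: "id \<in> iso ?G ?G" by (auto simp: iso_def hom_def bij_betw_def)
  interpret C_group ?G ?S m ?l ?w id
    by (intro C_group.intro C_group_axioms.intro grp pres id) simp
  have "hurwitz_C_group ?G ?S"
    unfolding hurwitz_C_group_def has_C_presentation_def
    using hur pres grp id by (intro exI[of _ m] exI[of _ ?l] exI[of _ ?w] conjI bexI[of _ id]) auto
  moreover have "alexander_polynomial ?G ?S
      = Polynomial.smult ((- 1) ^ (n + k)) ([:- 1, 1:] ^ n * [:1, 1:] ^ k)"
  \<comment> \<open>Pair 1 consists of the indices 1 and 2, so \<open>2 * a + 3\<close> is the first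
    index of pair \<open>a + 2\<close>.\<close>
  proof (rule alexander_polynomial_eigenbasis[where x = "\<lambda>a. gen (2 * a + 3)", OF k])
    fix a assume "a < n"
    then have "2 * a + 3 \<in> {1..m}" by (simp add: m_def)
    then show "gen (2 * a + 3) \<in> carrier ?G" "deg (gen (2 * a + 3)) = 1"
      by (rule gen_closed, rule deg_gen)
  next
    fix i assume i: "i \<in> {1..m}"
    \<comment> \<open>The relation between distinct members of a pair has the trivial word, so it
      identifies them.\<close>
    have same: "gen i = gen j" if "j \<in> {1..m}" "i \<noteq> j" "Suc i div 2 = Suc j div 2" for j
      using relation[OF i that(1), of 1] that gen_closed[OF that(1)]
      by (simp add: example_length_def example_word_def one_free_group)
    consider "i = 1" | "i = 2" | a where "a < n" "i = 2 * a + 3" | a where "a < n" "i = 2 * a + 4"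
    proof -
      have "i = 1 \<or> i = 2 \<or> i = 2 * ((i - 3) div 2) + 3 \<and> (i - 3) div 2 < n
          \<or> i = 2 * ((i - 3) div 2) + 4 \<and> (i - 3) div 2 < n"
        using i by (simp add: m_def; presburger)
      then show thesis using that by blast
    qed
    then show "gen i = gen 1 \<or> (\<exists>a<n. gen i = gen (2 * a + 3))"
    proof cases
      case 2
      then show ?thesis using same[of 1] by (simp add: m_def)
    next
      case 4
      then show ?thesis using same[of "2 * a + 3"] by (auto simp: m_def)
    qed auto
  next
    have "gen 1 \<otimes>\<^bsub>?G\<^esub> gen 1 \<otimes>\<^bsub>?G\<^esub> gen i = gen i \<otimes>\<^bsub>?G\<^esub> (gen 1 \<otimes>\<^bsub>?G\<^esub> gen 1)" if i: "i \<in> {1..m}" for i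
    proof -
      have "word_eval ?G gen (?w i i 2) = gen 1 \<otimes>\<^bsub>?G\<^esub> gen 1"
        using hom_mult[OF word_eval_hom[OF gen_fun] free_gen_closed free_gen_closed, of 1 1] one_m
          word_eval_free_gen[OF gen_fun, of 1] one_m
        by (simp add: example_word_def Let_def)
      then show ?thesis using self_relation_commutes[OF i, of 2] by (simp add: example_length_def)
    qed
    then show "gen 1 \<otimes>\<^bsub>?G\<^esub> gen 1 \<otimes>\<^bsub>?G\<^esub> g = g \<otimes>\<^bsub>?G\<^esub> (gen 1 \<otimes>\<^bsub>?G\<^esub> gen 1)" if "g \<in> carrier ?G" for g
      using central_of_commutes_gen[of "gen 1 \<otimes>\<^bsub>?G\<^esub> gen 1"] that gen1 by simp
  next
    fix a assume a: "k \<le> a" "a < n"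
    let ?i = "2 * a + 3"
    have "word_eval ?G gen (?w ?i ?i 3) = gen 1"
      using a word_eval_free_gen[OF gen_fun, of 1] one_m by (simp add: example_word_def Let_def)
    then show "gen 1 \<otimes>\<^bsub>?G\<^esub> gen ?i = gen ?i \<otimes>\<^bsub>?G\<^esub> gen 1"
      using self_relation_commutes[of ?i 3] a by (simp add: example_length_def m_def)
  next
    fix a and \<mu> :: complex assume a: "\<mu> = 1 \<and> a < n \<or> \<mu> = - 1 \<and> a < k"
    \<comment> \<open>\<open>Suc i div 2\<close> is the number of the pair containing
      \<open>i\<close>; the prescribed values are the indicator of pair
      \<open>a + 2\<close>.\<close>
    define c :: "nat \<Rightarrow> complex" where "c i = (if Suc i div 2 = a + 2 then 1 else 0)" for i
    have "\<exists>\<delta>. (\<forall>g\<in>carrier ?G. \<forall>h\<in>carrier ?G. \<delta> (g \<otimes>\<^bsub>?G\<^esub> h) = \<delta> g + \<mu> powi deg g * \<delta> h) \<and>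
        (\<forall>i\<in>{1..m}. \<delta> (gen i) = c i)"
    proof (rule crossed_hom_exists)
      show "\<mu> \<noteq> 0" using a by auto
      fix i j q W assume i: "i \<in> {1..m}" and j: "j \<in> {1..m}" and q: "q \<in> {1..?l i j}"
        and W: "W = word_eval affine_group (\<lambda>i. (\<mu>, c i)) (?w i j q)"
      have cij: "c i = c j" using q by (auto simp: c_def example_length_def split: if_splits)
      show "fst W * c i = c j - (1 - \<mu>) * snd W"
      proof (cases "\<mu> = 1")
        case True
        then show ?thesis using cij by (simp add: W fst_word_eval_affine_one)
      next
        case False
        then have \<mu>: "\<mu> = - 1" "a < k" using a by auto
        interpret Aff: group affine_group by (rule group_affine_group)
        have cf: "(\<lambda>i. (\<mu>, c i)) \<in> {1..m} \<rightarrow> carrier affine_group" using \<mu> by simp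
        have c1: "c 1 = 0" by (simp add: c_def)
        note gen_eval = Aff.word_eval_free_gen[OF cf one_m]
        \<comment> \<open>Every word evaluates to the identity, except the third self-relation
          beyond index \<open>2 * k + 2\<close>, which gives z -> -z. There \<open>c i = 0\<close>,
          because \<open>a < k\<close> places pair \<open>a + 2\<close> among the first k + 1
          pairs.\<close>
        have "W = (1, 0) \<or> i > 2 * k + 2 \<and> W = (- 1, 0)"
        proof -
          have "word_eval affine_group (\<lambda>i. (\<mu>, c i))
              (foldr (\<otimes>\<^bsub>free_group {1..m}\<^esub>) (map free_gen [1..<Suc m]) \<one>\<^bsub>free_group {1..m}\<^esub>) = (1, 0)"
            using paired_product_affine[of c "n + 1"] \<mu>
            by (subst Aff.word_eval_foldr_free_gen[OF cf]) (auto simp: c_def m_def simp del: upt_Suc)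
          moreover have "word_eval affine_group (\<lambda>i. (\<mu>, c i))
              (free_gen 1 \<otimes>\<^bsub>free_group {1..m}\<^esub> free_gen 1) = (1, 0)"
            using hom_mult[OF Aff.word_eval_hom[OF cf] free_gen_closed free_gen_closed, of 1 1] one_m
              gen_eval \<mu> c1 by simp
          moreover have "word_eval affine_group (\<lambda>i. (\<mu>, c i)) (free_gen 1) = (- 1, 0)"
            using gen_eval \<mu> c1 by simp
          ultimately show ?thesis
            unfolding W example_word_def Let_def by (auto simp: one_free_group simp del: upt_Suc)
        qed
        moreover have "c i = 0" if "i > 2 * k + 2"
          using that \<mu>(2) by (auto simp: c_def)
        ultimately show ?thesis using cij by auto
      qed
    qed
    then show "\<exists>\<delta>. (\<forall>g\<in>carrier ?G. \<forall>h\<in>carrier ?G. \<delta> (g \<otimes>\<^bsub>?G\<^esub> h) = \<delta> g + \<mu> powi deg g * \<delta> h) \<and>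
        \<delta> (gen 1) = 0 \<and> (\<forall>b<n. \<delta> (gen (2 * b + 3)) = (if b = a then 1 else 0))"
    proof (elim exE conjE, intro exI conjI)
      fix \<delta> assume "\<forall>i\<in>{1..m}. \<delta> (gen i) = c i"
      then show "\<delta> (gen 1) = 0" "\<forall>b<n. \<delta> (gen (2 * b + 3)) = (if b = a then 1 else 0)"
        by (auto simp: c_def m_def)
    qed
  qed
  ultimately show ?thesis by blast
qed

text \<open>\<open>nat word set\<close> is the carrier type of presented groups, so the example
  itself is the witness, with \<open>id\<close> as isomorphism; the bound is proved for every
  carrier type. The factor \<open>[:- 1, 1:]\<close> is t - 1 and \<open>[:1, 1:]\<close> is t +
  1.\<close>

theorem theorem0p3:
  fixes n k :: nat
  shows "(\<exists>(G :: nat word set monoid) S.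
            hurwitz_C_group G S \<and>
            alexander_polynomial G S =
              Polynomial.smult ((- 1) ^ (n + k)) ([:- 1, 1:] ^ n * [:1, 1:] ^ k))
         \<longleftrightarrow> n \<ge> k"
proof
  assume "k \<le> n"
  then show "\<exists>(G :: nat word set monoid) S. hurwitz_C_group G S \<and> alexander_polynomial G S =
      Polynomial.smult ((- 1) ^ (n + k)) ([:- 1, 1:] ^ n * [:1, 1:] ^ k)"
    by (rule hurwitz_C_group_exists)
next
  assume "\<exists>(G :: nat word set monoid) S. hurwitz_C_group G S \<and> alexander_polynomial G S =
      Polynomial.smult ((- 1) ^ (n + k)) ([:- 1, 1:] ^ n * [:1, 1:] ^ k)"
  then obtain G :: "nat word set monoid" and S m l w \<phi> where
    P: "alexander_polynomial G S =
      Polynomial.smult ((- 1) ^ (n + k)) ([:- 1, 1:] ^ n * [:1, 1:] ^ k)"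
    and hur: "hurwitz_C_presentation m l w" and G: "group G" "C_presentation m l w"
    and \<phi>: "\<phi> \<in> iso (C_presented_group m l w) G" "\<phi> ` C_presented_generators m l w = S"
    unfolding hurwitz_C_group_def has_C_presentation_def by blast
  interpret C_group G S m l w \<phi>
    by (intro C_group.intro C_group_axioms.intro G \<phi>)
  show "k \<le> n" by (rule hurwitz_alexander_polynomial_bound[OF hur P]) simp
qed

end
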